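(* Let $\mathbb{T}$ be a geometric theory, let $s,t\colon G^{\mathbb{T}}_1\rightrightarrows G^{\mathbb{T}}_0$ be the source and target maps of the localic groupoid $G^{\mathbb{T}}$ described in the context, and let $\pi_0(G^{\mathbb{T}})$ be the coequaliser of $s$ and $t$ in the category of locales (the locale of isomorphism classes of $G^{\mathbb{T}}$). Then the frame $\mathcal{O}\pi_0(G^{\mathbb{T}})$ is isomorphic to the frame of sentences of $\mathbb{T}$, i.e. the frame whose elements are the $\mathbb{T}$-provable equivalence classes of geometric formulae without free variables, ordered by $\mathbb{T}$-provability.
   Context: **Geometric theories.** A (first-order) geometric theory $\mathbb{T}$ consists of a set of sorts, a set of relation symbols $R \subseteq X^1 \times \dots \times X^k$ ($k \ge 0$; there are no function symbols, functions being treated as relations), and a set of axioms, which are sequents $\phi \vdash_{x_1\colon X^1,\dots,x_k\colon X^k} \psi$ between geometric formulae, i.e. formulae built from relation symbols and equality using finite conjunctions, arbitrary (set-indexed) disjunctions and $\exists$. Provability is in (infinitary, first-order) geometric logic. A theory is propositional if it has no sorts. The classifying locale of a propositional geometric theory is the locale whose frame is presented by the basic propositions as generators and a relation $\phi\le\psi$ for each axiom $\phi\vdash\psi$. $\mathcal{O}X$ denotes the frame of a locale $X$ and $f^*\colon \mathcal{O}Y\to\mathcal{O}X$ the frame homomorphism of a locale map $f\colon X\to Y$. **The propositional theory $P[\mathbb{T}]$.** It has the following basic propositions and axioms. (1) For each sort $X$ of $\mathbb{T}$: a basic proposition $[n\sim^X m]$ for all $n,m\in\mathbb{N}$, and axioms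 $[n\sim^X m]\vdash[m\sim^X n]$ and $[n\sim^X m]\wedge[m\sim^X \ell]\vdash[n\sim^X\ell]$ for all $n,m,\ell\in\mathbb{N}$. (2) For each relation symbol $R\subseteq X^1\times\dots\times X^k$ of $\mathbb{T}$ (not including equality) and all $n_1,\dots,n_k,m_1,\dots,m_k\in\mathbb{N}$: a basic proposition $[(n_1,\dots,n_k)\in R]$ and axioms $[(n_1,\dots,n_k)\in R]\wedge[n_1\sim^{X^1}m_1]\wedge\dots\wedge[n_k\sim^{X^k}m_k]\vdash[(m_1,\dots,m_k)\in R]$ and $[(n_1,\dots,n_k)\in R]\vdash[n_1\sim^{X^1}n_1]\wedge\dots\wedge[n_k\sim^{X^k}n_k]$. (3) For each axiom $\phi\vdash_{x_1\colon X^1,\dots,x_k\colon X^k}\psi$ of $\mathbb{T}$ and all $n_1,\dots,n_k\in\mathbb{N}$: the axiom $\bigwedge_{i=1}^k[n_i\sim^{X^i}n_i]\wedge\phi_{n_1,\dots,n_k}\vdash\psi_{n_1,\dots,n_k}$, where $\phi_{n_1,\dots,n_k},\psi_{n_1,\dots,n_k}$ are obtained from $\phi,\psi$ by replacing each free variable $x_i$ by the (fixed) natural number $n_i$, each quantifier $\exists x\colon X.\ \chi(x,\dots)$ by the join $\bigvee_{n_x\in\mathbb{N}}\chi(n_x,\dots)$, each subformula $(y_1,\dots,y_\ell)\in R$ by $[(y_1,\dots,y_\ell)\in R]$, and each subformula $x=_X y$ by $[x\sim^X y]$. **The theory $\mathbb{T}_{\cong}$** of isomorphisms of $\mathbb{T}$-models.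 It has: two copies of $\mathbb{T}$ (sorts $X_1,X_2$, relation symbols $R_1,R_2$, and both copies of each axiom, the subscript-$i$ copy being over the subscript-$i$ sorts); for each sort $X$ of $\mathbb{T}$ a relation symbol $\alpha^X\subseteq X_1\times X_2$ with the axioms $(x,y)\in\alpha^X\wedge(x',y')\in\alpha^X\wedge x=_{X_1}x'\ \dashv\vdash_{x,x'\colon X_1,\,y,y'\colon X_2}\ (x,y)\in\alpha^X\wedge(x',y')\in\alpha^X\wedge y=_{X_2}y'$, $\ \vdash_{y\colon X_2}\exists x\colon X_1.\,(x,y)\in\alpha^X$, and $\ \vdash_{x\colon X_1}\exists y\colon X_2.\,(x,y)\in\alpha^X$; and for each relation symbol $R\subseteq X^1\times\dots\times X^k$ of $\mathbb{T}$ the axioms $\bigwedge_{i=1}^k(x_i,y_i)\in\alpha^{X^i}\wedge(x_1,\dots,x_k)\in R_1\ \dashv\vdash_{x_1,\dots,x_k,y_1,\dots,y_k}\ \bigwedge_{i=1}^k(x_i,y_i)\in\alpha^{X^i}\wedge(y_1,\dots,y_k)\in R_2$. ($\dashv\vdash$ denotes a sequent in both directions.) **Objects, morphisms, source and target of $G^{\mathbb{T}}$.** $G^{\mathbb{T}}_0$ is the classifying locale of $P[\mathbb{T}]$ and $G^{\mathbb{T}}_1$ that of $P[\mathbb{T}_{\cong}]$ (the construction $P$ applied to $\mathbb{T}_{\cong}$). The source and target maps are given by the frame homomorphisms $s^*[\vec n\in R]=[\vec n\in R_1]$ and $t^*[\vec n\in R]=[\vec n\in R_2]$, where $R$ may also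 be equality $=_X$, with $[(n,m)\in {=_X}]$ meaning $[n\sim^X m]$. (The remaining structure maps of the localic groupoid, corresponding to identity isomorphisms, inverses and composites, are not needed for the statement.)
   Formalization: In P[T], ∃x:X.χ is replaced by the join over n of [n~n]∧χ(n), not of χ(n) alone, since otherwise the axiom ∃x:X.⊤ ⊢ ⊥ gives a counterexample; disjunctions are indexed by subsets of any infinite set at least as large as the sets of sorts and relation symbols. *)

theory Defs
  imports "HOL-Algebra.Complete_Lattice"
begin

section \<open>Frames and locales\<close>

locale frame = complete_lattice L for L (structure) +
  assumes meet_sup_distrib:
    "\<lbrakk>x \<in> carrier L; A \<subseteq> carrier L\<rbrakk> \<Longrightarrow> x \<sqinter> \<Squnion>A = \<Squnion>((\<lambda>a. x \<sqinter> a) ` A)"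

definition frame_hom :: "'a gorder \<Rightarrow> 'b gorder \<Rightarrow> ('a \<Rightarrow> 'b) \<Rightarrow> bool" where
  "frame_hom L M f \<longleftrightarrow>
     f \<in> carrier L \<rightarrow> carrier M \<and>
     f \<top>\<^bsub>L\<^esub> = \<top>\<^bsub>M\<^esub> \<and>
     (\<forall>x\<in>carrier L. \<forall>y\<in>carrier L. f (x \<sqinter>\<^bsub>L\<^esub> y) = f x \<sqinter>\<^bsub>M\<^esub> f y) \<and>
     (\<forall>A. A \<subseteq> carrier L \<longrightarrow> f (\<Squnion>\<^bsub>L\<^esub>A) = \<Squnion>\<^bsub>M\<^esub>(f ` A))"

definition frame_isomorphic :: "'a gorder \<Rightarrow> 'b gorder \<Rightarrow> bool" where
  "frame_isomorphic L M \<longleftrightarrow> (\<exists>f. frame_hom L M f \<and> bij_betw f (carrier L) (carrier M))"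

text \<open>
  Locales are represented by their frames, and a map of locales \<open>X \<rightarrow> Y\<close> by the frame
  homomorphism \<open>\<O>Y \<rightarrow> \<O>X\<close>.  Below, \<open>s\<close> and \<open>t\<close> are the inverse image maps of a parallel
  pair of locale maps \<open>X1 \<rightrightarrows> X0\<close>, where \<open>L0 = \<O>X0\<close> and \<open>L1 = \<O>X1\<close>, and \<open>q\<close> is the inverse
  image map of a cocone \<open>X0 \<rightarrow> X\<close> with \<open>E = \<O>X\<close>.  HOL cannot quantify over types, so the type
  \<open>'m\<close> of the elements of the frames of the competing locales is a parameter.  If the elements
  of \<open>L0\<close> are sets of sets and \<open>'m\<close> is their type, then this implies the universal property
  for all other types (\<open>loc_coequaliser_any_type\<close>).  Coequalisers exist
  (\<open>loc_coequaliser_equaliser_frame\<close>).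
\<close>

definition loc_coequaliser ::
  "'m itself \<Rightarrow> 'a gorder \<Rightarrow> 'b gorder \<Rightarrow> ('a \<Rightarrow> 'b) \<Rightarrow> ('a \<Rightarrow> 'b) \<Rightarrow> 'e gorder \<Rightarrow> ('e \<Rightarrow> 'a) \<Rightarrow> bool"
  where
  "loc_coequaliser (_ :: 'm itself) L0 L1 s t E q \<longleftrightarrow>
     frame E \<and> frame_hom E L0 q \<and> (\<forall>x\<in>carrier E. s (q x) = t (q x)) \<and>
     (\<forall>(K :: 'm gorder) h.
        frame K \<and> frame_hom K L0 h \<and> (\<forall>x\<in>carrier K. s (h x) = t (h x)) \<longrightarrow>
        (\<exists>k. frame_hom K E k \<and> (\<forall>x\<in>carrier K. q (k x) = h x) \<and>
             (\<forall>k'. frame_hom K E k' \<and> (\<forall>x\<in>carrier K. q (k' x) = h x) \<longrightarrow>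
                   (\<forall>x\<in>carrier K. k' x = k x))))"


section \<open>Propositional geometric theories and the frames they present\<close>

datatype ('g, 'i) pform =
    Prop 'g
  | PTop
  | PConj "('g, 'i) pform" "('g, 'i) pform"
  | PDisj "'i set" "'i \<Rightarrow> ('g, 'i) pform"

record ('g, 'i) prop_theory =
  props :: "'g set"
  paxioms :: "(('g, 'i) pform \<times> ('g, 'i) pform) set"

primrec pform_over :: "'g set \<Rightarrow> ('g, 'i) pform \<Rightarrow> bool" where
  "pform_over G (Prop g) \<longleftrightarrow> g \<in> G"
| "pform_over G PTop \<longleftrightarrow> True"
| "pform_over G (PConj a b) \<longleftrightarrow> pform_over G a \<and> pform_over G b"
| "pform_over G (PDisj I f) \<longleftrightarrow> (\<forall>i\<in>I. pform_over G (f i))"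

definition propositional_theory :: "('g, 'i) prop_theory \<Rightarrow> bool" where
  "propositional_theory P \<longleftrightarrow>
     (\<forall>(a, b) \<in> paxioms P. pform_over (props P) a \<and> pform_over (props P) b)"

primrec peval :: "'a gorder \<Rightarrow> ('g \<Rightarrow> 'a) \<Rightarrow> ('g, 'i) pform \<Rightarrow> 'a" where
  "peval M j (Prop g) = j g"
| "peval M j PTop = \<top>\<^bsub>M\<^esub>"
| "peval M j (PConj a b) = peval M j a \<sqinter>\<^bsub>M\<^esub> peval M j b"
| "peval M j (PDisj I f) = \<Squnion>\<^bsub>M\<^esub>((\<lambda>i. peval M j (f i)) ` I)"

text \<open>
  The frame presented by a propositional theory is constructed as a quotient of the free frame
  on the basic propositions.  The free frame consists of the upward closed sets of finite sets
  of basic propositions, a finite set standing for the conjunction of its elements and a set of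
  finite sets for the disjunction of these conjunctions; \<open>pform_val\<close> interprets formulae in it.
  The quotient by the axioms is represented by the elements \<open>D\<close> that are closed in the sense
  that \<open>c \<sqinter> b \<le> D\<close> implies \<open>c \<sqinter> a \<le> D\<close> for every axiom \<open>a \<turnstile> b\<close> and every element \<open>c\<close> (it
  suffices to take for \<open>c\<close> a finite conjunction).  Theorems \<open>paxiom_le\<close>,
  \<open>classifying_frame_universal\<close> and \<open>classifying_frame_hom_unique\<close> prove that this has the
  universal property of the frame presented by generators and relations.
\<close>

primrec pform_val :: "('g, 'i) pform \<Rightarrow> 'g set set" where
  "pform_val (Prop g) = {A. g \<in> A}"
| "pform_val PTop = UNIV"
| "pform_val (PConj a b) = pform_val a \<inter> pform_val b"
| "pform_val (PDisj I f) = (\<Union>i\<in>I. pform_val (f i))"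

definition theory_ideal :: "('g, 'i) prop_theory \<Rightarrow> 'g set set \<Rightarrow> bool" where
  "theory_ideal P D \<longleftrightarrow>
     D \<subseteq> Fpow (props P) \<and>
     (\<forall>A\<in>D. \<forall>B\<in>Fpow (props P). A \<subseteq> B \<longrightarrow> B \<in> D) \<and>
     (\<forall>(a, b)\<in>paxioms P. \<forall>A\<in>Fpow (props P).
        (\<forall>B\<in>Fpow (props P). A \<subseteq> B \<and> B \<in> pform_val b \<longrightarrow> B \<in> D) \<longrightarrow>
        (\<forall>B\<in>Fpow (props P). A \<subseteq> B \<and> B \<in> pform_val a \<longrightarrow> B \<in> D))"

definition classifying_frame :: "('g, 'i) prop_theory \<Rightarrow> 'g set set gorder" where
  "classifying_frame P = \<lparr>carrier = {D. theory_ideal P D}, eq = (=), le = (\<subseteq>)\<rparr>"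

definition ideal_closure :: "('g, 'i) prop_theory \<Rightarrow> 'g set set \<Rightarrow> 'g set set" where
  "ideal_closure P U = \<Inter>{D. theory_ideal P D \<and> U \<subseteq> D}"

definition generator :: "('g, 'i) prop_theory \<Rightarrow> 'g \<Rightarrow> 'g set set" where
  "generator P g = ideal_closure P {A \<in> Fpow (props P). g \<in> A}"


section \<open>Geometric logic\<close>

text \<open>
  Variables are de Bruijn indices into a context, which is the list of the sorts of its
  variables; \<open>Exists X \<phi>\<close> binds index \<open>0\<close>.  Disjunctions are indexed by subsets of \<open>'i\<close>.
\<close>

datatype ('s, 'r, 'i) form =
    Atom 'r "nat list"
  | Equal 's nat nat
  | TT
  | Conj "('s, 'r, 'i) form" "('s, 'r, 'i) form"
  | Disj "'i set" "'i \<Rightarrow> ('s, 'r, 'i) form"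
  | Exists 's "('s, 'r, 'i) form"

record ('s, 'r, 'i) geo_theory =
  sorts :: "'s set"
  rels :: "'r set"
  arity :: "'r \<Rightarrow> 's list"
  axioms :: "('s list \<times> ('s, 'r, 'i) form \<times> ('s, 'r, 'i) form) set"

primrec wf_form :: "('s, 'r, 'i) geo_theory \<Rightarrow> 's list \<Rightarrow> ('s, 'r, 'i) form \<Rightarrow> bool" where
  "wf_form T \<Gamma> (Atom r vs) \<longleftrightarrow>
     r \<in> rels T \<and> list_all2 (\<lambda>v X. v < length \<Gamma> \<and> \<Gamma> ! v = X) vs (arity T r)"
| "wf_form T \<Gamma> (Equal X v w) \<longleftrightarrow>
     v < length \<Gamma> \<and> \<Gamma> ! v = X \<and> w < length \<Gamma> \<and> \<Gamma> ! w = X"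
| "wf_form T \<Gamma> TT \<longleftrightarrow> True"
| "wf_form T \<Gamma> (Conj \<phi> \<psi>) \<longleftrightarrow> wf_form T \<Gamma> \<phi> \<and> wf_form T \<Gamma> \<psi>"
| "wf_form T \<Gamma> (Disj I f) \<longleftrightarrow> (\<forall>i\<in>I. wf_form T \<Gamma> (f i))"
| "wf_form T \<Gamma> (Exists X \<phi>) \<longleftrightarrow> X \<in> sorts T \<and> wf_form T (X # \<Gamma>) \<phi>"

definition form_in_context :: "('s, 'r, 'i) geo_theory \<Rightarrow> 's list \<Rightarrow> ('s, 'r, 'i) form \<Rightarrow> bool" where
  "form_in_context T \<Gamma> \<phi> \<longleftrightarrow> set \<Gamma> \<subseteq> sorts T \<and> wf_form T \<Gamma> \<phi>"

definition geometric_theory :: "('s, 'r, 'i) geo_theory \<Rightarrow> bool" where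
  "geometric_theory T \<longleftrightarrow>
     (\<forall>r\<in>rels T. set (arity T r) \<subseteq> sorts T) \<and>
     (\<forall>(\<Gamma>, \<phi>, \<psi>)\<in>axioms T. form_in_context T \<Gamma> \<phi> \<and> form_in_context T \<Gamma> \<psi>)"

text \<open>
  The subsets of \<open>'i\<close> play the role of the sets that may index disjunctions.  As soon as
  \<open>'i\<close> is infinite and has at least as many elements as there are sorts and relation symbols,
  every disjunction over a larger index set would be provably equivalent to one indexed by a
  subset of \<open>'i\<close>, since there are at most \<open>|'i|\<close> formulae built without disjunctions and
  every formula is provably equivalent to a disjunction of those.
\<close>

definition small_signature :: "('s, 'r, 'i) geo_theory \<Rightarrow> bool" where
  "small_signature T \<longleftrightarrow>
     infinite (UNIV :: 'i set) \<and>
     (\<exists>f :: 's \<Rightarrow> 'i. inj_on f (sorts T)) \<and> (\<exists>g :: 'r \<Rightarrow> 'i. inj_on g (rels T))"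

primrec lift_ren :: "(nat \<Rightarrow> nat) \<Rightarrow> nat \<Rightarrow> nat" where
  "lift_ren \<rho> 0 = 0"
| "lift_ren \<rho> (Suc v) = Suc (\<rho> v)"

primrec rename :: "(nat \<Rightarrow> nat) \<Rightarrow> ('s, 'r, 'i) form \<Rightarrow> ('s, 'r, 'i) form" where
  "rename \<rho> (Atom r vs) = Atom r (map \<rho> vs)"
| "rename \<rho> (Equal X v w) = Equal X (\<rho> v) (\<rho> w)"
| "rename \<rho> TT = TT"
| "rename \<rho> (Conj \<phi> \<psi>) = Conj (rename \<rho> \<phi>) (rename \<rho> \<psi>)"
| "rename \<rho> (Disj I f) = Disj I (\<lambda>i. rename \<rho> (f i))"
| "rename \<rho> (Exists X \<phi>) = Exists X (rename (lift_ren \<rho>) \<phi>)"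

definition renaming :: "'s list \<Rightarrow> 's list \<Rightarrow> (nat \<Rightarrow> nat) \<Rightarrow> bool" where
  "renaming \<Gamma> \<Delta> \<rho> \<longleftrightarrow> (\<forall>v<length \<Gamma>. \<rho> v < length \<Delta> \<and> \<Delta> ! \<rho> v = \<Gamma> ! v)"

text \<open>
  The sequent calculus of infinitary geometric logic (as in Johnstone's \<^emph>\<open>Sketches of an
  Elephant\<close>, D1.3.1).  There are no function symbols, so substitutions are renamings of
  variables; \<open>rename (case_nat v id)\<close> substitutes \<open>v\<close> for index \<open>0\<close>, and \<open>rename Suc\<close> is
  weakening by one variable.
\<close>

inductive proves ::
  "('s, 'r, 'i) geo_theory \<Rightarrow> 's list \<Rightarrow> ('s, 'r, 'i) form \<Rightarrow> ('s, 'r, 'i) form \<Rightarrow> bool"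
  for T where
  axiom: "(\<Gamma>, \<phi>, \<psi>) \<in> axioms T \<Longrightarrow> proves T \<Gamma> \<phi> \<psi>"
| identity: "form_in_context T \<Gamma> \<phi> \<Longrightarrow> proves T \<Gamma> \<phi> \<phi>"
| cut: "proves T \<Gamma> \<phi> \<psi> \<Longrightarrow> proves T \<Gamma> \<psi> \<chi> \<Longrightarrow> proves T \<Gamma> \<phi> \<chi>"
| substitution:
    "proves T \<Gamma> \<phi> \<psi> \<Longrightarrow> set \<Delta> \<subseteq> sorts T \<Longrightarrow> renaming \<Gamma> \<Delta> \<rho> \<Longrightarrow>
     proves T \<Delta> (rename \<rho> \<phi>) (rename \<rho> \<psi>)"
| equal_refl: "form_in_context T \<Gamma> (Equal X v v) \<Longrightarrow> proves T \<Gamma> TT (Equal X v v)"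
| equal_subst:
    "form_in_context T \<Gamma> (Equal X v w) \<Longrightarrow> form_in_context T (X # \<Gamma>) \<phi> \<Longrightarrow>
     proves T \<Gamma> (Conj (Equal X v w) (rename (case_nat v id) \<phi>)) (rename (case_nat w id) \<phi>)"
| top: "form_in_context T \<Gamma> \<phi> \<Longrightarrow> proves T \<Gamma> \<phi> TT"
| conj_left1: "form_in_context T \<Gamma> (Conj \<phi> \<psi>) \<Longrightarrow> proves T \<Gamma> (Conj \<phi> \<psi>) \<phi>"
| conj_left2: "form_in_context T \<Gamma> (Conj \<phi> \<psi>) \<Longrightarrow> proves T \<Gamma> (Conj \<phi> \<psi>) \<psi>"
| conj_right:
    "proves T \<Gamma> \<phi> \<psi> \<Longrightarrow> proves T \<Gamma> \<phi> \<chi> \<Longrightarrow> proves T \<Gamma> \<phi> (Conj \<psi> \<chi>)"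
| disj_right: "form_in_context T \<Gamma> (Disj I f) \<Longrightarrow> i \<in> I \<Longrightarrow> proves T \<Gamma> (f i) (Disj I f)"
| disj_left:
    "form_in_context T \<Gamma> \<psi> \<Longrightarrow> (\<And>i. i \<in> I \<Longrightarrow> proves T \<Gamma> (f i) \<psi>) \<Longrightarrow> proves T \<Gamma> (Disj I f) \<psi>"
| exists_left:
    "form_in_context T \<Gamma> \<psi> \<Longrightarrow> X \<in> sorts T \<Longrightarrow> proves T (X # \<Gamma>) \<phi> (rename Suc \<psi>) \<Longrightarrow>
     proves T \<Gamma> (Exists X \<phi>) \<psi>"
| exists_left_inverse:
    "proves T \<Gamma> (Exists X \<phi>) \<psi> \<Longrightarrow> proves T (X # \<Gamma>) \<phi> (rename Suc \<psi>)"
| distributivity: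
    "form_in_context T \<Gamma> \<phi> \<Longrightarrow> form_in_context T \<Gamma> (Disj I f) \<Longrightarrow>
     proves T \<Gamma> (Conj \<phi> (Disj I f)) (Disj I (\<lambda>i. Conj \<phi> (f i)))"
| frobenius:
    "form_in_context T \<Gamma> \<phi> \<Longrightarrow> form_in_context T \<Gamma> (Exists X \<psi>) \<Longrightarrow>
     proves T \<Gamma> (Conj \<phi> (Exists X \<psi>)) (Exists X (Conj (rename Suc \<phi>) \<psi>))"

definition sentences :: "('s, 'r, 'i) geo_theory \<Rightarrow> ('s, 'r, 'i) form set" where
  "sentences T = {\<phi>. form_in_context T [] \<phi>}"

definition provably_equivalent ::
  "('s, 'r, 'i) geo_theory \<Rightarrow> (('s, 'r, 'i) form \<times> ('s, 'r, 'i) form) set" where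
  "provably_equivalent T =
     {(\<phi>, \<psi>) \<in> sentences T \<times> sentences T. proves T [] \<phi> \<psi> \<and> proves T [] \<psi> \<phi>}"

definition sentence_frame :: "('s, 'r, 'i) geo_theory \<Rightarrow> ('s, 'r, 'i) form set gorder" where
  "sentence_frame T =
     \<lparr>carrier = sentences T // provably_equivalent T,
      eq = (=),
      le = (\<lambda>A B. \<exists>\<phi>\<in>A. \<exists>\<psi>\<in>B. proves T [] \<phi> \<psi>)\<rparr>"


section \<open>The propositional theory of models on subquotients of the natural numbers\<close>

datatype ('s, 'r) nat_prop = Sim 's nat nat | Holds 'r "nat list"

definition PConjs :: "('g, 'i) pform list \<Rightarrow> ('g, 'i) pform" where
  "PConjs xs = foldr PConj xs PTop"

definition sims :: "'s list \<Rightarrow> nat list \<Rightarrow> nat list \<Rightarrow> (('s, 'r) nat_prop, 'i) pform" where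
  "sims Xs ns ms = PConjs (map (\<lambda>i. Prop (Sim (Xs ! i) (ns ! i) (ms ! i))) [0..<length Xs])"

text \<open>
  \<open>inst \<phi> ns\<close> replaces the free variable with index \<open>i\<close> by the number \<open>ns ! i\<close>.
  The index type \<open>'i + nat\<close> provides for the disjunctions over \<open>nat\<close> replacing quantifiers.
  As the numbers denoting elements of the sort \<open>X\<close> are those with \<open>n \<sim>\<^sup>X n\<close>, the quantifier
  \<open>\<exists>x:X\<close> becomes a disjunction relativised to those \<open>n\<close>.  The conjunct \<open>n \<sim>\<^sup>X n\<close> is redundant
  whenever \<open>x\<close> occurs in an atomic conjunct of the formula quantified over, but needed in
  general: without it, \<open>\<exists>x:X. TT\<close> would become the true proposition.
\<close>

primrec inst :: "('s, 'r, 'i) form \<Rightarrow> nat list \<Rightarrow> (('s, 'r) nat_prop, 'i + nat) pform" where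
  "inst (Atom r vs) ns = Prop (Holds r (map ((!) ns) vs))"
| "inst (Equal X v w) ns = Prop (Sim X (ns ! v) (ns ! w))"
| "inst TT ns = PTop"
| "inst (Conj \<phi> \<psi>) ns = PConj (inst \<phi> ns) (inst \<psi> ns)"
| "inst (Disj I f) ns = PDisj (Inl ` I) (case_sum (\<lambda>i. inst (f i) ns) (\<lambda>_. PTop))"
| "inst (Exists X \<phi>) ns =
     PDisj (range Inr) (case_sum (\<lambda>_. PTop) (\<lambda>n. PConj (Prop (Sim X n n)) (inst \<phi> (n # ns))))"

definition nat_theory ::
  "('s, 'r, 'i) geo_theory \<Rightarrow> (('s, 'r) nat_prop, 'i + nat) prop_theory" where
  "nat_theory T =
     \<lparr>props =
        {Sim X n m | X n m. X \<in> sorts T} \<union>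
        {Holds r ns | r ns. r \<in> rels T \<and> length ns = length (arity T r)},
      paxioms =
        {(Prop (Sim X n m), Prop (Sim X m n)) | X n m. X \<in> sorts T} \<union>
        {(PConj (Prop (Sim X n m)) (Prop (Sim X m l)), Prop (Sim X n l)) | X n m l. X \<in> sorts T} \<union>
        {(PConj (Prop (Holds r ns)) (sims (arity T r) ns ms), Prop (Holds r ms)) | r ns ms.
           r \<in> rels T \<and> length ns = length (arity T r) \<and> length ms = length (arity T r)} \<union>
        {(Prop (Holds r ns), sims (arity T r) ns ns) | r ns.
           r \<in> rels T \<and> length ns = length (arity T r)} \<union>
        {(PConj (sims \<Gamma> ns ns) (inst \<phi> ns), inst \<psi> ns) | \<Gamma> \<phi> \<psi> ns.
           (\<Gamma>, \<phi>, \<psi>) \<in> axioms T \<and> length ns = length \<Gamma>}\<rparr>"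


section \<open>The theory of isomorphisms\<close>

datatype 's iso_sort = Sort1 's | Sort2 's

datatype ('s, 'r) iso_rel = Rel1 'r | Rel2 'r | Alpha 's

primrec iso_arity :: "('s, 'r, 'i) geo_theory \<Rightarrow> ('s, 'r) iso_rel \<Rightarrow> 's iso_sort list" where
  "iso_arity T (Rel1 r) = map Sort1 (arity T r)"
| "iso_arity T (Rel2 r) = map Sort2 (arity T r)"
| "iso_arity T (Alpha X) = [Sort1 X, Sort2 X]"

definition Conjs :: "('s, 'r, 'i) form list \<Rightarrow> ('s, 'r, 'i) form" where
  "Conjs xs = foldr Conj xs TT"

text \<open>
  In the first axiom for \<open>\<alpha>\<^sup>X\<close> the variables \<open>x, x', y, y'\<close> are the indices \<open>0, 1, 2, 3\<close>.  In
  the axioms for \<open>R\<close>, of arity \<open>k\<close>, the variables \<open>x\<^sub>1, \<dots>, x\<^sub>k\<close> are the indices \<open>0, \<dots>, k - 1\<close>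
  and \<open>y\<^sub>1, \<dots>, y\<^sub>k\<close> are \<open>k, \<dots>, 2 * k - 1\<close>.
\<close>

definition iso_alpha_axioms ::
  "'s \<Rightarrow> ('s iso_sort list \<times> ('s iso_sort, ('s, 'r) iso_rel, 'i) form
          \<times> ('s iso_sort, ('s, 'r) iso_rel, 'i) form) set" where
  "iso_alpha_axioms X =
     (let \<Gamma> = [Sort1 X, Sort1 X, Sort2 X, Sort2 X];
          \<phi> = Conj (Conj (Atom (Alpha X) [0, 2]) (Atom (Alpha X) [1, 3])) (Equal (Sort1 X) 0 1);
          \<psi> = Conj (Conj (Atom (Alpha X) [0, 2]) (Atom (Alpha X) [1, 3])) (Equal (Sort2 X) 2 3)
      in {(\<Gamma>, \<phi>, \<psi>), (\<Gamma>, \<psi>, \<phi>),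
          ([Sort2 X], TT, Exists (Sort1 X) (Atom (Alpha X) [0, 1])),
          ([Sort1 X], TT, Exists (Sort2 X) (Atom (Alpha X) [1, 0]))})"

definition iso_rel_axioms ::
  "('s, 'r, 'i) geo_theory \<Rightarrow> 'r \<Rightarrow>
     ('s iso_sort list \<times> ('s iso_sort, ('s, 'r) iso_rel, 'i) form
      \<times> ('s iso_sort, ('s, 'r) iso_rel, 'i) form) set" where
  "iso_rel_axioms T r =
     (let k = length (arity T r);
          \<Gamma> = map Sort1 (arity T r) @ map Sort2 (arity T r);
          \<alpha> = Conjs (map (\<lambda>i. Atom (Alpha (arity T r ! i)) [i, k + i]) [0..<k]);
          \<phi> = Conj \<alpha> (Atom (Rel1 r) [0..<k]);
          \<psi> = Conj \<alpha> (Atom (Rel2 r) [k..<2 * k])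
      in {(\<Gamma>, \<phi>, \<psi>), (\<Gamma>, \<psi>, \<phi>)})"

definition iso_theory ::
  "('s, 'r, 'i) geo_theory \<Rightarrow> ('s iso_sort, ('s, 'r) iso_rel, 'i) geo_theory" where
  "iso_theory T =
     \<lparr>sorts = Sort1 ` sorts T \<union> Sort2 ` sorts T,
      rels = Rel1 ` rels T \<union> Rel2 ` rels T \<union> Alpha ` sorts T,
      arity = iso_arity T,
      axioms =
        {(map Sort1 \<Gamma>, map_form Sort1 Rel1 \<phi>, map_form Sort1 Rel1 \<psi>) | \<Gamma> \<phi> \<psi>.
           (\<Gamma>, \<phi>, \<psi>) \<in> axioms T} \<union>
        {(map Sort2 \<Gamma>, map_form Sort2 Rel2 \<phi>, map_form Sort2 Rel2 \<psi>) | \<Gamma> \<phi> \<psi>.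
           (\<Gamma>, \<phi>, \<psi>) \<in> axioms T} \<union>
        (\<Union>X\<in>sorts T. iso_alpha_axioms X) \<union>
        (\<Union>r\<in>rels T. iso_rel_axioms T r)\<rparr>"


section \<open>Objects, morphisms, source and target of the localic groupoid\<close>

abbreviation G0_frame :: "('s, 'r, 'i) geo_theory \<Rightarrow> ('s, 'r) nat_prop set set gorder" where
  "G0_frame T \<equiv> classifying_frame (nat_theory T)"

abbreviation G1_frame ::
  "('s, 'r, 'i) geo_theory \<Rightarrow> ('s iso_sort, ('s, 'r) iso_rel) nat_prop set set gorder" where
  "G1_frame T \<equiv> classifying_frame (nat_theory (iso_theory T))"

text \<open>
  The conditions below determine the homomorphisms on all of the frame of \<open>G\<^sub>0\<close>, and such
  homomorphisms exist: see \<open>source_map_unique\<close>, \<open>source_map_exists\<close> and their analogues for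
  the target.  The condition on \<open>Sim\<close> is the case of the equality relation.
\<close>

definition source_map ::
  "('s, 'r, 'i) geo_theory \<Rightarrow>
   (('s, 'r) nat_prop set set \<Rightarrow> ('s iso_sort, ('s, 'r) iso_rel) nat_prop set set) \<Rightarrow> bool" where
  "source_map T s \<longleftrightarrow>
     frame_hom (G0_frame T) (G1_frame T) s \<and>
     (\<forall>X n m. X \<in> sorts T \<longrightarrow>
        s (generator (nat_theory T) (Sim X n m)) =
        generator (nat_theory (iso_theory T)) (Sim (Sort1 X) n m)) \<and>
     (\<forall>r ns. r \<in> rels T \<and> length ns = length (arity T r) \<longrightarrow>
        s (generator (nat_theory T) (Holds r ns)) =
        generator (nat_theory (iso_theory T)) (Holds (Rel1 r) ns))"

definition target_map ::
  "('s, 'r, 'i) geo_theory \<Rightarrow>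
   (('s, 'r) nat_prop set set \<Rightarrow> ('s iso_sort, ('s, 'r) iso_rel) nat_prop set set) \<Rightarrow> bool" where
  "target_map T t \<longleftrightarrow>
     frame_hom (G0_frame T) (G1_frame T) t \<and>
     (\<forall>X n m. X \<in> sorts T \<longrightarrow>
        t (generator (nat_theory T) (Sim X n m)) =
        generator (nat_theory (iso_theory T)) (Sim (Sort2 X) n m)) \<and>
     (\<forall>r ns. r \<in> rels T \<and> length ns = length (arity T r) \<longrightarrow>
        t (generator (nat_theory T) (Holds r ns)) =
        generator (nat_theory (iso_theory T)) (Holds (Rel2 r) ns))"


section \<open>Justification of the encodings\<close>

context complete_lattice
begin

lemma sup_eqI:
  assumes "A \<subseteq> carrier L" "x \<in> carrier L" "\<And>a. a \<in> A \<Longrightarrow> a \<sqsubseteq> x"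
    "\<And>y. y \<in> carrier L \<Longrightarrow> (\<And>a. a \<in> A \<Longrightarrow> a \<sqsubseteq> y) \<Longrightarrow> x \<sqsubseteq> y"
  shows "\<Squnion>A = x"
proof (rule le_antisym)
  show "\<Squnion>A \<sqsubseteq> x" using assms(1-3) by (rule sup_least)
  show "x \<sqsubseteq> \<Squnion>A" using assms(1) by (intro assms(4) sup_upper sup_closed) auto
qed (use assms in auto)

lemma meet_eqI:
  assumes "a \<in> carrier L" "b \<in> carrier L" "x \<in> carrier L" "x \<sqsubseteq> a" "x \<sqsubseteq> b"
    "\<And>y. y \<in> carrier L \<Longrightarrow> y \<sqsubseteq> a \<Longrightarrow> y \<sqsubseteq> b \<Longrightarrow> y \<sqsubseteq> x"
  shows "a \<sqinter> b = x"
proof (rule le_antisym)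
  show "a \<sqinter> b \<sqsubseteq> x" using assms(1,2) by (intro assms(6) meet_left meet_right meet_closed)
  show "x \<sqsubseteq> a \<sqinter> b" using assms(4,5,1,2,3) by (rule meet_le)
qed (use assms in auto)

lemma top_eqI:
  assumes "x \<in> carrier L" "\<And>y. y \<in> carrier L \<Longrightarrow> y \<sqsubseteq> x"
  shows "\<top> = x"
  by (rule le_antisym) (use assms in auto)

end

lemma frameI:
  fixes L :: "'a gorder" (structure)
  assumes po: "partial_order L"
    and top: "tp \<in> carrier L" "\<And>x. x \<in> carrier L \<Longrightarrow> x \<sqsubseteq>\<^bsub>L\<^esub> tp"
    and sup: "\<And>A. A \<subseteq> carrier L \<Longrightarrow> sp A \<in> carrier L"
      "\<And>A a. A \<subseteq> carrier L \<Longrightarrow> a \<in> A \<Longrightarrow> a \<sqsubseteq>\<^bsub>L\<^esub> sp A"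
      "\<And>A y. A \<subseteq> carrier L \<Longrightarrow> y \<in> carrier L \<Longrightarrow> (\<And>a. a \<in> A \<Longrightarrow> a \<sqsubseteq>\<^bsub>L\<^esub> y) \<Longrightarrow> sp A \<sqsubseteq>\<^bsub>L\<^esub> y"
    and meet: "\<And>a b. a \<in> carrier L \<Longrightarrow> b \<in> carrier L \<Longrightarrow> mt a b \<in> carrier L"
      "\<And>a b. a \<in> carrier L \<Longrightarrow> b \<in> carrier L \<Longrightarrow> mt a b \<sqsubseteq>\<^bsub>L\<^esub> a"
      "\<And>a b. a \<in> carrier L \<Longrightarrow> b \<in> carrier L \<Longrightarrow> mt a b \<sqsubseteq>\<^bsub>L\<^esub> b"
      "\<And>a b y. a \<in> carrier L \<Longrightarrow> b \<in> carrier L \<Longrightarrow> y \<in> carrier L \<Longrightarrow>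
         y \<sqsubseteq>\<^bsub>L\<^esub> a \<Longrightarrow> y \<sqsubseteq>\<^bsub>L\<^esub> b \<Longrightarrow> y \<sqsubseteq>\<^bsub>L\<^esub> mt a b"
    and distrib: "\<And>x A. x \<in> carrier L \<Longrightarrow> A \<subseteq> carrier L \<Longrightarrow> mt x (sp A) = sp (mt x ` A)"
  shows "frame L" "\<top>\<^bsub>L\<^esub> = tp" "\<And>A. A \<subseteq> carrier L \<Longrightarrow> \<Squnion>\<^bsub>L\<^esub>A = sp A"
    "\<And>a b. a \<in> carrier L \<Longrightarrow> b \<in> carrier L \<Longrightarrow> a \<sqinter>\<^bsub>L\<^esub> b = mt a b"
proof -
  interpret partial_order L by (rule po)
  have cl: "complete_lattice L"
  proof
    fix A assume A: "A \<subseteq> carrier L"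
    have "least L (sp A) (Upper L A)"
    proof (rule least_UpperI)
      fix y assume "y \<in> Upper L A"
      then show "sp A \<sqsubseteq> y" using A by (intro sup(3)) (auto simp: Upper_def)
    qed (use A sup in auto)
    then show "\<exists>s. least L s (Upper L A)" ..
    let ?i = "sp {y \<in> carrier L. \<forall>a\<in>A. y \<sqsubseteq>\<^bsub>L\<^esub> a}"
    have "greatest L ?i (Lower L A)"
    proof (rule greatest_LowerI)
      fix x assume "x \<in> A"
      then show "?i \<sqsubseteq> x" using A by (intro sup(3)) auto
    next
      fix y assume "y \<in> Lower L A"
      then show "y \<sqsubseteq> ?i" using A by (intro sup(2)) (auto simp: Lower_def)
    qed (use A sup(1)[of "{y \<in> carrier L. \<forall>a\<in>A. y \<sqsubseteq>\<^bsub>L\<^esub> a}"] in auto)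
    then show "\<exists>i. greatest L i (Lower L A)" ..
  qed
  interpret complete_lattice L by (rule cl)
  show t: "\<top>\<^bsub>L\<^esub> = tp" by (rule top_eqI) (use top in auto)
  show s: "\<And>A. A \<subseteq> carrier L \<Longrightarrow> \<Squnion>\<^bsub>L\<^esub>A = sp A" by (rule sup_eqI) (use sup in auto)
  show m: "\<And>a b. a \<in> carrier L \<Longrightarrow> b \<in> carrier L \<Longrightarrow> a \<sqinter>\<^bsub>L\<^esub> b = mt a b"
    by (rule meet_eqI) (use meet in auto)
  show "frame L"
  proof
    fix x A assume x: "x \<in> carrier L" and A: "A \<subseteq> carrier L"
    have "(\<lambda>a. x \<sqinter> a) ` A = mt x ` A" using x A m by (intro image_cong) auto
    moreover have "mt x ` A \<subseteq> carrier L" using x A meet(1) by auto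
    ultimately show "x \<sqinter> \<Squnion>A = \<Squnion>((\<lambda>a. x \<sqinter> a) ` A)"
      using s[of A] s[of "mt x ` A"] m[of x "sp A"] sup(1)[of A] x A distrib[of x A] by simp
  qed
qed

lemma frame_homD:
  assumes "frame_hom L M f"
  shows "\<And>x. x \<in> carrier L \<Longrightarrow> f x \<in> carrier M" "f \<top>\<^bsub>L\<^esub> = \<top>\<^bsub>M\<^esub>"
    "\<And>x y. x \<in> carrier L \<Longrightarrow> y \<in> carrier L \<Longrightarrow> f (x \<sqinter>\<^bsub>L\<^esub> y) = f x \<sqinter>\<^bsub>M\<^esub> f y"
    "\<And>A. A \<subseteq> carrier L \<Longrightarrow> f (\<Squnion>\<^bsub>L\<^esub>A) = \<Squnion>\<^bsub>M\<^esub>(f ` A)"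
  using assms by (auto simp: frame_hom_def)

lemma frame_hom_comp:
  assumes "frame_hom L M f" "frame_hom M N g"
  shows "frame_hom L N (g \<circ> f)"
proof -
  note f = frame_homD[OF assms(1)] and g = frame_homD[OF assms(2)]
  have "g (f (\<Squnion>\<^bsub>L\<^esub>A)) = \<Squnion>\<^bsub>N\<^esub>((g \<circ> f) ` A)" if "A \<subseteq> carrier L" for A
  proof -
    have "f ` A \<subseteq> carrier M" using that f(1) by auto
    then show ?thesis using f(4)[OF that] g(4)[of "f ` A"] by (simp add: image_comp)
  qed
  then show ?thesis using f g by (simp add: frame_hom_def)
qed


subsection \<open>Coequalisers of locales exist\<close>

definition equaliser_frame :: "'a gorder \<Rightarrow> ('a \<Rightarrow> 'b) \<Rightarrow> ('a \<Rightarrow> 'b) \<Rightarrow> 'a gorder" where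
  "equaliser_frame L s t = L\<lparr>carrier := {x \<in> carrier L. s x = t x}\<rparr>"

lemma equaliser_frame:
  fixes L0 :: "'a gorder" and L1 :: "'b gorder"
  assumes L0: "frame L0" and s: "frame_hom L0 L1 s" and t: "frame_hom L0 L1 t"
  defines "E \<equiv> equaliser_frame L0 s t"
  shows "frame E" "frame_hom E L0 id" "\<And>x. x \<in> carrier E \<longleftrightarrow> x \<in> carrier L0 \<and> s x = t x"
    "\<And>(K :: 'm gorder) h. frame_hom K L0 h \<Longrightarrow> \<forall>x\<in>carrier K. s (h x) = t (h x) \<Longrightarrow>
       frame_hom K E h"
proof -
  interpret L: frame L0 by (rule L0)
  show car: "\<And>x. x \<in> carrier E \<longleftrightarrow> x \<in> carrier L0 \<and> s x = t x"
    by (simp add: E_def equaliser_frame_def)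
  have sub: "carrier E \<subseteq> carrier L0" using car by auto
  have le: "le E = le L0" and eq: "eq E = (=)"
    using L.eq_is_equal by (simp_all add: E_def equaliser_frame_def)
  note sh = frame_homD[OF s] and th = frame_homD[OF t]
  have po: "partial_order E"
    by standard (use sub in \<open>auto simp: le eq intro: L.le_trans L.le_antisym\<close>)
  have sup: "\<Squnion>\<^bsub>L0\<^esub>A \<in> carrier E" if "A \<subseteq> carrier E" for A
  proof -
    have "s ` A = t ` A" using that car by (intro image_cong) auto
    then show ?thesis using that sub sh(4)[of A] th(4)[of A] by (auto simp: car)
  qed
  have E: "frame E" "\<top>\<^bsub>E\<^esub> = \<top>\<^bsub>L0\<^esub>" "\<And>A. A \<subseteq> carrier E \<Longrightarrow> \<Squnion>\<^bsub>E\<^esub>A = \<Squnion>\<^bsub>L0\<^esub>A"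
    "\<And>a b. a \<in> carrier E \<Longrightarrow> b \<in> carrier E \<Longrightarrow> a \<sqinter>\<^bsub>E\<^esub> b = a \<sqinter>\<^bsub>L0\<^esub> b"
  proof -
    have top: "\<top>\<^bsub>L0\<^esub> \<in> carrier E" "\<And>x. x \<in> carrier E \<Longrightarrow> x \<sqsubseteq>\<^bsub>E\<^esub> \<top>\<^bsub>L0\<^esub>"
      using sh(2) th(2) sub by (auto simp: car le)
    have up: "a \<sqsubseteq>\<^bsub>E\<^esub> \<Squnion>\<^bsub>L0\<^esub>A" if "A \<subseteq> carrier E" "a \<in> A" for A a
      using that sub by (auto simp: le intro: L.sup_upper)
    have lst: "\<Squnion>\<^bsub>L0\<^esub>A \<sqsubseteq>\<^bsub>E\<^esub> y"
      if "A \<subseteq> carrier E" "y \<in> carrier E" "\<And>a. a \<in> A \<Longrightarrow> a \<sqsubseteq>\<^bsub>E\<^esub> y" for A y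
      unfolding le by (rule L.sup_least) (use that sub in \<open>auto simp: le\<close>)
    have m: "a \<sqinter>\<^bsub>L0\<^esub> b \<in> carrier E" "a \<sqinter>\<^bsub>L0\<^esub> b \<sqsubseteq>\<^bsub>E\<^esub> a" "a \<sqinter>\<^bsub>L0\<^esub> b \<sqsubseteq>\<^bsub>E\<^esub> b"
      if "a \<in> carrier E" "b \<in> carrier E" for a b
      using that sh(3) th(3) by (auto simp: car le L.meet_left L.meet_right)
    have mg: "y \<sqsubseteq>\<^bsub>E\<^esub> a \<sqinter>\<^bsub>L0\<^esub> b"
      if "a \<in> carrier E" "b \<in> carrier E" "y \<in> carrier E" "y \<sqsubseteq>\<^bsub>E\<^esub> a" "y \<sqsubseteq>\<^bsub>E\<^esub> b" for a b y
      unfolding le by (rule L.meet_le) (use that sub in \<open>auto simp: le\<close>)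
    have d: "x \<sqinter>\<^bsub>L0\<^esub> \<Squnion>\<^bsub>L0\<^esub>A = \<Squnion>\<^bsub>L0\<^esub>((\<lambda>a. x \<sqinter>\<^bsub>L0\<^esub> a) ` A)"
      if "x \<in> carrier E" "A \<subseteq> carrier E" for x A
      by (rule L.meet_sup_distrib) (use that sub in auto)
    note * = frameI[where L = E and tp = "\<top>\<^bsub>L0\<^esub>" and sp = "\<lambda>A. \<Squnion>\<^bsub>L0\<^esub>A" and mt = "\<lambda>a b. a \<sqinter>\<^bsub>L0\<^esub> b",
        OF po top sup up lst m mg d]
    show "frame E" "\<top>\<^bsub>E\<^esub> = \<top>\<^bsub>L0\<^esub>" "\<And>A. A \<subseteq> carrier E \<Longrightarrow> \<Squnion>\<^bsub>E\<^esub>A = \<Squnion>\<^bsub>L0\<^esub>A"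
      "\<And>a b. a \<in> carrier E \<Longrightarrow> b \<in> carrier E \<Longrightarrow> a \<sqinter>\<^bsub>E\<^esub> b = a \<sqinter>\<^bsub>L0\<^esub> b"
      by (rule *; assumption)+
  qed
  show "frame E" by (rule E(1))
  show "frame_hom E L0 id" unfolding frame_hom_def using E sub by auto
  fix K :: "'m gorder" and h
  assume h: "frame_hom K L0 h" and st: "\<forall>x\<in>carrier K. s (h x) = t (h x)"
  note hh = frame_homD[OF h]
  have hE: "\<And>x. x \<in> carrier K \<Longrightarrow> h x \<in> carrier E" using hh(1) st car by auto
  have "h (\<Squnion>\<^bsub>K\<^esub>A) = \<Squnion>\<^bsub>E\<^esub>(h ` A)" if "A \<subseteq> carrier K" for A
  proof -
    have "h ` A \<subseteq> carrier E" using that hE by auto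
    from E(3)[OF this] show ?thesis using hh(4)[OF that] by simp
  qed
  then show "frame_hom K E h" unfolding frame_hom_def using hE hh E by auto
qed

theorem loc_coequaliser_equaliser_frame:
  assumes "frame L0" "frame_hom L0 L1 s" "frame_hom L0 L1 t"
  shows "loc_coequaliser TYPE('m) L0 L1 s t (equaliser_frame L0 s t) id"
  unfolding loc_coequaliser_def
proof (intro conjI ballI allI impI)
  note E = equaliser_frame[OF assms]
  show "frame (equaliser_frame L0 s t)" "frame_hom (equaliser_frame L0 s t) L0 id" by (fact E)+
  show "s (id x) = t (id x)" if "x \<in> carrier (equaliser_frame L0 s t)" for x
    using that E(3) by simp
  fix K :: "'m gorder" and h
  assume "frame K \<and> frame_hom K L0 h \<and> (\<forall>x\<in>carrier K. s (h x) = t (h x))"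
  then have "frame_hom K (equaliser_frame L0 s t) h" using E(4) by blast
  then show "\<exists>k. frame_hom K (equaliser_frame L0 s t) k \<and> (\<forall>x\<in>carrier K. id (k x) = h x) \<and>
      (\<forall>k'. frame_hom K (equaliser_frame L0 s t) k' \<and> (\<forall>x\<in>carrier K. id (k' x) = h x) \<longrightarrow>
            (\<forall>x\<in>carrier K. k' x = k x))"
    by (intro exI[of _ h]) simp
qed


subsection \<open>The universal property of the classifying frame\<close>

lemma pform_val_mono: "A \<in> pform_val a \<Longrightarrow> A \<subseteq> B \<Longrightarrow> B \<in> pform_val a"
  by (induction a) auto

context
  fixes P :: "('g, 'i) prop_theory"
begin

private abbreviation "F \<equiv> Fpow (props P)"

private lemma F_Un: "A \<in> F \<Longrightarrow> B \<in> F \<Longrightarrow> A \<union> B \<in> F"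
  by (auto simp: Fpow_def)

lemma theory_idealD:
  assumes "theory_ideal P D"
  shows "D \<subseteq> F" "\<And>A B. A \<in> D \<Longrightarrow> B \<in> F \<Longrightarrow> A \<subseteq> B \<Longrightarrow> B \<in> D"
    "\<And>a b A B. (a, b) \<in> paxioms P \<Longrightarrow> A \<in> F \<Longrightarrow>
       (\<And>B. B \<in> F \<Longrightarrow> A \<subseteq> B \<Longrightarrow> B \<in> pform_val b \<Longrightarrow> B \<in> D) \<Longrightarrow>
       B \<in> F \<Longrightarrow> A \<subseteq> B \<Longrightarrow> B \<in> pform_val a \<Longrightarrow> B \<in> D"
proof -
  have D: "D \<subseteq> F" "\<forall>A\<in>D. \<forall>B\<in>F. A \<subseteq> B \<longrightarrow> B \<in> D"
    and ax: "\<forall>(a, b)\<in>paxioms P. \<forall>A\<in>F. (\<forall>B\<in>F. A \<subseteq> B \<and> B \<in> pform_val b \<longrightarrow> B \<in> D) \<longrightarrow>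
        (\<forall>B\<in>F. A \<subseteq> B \<and> B \<in> pform_val a \<longrightarrow> B \<in> D)"
    using assms unfolding theory_ideal_def by simp_all
  show "D \<subseteq> F" by (rule D)
  show "\<And>A B. A \<in> D \<Longrightarrow> B \<in> F \<Longrightarrow> A \<subseteq> B \<Longrightarrow> B \<in> D" using D(2) by simp
  fix a b A B assume *: "(a, b) \<in> paxioms P" "A \<in> F"
    "\<And>B. B \<in> F \<Longrightarrow> A \<subseteq> B \<Longrightarrow> B \<in> pform_val b \<Longrightarrow> B \<in> D" "B \<in> F" "A \<subseteq> B" "B \<in> pform_val a"
  have "(\<forall>B\<in>F. A \<subseteq> B \<and> B \<in> pform_val b \<longrightarrow> B \<in> D) \<longrightarrow>
        (\<forall>B\<in>F. A \<subseteq> B \<and> B \<in> pform_val a \<longrightarrow> B \<in> D)"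
    by (rule bspec[OF bspec[OF ax *(1), unfolded prod.case] *(2)])
  moreover have "\<forall>B\<in>F. A \<subseteq> B \<and> B \<in> pform_val b \<longrightarrow> B \<in> D" by (intro ballI impI *(3)) simp_all
  ultimately have "\<forall>B\<in>F. A \<subseteq> B \<and> B \<in> pform_val a \<longrightarrow> B \<in> D" by (rule mp)
  then show "B \<in> D" using *(4-6) by simp
qed

lemma theory_idealI:
  assumes "D \<subseteq> F" "\<And>A B. A \<in> D \<Longrightarrow> B \<in> F \<Longrightarrow> A \<subseteq> B \<Longrightarrow> B \<in> D"
    "\<And>a b A B. (a, b) \<in> paxioms P \<Longrightarrow> A \<in> F \<Longrightarrow>
       (\<And>B. B \<in> F \<Longrightarrow> A \<subseteq> B \<Longrightarrow> B \<in> pform_val b \<Longrightarrow> B \<in> D) \<Longrightarrow>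
       B \<in> F \<Longrightarrow> A \<subseteq> B \<Longrightarrow> B \<in> pform_val a \<Longrightarrow> B \<in> D"
  shows "theory_ideal P D"
  unfolding theory_ideal_def
proof (intro conjI ballI impI)
  fix p assume "p \<in> paxioms P"
  then show "case p of (a, b) \<Rightarrow> \<forall>A\<in>F. (\<forall>B\<in>F. A \<subseteq> B \<and> B \<in> pform_val b \<longrightarrow> B \<in> D) \<longrightarrow>
      (\<forall>B\<in>F. A \<subseteq> B \<and> B \<in> pform_val a \<longrightarrow> B \<in> D)"
    by (cases p) (auto intro: assms(3))
qed (use assms(1,2) in auto)

lemma theory_ideal_F: "theory_ideal P F"
  by (rule theory_idealI) auto

lemma ideal_closure_upper: "U \<subseteq> ideal_closure P U"
  by (auto simp: ideal_closure_def)

lemma ideal_closure_least: "theory_ideal P D \<Longrightarrow> U \<subseteq> D \<Longrightarrow> ideal_closure P U \<subseteq> D"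
  by (auto simp: ideal_closure_def)

lemma theory_ideal_closure:
  assumes "U \<subseteq> F"
  shows "theory_ideal P (ideal_closure P U)"
proof (rule theory_idealI)
  show "ideal_closure P U \<subseteq> F" by (rule ideal_closure_least[OF theory_ideal_F assms])
next
  fix A B assume "A \<in> ideal_closure P U" "B \<in> F" "A \<subseteq> B"
  then show "B \<in> ideal_closure P U"
    unfolding ideal_closure_def using theory_idealD(2) by blast
next
  fix a b A B
  assume *: "(a, b) \<in> paxioms P" "A \<in> F"
    "\<And>B. B \<in> F \<Longrightarrow> A \<subseteq> B \<Longrightarrow> B \<in> pform_val b \<Longrightarrow> B \<in> ideal_closure P U"
    "B \<in> F" "A \<subseteq> B" "B \<in> pform_val a"
  show "B \<in> ideal_closure P U"
    unfolding ideal_closure_def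
  proof clarify
    fix D assume D: "theory_ideal P D" "U \<subseteq> D"
    show "B \<in> D"
      by (rule theory_idealD(3)[OF D(1) *(1,2) _ *(4-6)])
        (use *(3) D in \<open>auto simp: ideal_closure_def\<close>)
  qed
qed

lemma ideal_closure_ideal: "theory_ideal P D \<Longrightarrow> ideal_closure P D = D"
  by (intro equalityI ideal_closure_least ideal_closure_upper) auto

lemma ideal_closure_mono: "U \<subseteq> V \<Longrightarrow> ideal_closure P U \<subseteq> ideal_closure P V"
  by (auto simp: ideal_closure_def)

lemma theory_ideal_residual:
  assumes E: "theory_ideal P E" and V: "V \<subseteq> F"
  shows "theory_ideal P {A \<in> F. \<forall>B\<in>V. A \<union> B \<in> E}" (is "theory_ideal P ?N")
proof (rule theory_idealI)
  fix A B assume A: "A \<in> ?N" and B: "B \<in> F" "A \<subseteq> B"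
  have "B \<union> C \<in> E" if "C \<in> V" for C
    by (rule theory_idealD(2)[OF E, of "A \<union> C"]) (use A B V that F_Un in auto)
  then show "B \<in> ?N" using B by auto
next
  fix a b A B
  assume *: "(a, b) \<in> paxioms P" "A \<in> F"
    "\<And>B. B \<in> F \<Longrightarrow> A \<subseteq> B \<Longrightarrow> B \<in> pform_val b \<Longrightarrow> B \<in> ?N"
    "B \<in> F" "A \<subseteq> B" "B \<in> pform_val a"
  have "B \<union> C \<in> E" if C: "C \<in> V" for C
  proof (rule theory_idealD(3)[OF E *(1), of "A \<union> C"])
    show "A \<union> C \<in> F" "B \<union> C \<in> F" using * C V F_Un by auto
    show "A \<union> C \<subseteq> B \<union> C" using * by auto
    show "B \<union> C \<in> pform_val a" using *(6) by (rule pform_val_mono) auto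
    fix B' assume B': "B' \<in> F" "A \<union> C \<subseteq> B'" "B' \<in> pform_val b"
    then have "B' \<in> ?N" using *(3) by auto
    then have "B' \<union> C \<in> E" using C by auto
    moreover have "B' \<union> C = B'" using B' by auto
    ultimately show "B' \<in> E" by simp
  qed
  then show "B \<in> ?N" using * by auto
qed auto

lemma ideal_closure_Int:
  assumes U: "U \<subseteq> F" "\<And>A B. A \<in> U \<Longrightarrow> B \<in> F \<Longrightarrow> A \<subseteq> B \<Longrightarrow> B \<in> U"
    and V: "V \<subseteq> F" "\<And>A B. A \<in> V \<Longrightarrow> B \<in> F \<Longrightarrow> A \<subseteq> B \<Longrightarrow> B \<in> V"
  shows "ideal_closure P U \<inter> ideal_closure P V = ideal_closure P (U \<inter> V)"
proof
  let ?E = "ideal_closure P (U \<inter> V)"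
  have E: "theory_ideal P ?E" using U(1) by (intro theory_ideal_closure) auto
  have "U \<subseteq> {A \<in> F. \<forall>B\<in>V. A \<union> B \<in> ?E}"
  proof clarify
    fix A assume A: "A \<in> U"
    have "A \<union> B \<in> ?E" if "B \<in> V" for B
    proof -
      have "A \<union> B \<in> F" using A that U(1) V(1) F_Un by auto
      then have "A \<union> B \<in> U \<inter> V" using U(2)[OF A] V(2)[OF that] by auto
      then show ?thesis by (rule subsetD[OF ideal_closure_upper])
    qed
    then show "A \<in> F \<and> (\<forall>B\<in>V. A \<union> B \<in> ?E)" using A U(1) by auto
  qed
  then have 1: "ideal_closure P U \<subseteq> {A \<in> F. \<forall>B\<in>V. A \<union> B \<in> ?E}"
    by (rule ideal_closure_least[OF theory_ideal_residual[OF E V(1)]])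
  have clU: "ideal_closure P U \<subseteq> F" using ideal_closure_least[OF theory_ideal_F U(1)] .
  have "V \<subseteq> {A \<in> F. \<forall>B\<in>ideal_closure P U. A \<union> B \<in> ?E}"
  proof (rule subsetI)
    fix A assume A: "A \<in> V"
    have "A \<union> B \<in> ?E" if "B \<in> ideal_closure P U" for B
      using subsetD[OF 1 that] A by (simp add: Un_commute)
    then show "A \<in> {A \<in> F. \<forall>B\<in>ideal_closure P U. A \<union> B \<in> ?E}" using A V(1) by auto
  qed
  then have 2: "ideal_closure P V \<subseteq> {A \<in> F. \<forall>B\<in>ideal_closure P U. A \<union> B \<in> ?E}"
    by (rule ideal_closure_least[OF theory_ideal_residual[OF E clU]])
  show "ideal_closure P U \<inter> ideal_closure P V \<subseteq> ?E"
  proof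
    fix A assume A: "A \<in> ideal_closure P U \<inter> ideal_closure P V"
    then have "A \<in> {A \<in> F. \<forall>B\<in>ideal_closure P U. A \<union> B \<in> ?E}" using 2 by blast
    then have "A \<union> A \<in> ?E" using A by blast
    then show "A \<in> ?E" by simp
  qed
  show "?E \<subseteq> ideal_closure P U \<inter> ideal_closure P V"
    using ideal_closure_mono[of "U \<inter> V" U] ideal_closure_mono[of "U \<inter> V" V] by auto
qed

lemma theory_ideal_Int:
  assumes "theory_ideal P D" "theory_ideal P E"
  shows "theory_ideal P (D \<inter> E)"
proof -
  note D = theory_idealD[OF assms(1)] and E = theory_idealD[OF assms(2)]
  have "ideal_closure P (D \<inter> E) = D \<inter> E"
    using ideal_closure_Int[OF D(1,2) E(1,2)] ideal_closure_ideal assms by simp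
  moreover have "theory_ideal P (ideal_closure P (D \<inter> E))"
    using D(1) by (intro theory_ideal_closure) auto
  ultimately show ?thesis by simp
qed

lemma classifying_frame:
  shows "frame (classifying_frame P)"
    and "\<top>\<^bsub>classifying_frame P\<^esub> = F"
    and "\<And>\<A>. \<A> \<subseteq> Collect (theory_ideal P) \<Longrightarrow> \<Squnion>\<^bsub>classifying_frame P\<^esub>\<A> = ideal_closure P (\<Union>\<A>)"
    and "\<And>D E. theory_ideal P D \<Longrightarrow> theory_ideal P E \<Longrightarrow> D \<sqinter>\<^bsub>classifying_frame P\<^esub> E = D \<inter> E"
proof -
  let ?L = "classifying_frame P"
  have car: "carrier ?L = Collect (theory_ideal P)" and eq: "eq ?L = (=)" and le: "le ?L = (\<subseteq>)"
    by (simp_all add: classifying_frame_def)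
  have po: "partial_order ?L" by standard (auto simp: eq le)
  have UF: "\<Union>\<A> \<subseteq> F" if "\<A> \<subseteq> Collect (theory_ideal P)" for \<A>
    using that theory_idealD(1) by blast
  have d: "D \<inter> ideal_closure P (\<Union>\<A>) = ideal_closure P (\<Union>((\<inter>) D ` \<A>))"
    if D: "theory_ideal P D" and A: "\<A> \<subseteq> Collect (theory_ideal P)" for D \<A>
  proof -
    have up: "\<And>A B. A \<in> \<Union>\<A> \<Longrightarrow> B \<in> F \<Longrightarrow> A \<subseteq> B \<Longrightarrow> B \<in> \<Union>\<A>"
      using A theory_idealD(2) by blast
    have "D \<inter> ideal_closure P (\<Union>\<A>) = ideal_closure P (D \<inter> \<Union>\<A>)"
      using ideal_closure_Int[OF theory_idealD(1,2)[OF D] UF[OF A] up] ideal_closure_ideal[OF D]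
      by simp
    also have "D \<inter> \<Union>\<A> = \<Union>((\<inter>) D ` \<A>)" by auto
    finally show ?thesis .
  qed
  have top: "F \<in> carrier ?L" "\<And>x. x \<in> carrier ?L \<Longrightarrow> x \<sqsubseteq>\<^bsub>?L\<^esub> F"
    using theory_ideal_F theory_idealD(1) by (auto simp: car le)
  have sup: "ideal_closure P (\<Union>A) \<in> carrier ?L" if "A \<subseteq> carrier ?L" for A
    using that UF theory_ideal_closure by (auto simp: car)
  have up: "a \<sqsubseteq>\<^bsub>?L\<^esub> ideal_closure P (\<Union>A)" if "A \<subseteq> carrier ?L" "a \<in> A" for A a
    using that ideal_closure_upper[of "\<Union>A"] by (auto simp: car le)
  have lst: "ideal_closure P (\<Union>A) \<sqsubseteq>\<^bsub>?L\<^esub> y"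
    if "A \<subseteq> carrier ?L" "y \<in> carrier ?L" "\<And>a. a \<in> A \<Longrightarrow> a \<sqsubseteq>\<^bsub>?L\<^esub> y" for A y
    using that ideal_closure_least[of y "\<Union>A"] by (auto simp: car le)
  have m: "a \<inter> b \<in> carrier ?L" "a \<inter> b \<sqsubseteq>\<^bsub>?L\<^esub> a" "a \<inter> b \<sqsubseteq>\<^bsub>?L\<^esub> b"
    if "a \<in> carrier ?L" "b \<in> carrier ?L" for a b
    using that theory_ideal_Int by (auto simp: car le)
  have mg: "y \<sqsubseteq>\<^bsub>?L\<^esub> a \<inter> b"
    if "a \<in> carrier ?L" "b \<in> carrier ?L" "y \<in> carrier ?L" "y \<sqsubseteq>\<^bsub>?L\<^esub> a" "y \<sqsubseteq>\<^bsub>?L\<^esub> b" for a b y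
    using that by (auto simp: le)
  have d': "D \<inter> ideal_closure P (\<Union>\<A>) = ideal_closure P (\<Union>((\<inter>) D ` \<A>))"
    if "D \<in> carrier ?L" "\<A> \<subseteq> carrier ?L" for D \<A>
    using that d by (simp add: car)
  note * = frameI[where L = ?L and tp = F and sp = "\<lambda>\<A>. ideal_closure P (\<Union>\<A>)" and mt = "(\<inter>)",
      OF po top sup up lst m mg d']
  show "frame ?L" "\<top>\<^bsub>?L\<^esub> = F" by (rule *; assumption)+
  show "\<And>\<A>. \<A> \<subseteq> Collect (theory_ideal P) \<Longrightarrow> \<Squnion>\<^bsub>?L\<^esub>\<A> = ideal_closure P (\<Union>\<A>)"
    unfolding car[symmetric] by (rule *; assumption)
  show "\<And>D E. theory_ideal P D \<Longrightarrow> theory_ideal P E \<Longrightarrow> D \<sqinter>\<^bsub>?L\<^esub> E = D \<inter> E"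
    by (rule *) (simp_all add: car)
qed

lemma generator_closed: "generator P g \<in> carrier (classifying_frame P)"
  by (auto simp: classifying_frame_def generator_def intro: theory_ideal_closure)

lemma peval_generator:
  assumes "pform_over (props P) a"
  shows "peval (classifying_frame P) (generator P) a = ideal_closure P (F \<inter> pform_val a)"
  using assms
proof (induction a)
  case (Prop g)
  then show ?case by (simp add: generator_def Int_def)
next
  case PTop
  then show ?case by (simp add: classifying_frame(2) ideal_closure_ideal theory_ideal_F)
next
  case (PConj a b)
  have "ideal_closure P (F \<inter> pform_val a) \<inter> ideal_closure P (F \<inter> pform_val b) =
        ideal_closure P ((F \<inter> pform_val a) \<inter> (F \<inter> pform_val b))"
    by (rule ideal_closure_Int) (auto intro: pform_val_mono)
  moreover have "(F \<inter> pform_val a) \<inter> (F \<inter> pform_val b) = F \<inter> (pform_val a \<inter> pform_val b)" by auto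
  ultimately show ?case
    using PConj classifying_frame(4)[OF theory_ideal_closure theory_ideal_closure] by simp
next
  case (PDisj I f)
  let ?v = "\<lambda>i. F \<inter> pform_val (f i)"
  have img: "(\<lambda>i. peval (classifying_frame P) (generator P) (f i)) ` I =
      (\<lambda>i. ideal_closure P (?v i)) ` I"
    using PDisj by (intro image_cong) auto
  have "\<Squnion>\<^bsub>classifying_frame P\<^esub>((\<lambda>i. ideal_closure P (?v i)) ` I) =
      ideal_closure P (\<Union>i\<in>I. ideal_closure P (?v i))"
    by (rule classifying_frame(3)) (auto intro: theory_ideal_closure)
  also have "\<dots> = ideal_closure P (\<Union>i\<in>I. ?v i)"
  proof
    have "theory_ideal P (ideal_closure P (\<Union>i\<in>I. ?v i))" by (rule theory_ideal_closure) auto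
    then show "ideal_closure P (\<Union>i\<in>I. ideal_closure P (?v i)) \<subseteq> ideal_closure P (\<Union>i\<in>I. ?v i)"
      by (rule ideal_closure_least) (intro UN_least ideal_closure_mono, auto)
    show "ideal_closure P (\<Union>i\<in>I. ?v i) \<subseteq> ideal_closure P (\<Union>i\<in>I. ideal_closure P (?v i))"
      by (intro ideal_closure_mono UN_mono ideal_closure_upper) auto
  qed
  also have "(\<Union>i\<in>I. ?v i) = F \<inter> (\<Union>i\<in>I. pform_val (f i))" by auto
  finally show ?case using img by simp
qed

lemma paxiom_le:
  assumes P: "propositional_theory P" and ab: "(a, b) \<in> paxioms P"
  shows "peval (classifying_frame P) (generator P) a \<sqsubseteq>\<^bsub>classifying_frame P\<^esub>
         peval (classifying_frame P) (generator P) b"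
proof -
  let ?E = "ideal_closure P (F \<inter> pform_val b)"
  have over: "pform_over (props P) a" "pform_over (props P) b"
    using assms by (auto simp: propositional_theory_def)
  have E: "theory_ideal P ?E" by (rule theory_ideal_closure) auto
  have "F \<inter> pform_val a \<subseteq> ?E"
  proof
    fix B assume B: "B \<in> F \<inter> pform_val a"
    show "B \<in> ?E"
      by (rule theory_idealD(3)[OF E ab, of "{}"])
        (use B ideal_closure_upper[of "F \<inter> pform_val b"] in \<open>auto simp: empty_in_Fpow\<close>)
  qed
  then have "ideal_closure P (F \<inter> pform_val a) \<subseteq> ?E" by (rule ideal_closure_least[OF E])
  then show ?thesis
    unfolding peval_generator[OF over(1)] peval_generator[OF over(2)]
    by (simp add: classifying_frame_def)
qed

context
  fixes M :: "'m gorder" and j :: "'g \<Rightarrow> 'm"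
  assumes M: "frame M" and P: "propositional_theory P"
    and j: "\<And>g. g \<in> props P \<Longrightarrow> j g \<in> carrier M"
    and sound: "\<And>a b. (a, b) \<in> paxioms P \<Longrightarrow> peval M j a \<sqsubseteq>\<^bsub>M\<^esub> peval M j b"
begin

interpretation M: frame M by (rule M)

private definition mt where "mt A = \<Sqinter>\<^bsub>M\<^esub>(j ` A)"

private lemma j_sub: "A \<in> F \<Longrightarrow> j ` A \<subseteq> carrier M"
  using j by (auto simp: Fpow_def)

private lemma mt_closed: "A \<in> F \<Longrightarrow> mt A \<in> carrier M"
  using j_sub by (simp add: mt_def)

private lemma mt_le: "A \<in> F \<Longrightarrow> g \<in> A \<Longrightarrow> mt A \<sqsubseteq>\<^bsub>M\<^esub> j g"
  unfolding mt_def by (rule M.inf_lower) (use j_sub in auto)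

private lemma mt_greatest:
  "A \<in> F \<Longrightarrow> y \<in> carrier M \<Longrightarrow> (\<And>g. g \<in> A \<Longrightarrow> y \<sqsubseteq>\<^bsub>M\<^esub> j g) \<Longrightarrow> y \<sqsubseteq>\<^bsub>M\<^esub> mt A"
  unfolding mt_def by (rule M.inf_greatest) (use j_sub in auto)

private lemma mt_anti: "A \<in> F \<Longrightarrow> B \<in> F \<Longrightarrow> A \<subseteq> B \<Longrightarrow> mt B \<sqsubseteq>\<^bsub>M\<^esub> mt A"
  by (rule mt_greatest) (auto intro: mt_le mt_closed)

private lemma mt_Un:
  assumes "A \<in> F" "B \<in> F"
  shows "mt A \<sqinter>\<^bsub>M\<^esub> mt B = mt (A \<union> B)"
proof (rule M.meet_eqI)
  fix y assume y: "y \<in> carrier M" "y \<sqsubseteq>\<^bsub>M\<^esub> mt A" "y \<sqsubseteq>\<^bsub>M\<^esub> mt B"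
  show "y \<sqsubseteq>\<^bsub>M\<^esub> mt (A \<union> B)"
  proof (rule mt_greatest)
    fix g assume g: "g \<in> A \<union> B"
    then have "j g \<in> carrier M" using assms j by (auto simp: Fpow_def)
    then show "y \<sqsubseteq>\<^bsub>M\<^esub> j g"
      using g y assms mt_le mt_closed M.le_trans by (meson UnE)
  qed (use y assms F_Un in auto)
qed (use assms F_Un mt_closed mt_anti in auto)

private lemma mt_empty: "mt {} = \<top>\<^bsub>M\<^esub>"
  unfolding mt_def using M.weak_inf_empty M.eq_is_equal by simp

private lemma sup_meet_sup:
  assumes U: "U \<subseteq> F" and V: "V \<subseteq> F"
    and W: "W \<subseteq> F" "\<And>A B. A \<in> U \<Longrightarrow> B \<in> V \<Longrightarrow> A \<union> B \<in> W" "W \<subseteq> U" "W \<subseteq> V"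
  shows "\<Squnion>\<^bsub>M\<^esub>(mt ` U) \<sqinter>\<^bsub>M\<^esub> \<Squnion>\<^bsub>M\<^esub>(mt ` V) = \<Squnion>\<^bsub>M\<^esub>(mt ` W)"
proof (rule M.meet_eqI)
  have c: "mt ` U \<subseteq> carrier M" "mt ` V \<subseteq> carrier M" "mt ` W \<subseteq> carrier M"
    using U V W(1) mt_closed by auto
  then show cc: "\<Squnion>\<^bsub>M\<^esub>(mt ` U) \<in> carrier M" "\<Squnion>\<^bsub>M\<^esub>(mt ` V) \<in> carrier M" "\<Squnion>\<^bsub>M\<^esub>(mt ` W) \<in> carrier M"
    by auto
  show "\<Squnion>\<^bsub>M\<^esub>(mt ` W) \<sqsubseteq>\<^bsub>M\<^esub> \<Squnion>\<^bsub>M\<^esub>(mt ` U)"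
    by (rule M.sup_least[OF c(3) cc(1)], rule M.sup_upper[OF c(1)]) (use W in auto)
  show "\<Squnion>\<^bsub>M\<^esub>(mt ` W) \<sqsubseteq>\<^bsub>M\<^esub> \<Squnion>\<^bsub>M\<^esub>(mt ` V)"
    by (rule M.sup_least[OF c(3) cc(2)], rule M.sup_upper[OF c(2)]) (use W in auto)
  have le: "\<Squnion>\<^bsub>M\<^esub>(mt ` U) \<sqinter>\<^bsub>M\<^esub> \<Squnion>\<^bsub>M\<^esub>(mt ` V) \<sqsubseteq>\<^bsub>M\<^esub> \<Squnion>\<^bsub>M\<^esub>(mt ` W)"
  proof -
    have "\<Squnion>\<^bsub>M\<^esub>(mt ` U) \<sqinter>\<^bsub>M\<^esub> mt B \<sqsubseteq>\<^bsub>M\<^esub> \<Squnion>\<^bsub>M\<^esub>(mt ` W)" if B: "B \<in> V" for B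
    proof -
      have mB: "mt B \<in> carrier M" using B V mt_closed by auto
      have "mt B \<sqinter>\<^bsub>M\<^esub> \<Squnion>\<^bsub>M\<^esub>(mt ` U) = \<Squnion>\<^bsub>M\<^esub>((\<lambda>a. mt B \<sqinter>\<^bsub>M\<^esub> a) ` mt ` U)"
        by (rule M.meet_sup_distrib[OF mB c(1)])
      also have "\<dots> \<sqsubseteq>\<^bsub>M\<^esub> \<Squnion>\<^bsub>M\<^esub>(mt ` W)"
      proof (rule M.sup_least)
        fix x assume "x \<in> (\<lambda>a. mt B \<sqinter>\<^bsub>M\<^esub> a) ` mt ` U"
        then obtain A where A: "A \<in> U" "x = mt B \<sqinter>\<^bsub>M\<^esub> mt A" by auto
        then have "x = mt (A \<union> B)" using mt_Un[of B A] A B U V by (auto simp: Un_commute)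
        then show "x \<sqsubseteq>\<^bsub>M\<^esub> \<Squnion>\<^bsub>M\<^esub>(mt ` W)" using W(2)[OF A(1) B] by (intro M.sup_upper[OF c(3)]) auto
      qed (use c mB cc in auto)
      finally show ?thesis by (simp add: meet_comm)
    qed
    then have "\<Squnion>\<^bsub>M\<^esub>((\<lambda>a. \<Squnion>\<^bsub>M\<^esub>(mt ` U) \<sqinter>\<^bsub>M\<^esub> a) ` mt ` V) \<sqsubseteq>\<^bsub>M\<^esub> \<Squnion>\<^bsub>M\<^esub>(mt ` W)"
      by (intro M.sup_least) (use c cc in auto)
    then show ?thesis using M.meet_sup_distrib[OF cc(1) c(2)] by simp
  qed
  fix y assume y: "y \<in> carrier M" "y \<sqsubseteq>\<^bsub>M\<^esub> \<Squnion>\<^bsub>M\<^esub>(mt ` U)" "y \<sqsubseteq>\<^bsub>M\<^esub> \<Squnion>\<^bsub>M\<^esub>(mt ` V)"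
  have "y \<sqsubseteq>\<^bsub>M\<^esub> \<Squnion>\<^bsub>M\<^esub>(mt ` U) \<sqinter>\<^bsub>M\<^esub> \<Squnion>\<^bsub>M\<^esub>(mt ` V)" by (rule M.meet_le) (use y cc in auto)
  then show "y \<sqsubseteq>\<^bsub>M\<^esub> \<Squnion>\<^bsub>M\<^esub>(mt ` W)" by (rule M.le_trans[OF _ le]) (use y cc in auto)
qed

private lemma peval_eq:
  assumes "pform_over (props P) a"
  shows "peval M j a = \<Squnion>\<^bsub>M\<^esub>(mt ` (F \<inter> pform_val a))"
  using assms
proof (induction a)
  case (Prop g)
  then have g: "{g} \<in> F" "j g \<in> carrier M" using j by (auto simp: Fpow_def)
  then have mg: "mt {g} = j g" by (simp add: mt_def)
  have "\<Squnion>\<^bsub>M\<^esub>(mt ` (F \<inter> pform_val (Prop g))) = j g"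
  proof (rule M.sup_eqI)
    fix y assume y: "\<And>a. a \<in> mt ` (F \<inter> pform_val (Prop g)) \<Longrightarrow> a \<sqsubseteq>\<^bsub>M\<^esub> y"
    have "mt {g} \<sqsubseteq>\<^bsub>M\<^esub> y" by (intro y imageI) (use g in auto)
    then show "j g \<sqsubseteq>\<^bsub>M\<^esub> y" using mg by simp
  qed (use g mt_closed mt_le in auto)
  then show ?case by simp
next
  case PTop
  have "\<Squnion>\<^bsub>M\<^esub>(mt ` F) = \<top>\<^bsub>M\<^esub>"
  proof (rule M.sup_eqI)
    fix y assume y: "\<And>a. a \<in> mt ` F \<Longrightarrow> a \<sqsubseteq>\<^bsub>M\<^esub> y"
    have "mt {} \<sqsubseteq>\<^bsub>M\<^esub> y" by (intro y imageI empty_in_Fpow)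
    then show "\<top>\<^bsub>M\<^esub> \<sqsubseteq>\<^bsub>M\<^esub> y" using mt_empty by simp
  qed (use mt_closed in auto)
  then show ?case by simp
next
  case (PConj a b)
  have "\<Squnion>\<^bsub>M\<^esub>(mt ` (F \<inter> pform_val a)) \<sqinter>\<^bsub>M\<^esub> \<Squnion>\<^bsub>M\<^esub>(mt ` (F \<inter> pform_val b)) =
      \<Squnion>\<^bsub>M\<^esub>(mt ` (F \<inter> (pform_val a \<inter> pform_val b)))"
    by (rule sup_meet_sup) (auto intro: F_Un pform_val_mono)
  then show ?case using PConj by simp
next
  case (PDisj I f)
  let ?v = "\<lambda>i. F \<inter> pform_val (f i)"
  have img: "(\<lambda>i. peval M j (f i)) ` I = (\<lambda>i. \<Squnion>\<^bsub>M\<^esub>(mt ` ?v i)) ` I"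
    using PDisj by (intro image_cong) auto
  have c: "mt ` ?v i \<subseteq> carrier M" for i using mt_closed by auto
  have c': "mt ` (F \<inter> pform_val (PDisj I f)) \<subseteq> carrier M" using mt_closed by auto
  have "\<Squnion>\<^bsub>M\<^esub>((\<lambda>i. \<Squnion>\<^bsub>M\<^esub>(mt ` ?v i)) ` I) = \<Squnion>\<^bsub>M\<^esub>(mt ` (F \<inter> pform_val (PDisj I f)))"
  proof (rule M.sup_eqI)
    fix x assume "x \<in> (\<lambda>i. \<Squnion>\<^bsub>M\<^esub>(mt ` ?v i)) ` I"
    then obtain i where i: "i \<in> I" "x = \<Squnion>\<^bsub>M\<^esub>(mt ` ?v i)" by auto
    show "x \<sqsubseteq>\<^bsub>M\<^esub> \<Squnion>\<^bsub>M\<^esub>(mt ` (F \<inter> pform_val (PDisj I f)))"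
      unfolding i(2) by (rule M.sup_least) (use c c' i in \<open>auto intro!: M.sup_upper\<close>)
  next
    fix y assume y: "y \<in> carrier M" "\<And>a. a \<in> (\<lambda>i. \<Squnion>\<^bsub>M\<^esub>(mt ` ?v i)) ` I \<Longrightarrow> a \<sqsubseteq>\<^bsub>M\<^esub> y"
    show "\<Squnion>\<^bsub>M\<^esub>(mt ` (F \<inter> pform_val (PDisj I f))) \<sqsubseteq>\<^bsub>M\<^esub> y"
    proof (rule M.sup_least[OF c' y(1)])
      fix x assume "x \<in> mt ` (F \<inter> pform_val (PDisj I f))"
      then obtain i where i: "i \<in> I" "x \<in> mt ` ?v i" by auto
      have "x \<sqsubseteq>\<^bsub>M\<^esub> \<Squnion>\<^bsub>M\<^esub>(mt ` ?v i)" by (rule M.sup_upper[OF c i(2)])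
      moreover have "\<Squnion>\<^bsub>M\<^esub>(mt ` ?v i) \<sqsubseteq>\<^bsub>M\<^esub> y" using i y(2) by auto
      ultimately show "x \<sqsubseteq>\<^bsub>M\<^esub> y"
        by (rule M.le_trans) (use i c y(1) in auto)
    qed
  qed (use c c' in auto)
  then show ?case using img by simp
qed

private lemma ideal_below:
  assumes y: "y \<in> carrier M"
  shows "theory_ideal P {A \<in> F. mt A \<sqsubseteq>\<^bsub>M\<^esub> y}" (is "theory_ideal P ?D")
proof (rule theory_idealI)
  fix A B assume A: "A \<in> ?D" and B: "B \<in> F" "A \<subseteq> B"
  have "mt B \<sqsubseteq>\<^bsub>M\<^esub> mt A" using A B mt_anti by auto
  then have "mt B \<sqsubseteq>\<^bsub>M\<^esub> y" by (rule M.le_trans) (use A B y mt_closed in auto)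
  then show "B \<in> ?D" using B by auto
next
  fix a b A B
  assume ab: "(a, b) \<in> paxioms P" and A: "A \<in> F"
    and b: "\<And>B. B \<in> F \<Longrightarrow> A \<subseteq> B \<Longrightarrow> B \<in> pform_val b \<Longrightarrow> B \<in> ?D"
    and B: "B \<in> F" "A \<subseteq> B" "B \<in> pform_val a"
  have over: "pform_over (props P) a" "pform_over (props P) b"
    using P ab by (auto simp: propositional_theory_def)
  let ?V = "F \<inter> pform_val b"
  have c: "mt ` ?V \<subseteq> carrier M" "mt ` (F \<inter> pform_val a) \<subseteq> carrier M" using mt_closed by auto
  have mA: "mt A \<in> carrier M" and mB: "mt B \<in> carrier M" using A B mt_closed by auto
  have "mt A \<sqinter>\<^bsub>M\<^esub> peval M j b = \<Squnion>\<^bsub>M\<^esub>((\<lambda>x. mt A \<sqinter>\<^bsub>M\<^esub> x) ` mt ` ?V)"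
    unfolding peval_eq[OF over(2)] by (rule M.meet_sup_distrib[OF mA c(1)])
  also have "\<dots> \<sqsubseteq>\<^bsub>M\<^esub> y"
  proof (rule M.sup_least)
    fix x assume "x \<in> (\<lambda>x. mt A \<sqinter>\<^bsub>M\<^esub> x) ` mt ` ?V"
    then obtain C where C: "C \<in> F" "C \<in> pform_val b" "x = mt A \<sqinter>\<^bsub>M\<^esub> mt C" by auto
    then have "x = mt (A \<union> C)" using mt_Un A by simp
    moreover have "A \<union> C \<in> ?D"
      by (rule b) (use A C F_Un pform_val_mono[of C b "A \<union> C"] in auto)
    ultimately show "x \<sqsubseteq>\<^bsub>M\<^esub> y" by auto
  qed (use c mA y in auto)
  finally have 1: "mt A \<sqinter>\<^bsub>M\<^esub> peval M j b \<sqsubseteq>\<^bsub>M\<^esub> y" .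
  have ca: "peval M j a \<in> carrier M" and cb: "peval M j b \<in> carrier M"
    using peval_eq[OF over(1)] peval_eq[OF over(2)] c by auto
  have "mt B \<sqsubseteq>\<^bsub>M\<^esub> peval M j a"
    unfolding peval_eq[OF over(1)] by (rule M.sup_upper) (use B c in auto)
  then have "mt B \<sqsubseteq>\<^bsub>M\<^esub> peval M j b" using sound[OF ab] mB ca cb by (rule M.le_trans)
  moreover have "mt B \<sqsubseteq>\<^bsub>M\<^esub> mt A" using A B mt_anti by auto
  ultimately have "mt B \<sqsubseteq>\<^bsub>M\<^esub> mt A \<sqinter>\<^bsub>M\<^esub> peval M j b" using mA mB cb by (intro M.meet_le)
  then have "mt B \<sqsubseteq>\<^bsub>M\<^esub> y" using 1 by (rule M.le_trans) (use mA mB cb y in auto)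
  then show "B \<in> ?D" using B by auto
qed auto

private definition hom where "hom D = \<Squnion>\<^bsub>M\<^esub>(mt ` D)"

private lemma mt_sub: "D \<subseteq> F \<Longrightarrow> mt ` D \<subseteq> carrier M"
  using mt_closed by auto

private lemma hom_closed: "D \<subseteq> F \<Longrightarrow> hom D \<in> carrier M"
  using mt_sub by (auto simp: hom_def)

private lemma hom_le: "D \<subseteq> F \<Longrightarrow> y \<in> carrier M \<Longrightarrow> hom D \<sqsubseteq>\<^bsub>M\<^esub> y \<longleftrightarrow> (\<forall>A\<in>D. mt A \<sqsubseteq>\<^bsub>M\<^esub> y)"
proof
  assume D: "D \<subseteq> F" "y \<in> carrier M" "hom D \<sqsubseteq>\<^bsub>M\<^esub> y"
  show "\<forall>A\<in>D. mt A \<sqsubseteq>\<^bsub>M\<^esub> y"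
  proof
    fix A assume "A \<in> D"
    then have "mt A \<sqsubseteq>\<^bsub>M\<^esub> hom D" unfolding hom_def using D mt_sub by (intro M.sup_upper) auto
    then show "mt A \<sqsubseteq>\<^bsub>M\<^esub> y"
      by (rule M.le_trans) (use D \<open>A \<in> D\<close> mt_closed hom_closed in auto)
  qed
next
  assume "D \<subseteq> F" "y \<in> carrier M" "\<forall>A\<in>D. mt A \<sqsubseteq>\<^bsub>M\<^esub> y"
  then show "hom D \<sqsubseteq>\<^bsub>M\<^esub> y" unfolding hom_def using mt_sub by (intro M.sup_least) auto
qed

private lemma hom_closure:
  assumes U: "U \<subseteq> F"
  shows "hom (ideal_closure P U) = hom U"
proof (rule M.le_antisym)
  have cl: "ideal_closure P U \<subseteq> F" by (rule ideal_closure_least[OF theory_ideal_F U])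
  show c: "hom (ideal_closure P U) \<in> carrier M" "hom U \<in> carrier M" using cl U hom_closed by auto
  have "U \<subseteq> {A \<in> F. mt A \<sqsubseteq>\<^bsub>M\<^esub> hom U}" using U hom_le[OF U c(2)] c(2) by auto
  then have "ideal_closure P U \<subseteq> {A \<in> F. mt A \<sqsubseteq>\<^bsub>M\<^esub> hom U}"
    by (rule ideal_closure_least[OF ideal_below[OF c(2)]])
  then show "hom (ideal_closure P U) \<sqsubseteq>\<^bsub>M\<^esub> hom U" using hom_le[OF cl c(2)] by auto
  show "hom U \<sqsubseteq>\<^bsub>M\<^esub> hom (ideal_closure P U)"
    using hom_le[OF U c(1)] hom_le[OF cl c(1)] ideal_closure_upper[of U] c(1) by auto
qed

private lemma hom_UN:
  assumes A: "\<And>D. D \<in> \<A> \<Longrightarrow> D \<subseteq> F"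
  shows "hom (\<Union>\<A>) = \<Squnion>\<^bsub>M\<^esub>(hom ` \<A>)"
proof (rule M.sup_eqI[symmetric])
  have U: "\<Union>\<A> \<subseteq> F" using A by auto
  show s: "hom ` \<A> \<subseteq> carrier M" using A hom_closed by auto
  show c: "hom (\<Union>\<A>) \<in> carrier M" using U hom_closed by auto
  have bound: "\<forall>A\<in>\<Union>\<A>. mt A \<sqsubseteq>\<^bsub>M\<^esub> hom (\<Union>\<A>)" using hom_le[OF U c] c by simp
  fix x assume "x \<in> hom ` \<A>"
  then obtain D where D: "D \<in> \<A>" "x = hom D" by auto
  show "x \<sqsubseteq>\<^bsub>M\<^esub> hom (\<Union>\<A>)" unfolding D(2) hom_le[OF A[OF D(1)] c] using bound D(1) by blast
next
  have U: "\<Union>\<A> \<subseteq> F" using A by auto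
  fix y assume y: "y \<in> carrier M" "\<And>a. a \<in> hom ` \<A> \<Longrightarrow> a \<sqsubseteq>\<^bsub>M\<^esub> y"
  show "hom (\<Union>\<A>) \<sqsubseteq>\<^bsub>M\<^esub> y" unfolding hom_le[OF U y(1)]
  proof
    fix B assume "B \<in> \<Union>\<A>"
    then obtain D where D: "D \<in> \<A>" "B \<in> D" by auto
    have "\<forall>A\<in>D. mt A \<sqsubseteq>\<^bsub>M\<^esub> y" using y(2)[OF imageI[OF D(1)]] hom_le[OF A[OF D(1)] y(1)] by simp
    then show "mt B \<sqsubseteq>\<^bsub>M\<^esub> y" using D(2) by simp
  qed
qed

theorem classifying_frame_universal:
  "\<exists>h. frame_hom (classifying_frame P) M h \<and> (\<forall>g\<in>props P. h (generator P g) = j g)"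
proof (intro exI conjI ballI)
  show "frame_hom (classifying_frame P) M hom"
    unfolding frame_hom_def
  proof (intro conjI ballI allI impI)
    show "hom \<in> carrier (classifying_frame P) \<rightarrow> carrier M"
      using hom_closed theory_idealD(1) by (auto simp: classifying_frame_def)
    show "hom \<top>\<^bsub>classifying_frame P\<^esub> = \<top>\<^bsub>M\<^esub>"
      using peval_eq[of PTop] by (simp add: classifying_frame(2) hom_def)
  next
    fix D E assume "D \<in> carrier (classifying_frame P)" "E \<in> carrier (classifying_frame P)"
    then have D: "theory_ideal P D" and E: "theory_ideal P E" by (auto simp: classifying_frame_def)
    have "A \<union> B \<in> D \<inter> E" if "A \<in> D" "B \<in> E" for A B
    proof -
      have "A \<union> B \<in> F" using that theory_idealD(1)[OF D] theory_idealD(1)[OF E] F_Un by auto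
      then show ?thesis
        using theory_idealD(2)[OF D that(1), of "A \<union> B"] theory_idealD(2)[OF E that(2), of "A \<union> B"]
        by auto
    qed
    then have "hom D \<sqinter>\<^bsub>M\<^esub> hom E = hom (D \<inter> E)"
      unfolding hom_def using theory_idealD(1)[OF D] theory_idealD(1)[OF E]
      by (intro sup_meet_sup) auto
    then show "hom (D \<sqinter>\<^bsub>classifying_frame P\<^esub> E) = hom D \<sqinter>\<^bsub>M\<^esub> hom E"
      using classifying_frame(4)[OF D E] by simp
  next
    fix \<A> assume "\<A> \<subseteq> carrier (classifying_frame P)"
    then have A: "\<A> \<subseteq> Collect (theory_ideal P)" by (auto simp: classifying_frame_def)
    then have A': "\<And>D. D \<in> \<A> \<Longrightarrow> D \<subseteq> F" using theory_idealD(1) by blast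
    have "hom (ideal_closure P (\<Union>\<A>)) = \<Squnion>\<^bsub>M\<^esub>(hom ` \<A>)"
      using hom_closure[of "\<Union>\<A>"] hom_UN[OF A'] A' by auto
    then show "hom (\<Squnion>\<^bsub>classifying_frame P\<^esub>\<A>) = \<Squnion>\<^bsub>M\<^esub>(hom ` \<A>)"
      using classifying_frame(3)[OF A] by simp
  qed
next
  fix g assume "g \<in> props P"
  then have "j g = \<Squnion>\<^bsub>M\<^esub>(mt ` (F \<inter> pform_val (Prop g)))" using peval_eq[of "Prop g"] by simp
  moreover have "hom (generator P g) = hom {A \<in> F. g \<in> A}"
    unfolding generator_def by (rule hom_closure) auto
  ultimately show "hom (generator P g) = j g" by (simp add: hom_def Int_def)
qed

end

theorem classifying_frame_hom_unique:
  fixes M :: "'m gorder"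
  assumes h: "frame_hom (classifying_frame P) M h" and k: "frame_hom (classifying_frame P) M k"
    and hk: "\<And>g. g \<in> props P \<Longrightarrow> h (generator P g) = k (generator P g)"
    and D: "D \<in> carrier (classifying_frame P)"
  shows "h D = k D"
proof -
  let ?L = "classifying_frame P" and ?c = "\<lambda>A. ideal_closure P {B \<in> F. A \<subseteq> B}"
  note hh = frame_homD[OF h] and kk = frame_homD[OF k]
  have c: "?c A \<in> carrier ?L" for A
    by (auto simp: classifying_frame_def intro: theory_ideal_closure)
  have cA: "h (?c A) = k (?c A)" if "A \<in> F" for A
  proof -
    have "finite A" "A \<subseteq> props P" using that by (auto simp: Fpow_def)
    then show ?thesis
    proof (induction A rule: finite_induct)
      case empty
      have "?c {} = \<top>\<^bsub>?L\<^esub>" by (simp add: classifying_frame(2) ideal_closure_ideal theory_ideal_F)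
      then show ?case using hh(2) kk(2) by simp
    next
      case (insert g A)
      have "generator P g \<inter> ?c A = ideal_closure P ({B \<in> F. g \<in> B} \<inter> {B \<in> F. A \<subseteq> B})"
        unfolding generator_def by (rule ideal_closure_Int) auto
      also have "{B \<in> F. g \<in> B} \<inter> {B \<in> F. A \<subseteq> B} = {B \<in> F. insert g A \<subseteq> B}" by auto
      finally have "?c (insert g A) = generator P g \<sqinter>\<^bsub>?L\<^esub> ?c A"
        using classifying_frame(4)[of "generator P g" "?c A"] generator_closed c
        by (auto simp: classifying_frame_def)
      then show ?case
        using insert hk hh(3)[OF generator_closed c] kk(3)[OF generator_closed c] by simp
    qed
  qed
  have DI: "theory_ideal P D" using D by (simp add: classifying_frame_def)
  have "D = ideal_closure P (\<Union>(?c ` D))"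
  proof
    show "D \<subseteq> ideal_closure P (\<Union>(?c ` D))"
    proof
      fix A assume A: "A \<in> D"
      then have "A \<in> ?c A" using theory_idealD(1)[OF DI] by (intro subsetD[OF ideal_closure_upper]) auto
      then show "A \<in> ideal_closure P (\<Union>(?c ` D))" using A by (intro subsetD[OF ideal_closure_upper]) auto
    qed
    show "ideal_closure P (\<Union>(?c ` D)) \<subseteq> D"
      by (intro ideal_closure_least[OF DI] UN_least) (use theory_idealD(2)[OF DI] in auto)
  qed
  then have D_eq: "D = \<Squnion>\<^bsub>?L\<^esub>(?c ` D)"
    using classifying_frame(3)[of "?c ` D"] c by (auto simp: classifying_frame_def)
  have sub: "?c ` D \<subseteq> carrier ?L" using c by auto
  have "h ` ?c ` D = k ` ?c ` D"
    unfolding image_image by (rule image_cong) (use cA theory_idealD(1)[OF DI] in auto)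
  then have "h (\<Squnion>\<^bsub>?L\<^esub>(?c ` D)) = k (\<Squnion>\<^bsub>?L\<^esub>(?c ` D))"
    using hh(4)[OF sub] kk(4)[OF sub] by simp
  then show ?thesis using D_eq by simp
qed

end

theorem loc_coequaliser_any_type:
  fixes L0 :: "'g set set gorder"
  assumes L0: "frame L0" and s: "frame_hom L0 L1 s" and t: "frame_hom L0 L1 t"
    and co: "loc_coequaliser TYPE('g set set) L0 L1 s t E q"
  shows "loc_coequaliser TYPE('m) L0 L1 s t E q"
proof -
  note Eq = equaliser_frame[OF L0 s t]
  let ?Q = "equaliser_frame L0 s t"
  have E: "frame E" and q: "frame_hom E L0 q" and sq: "\<And>x. x \<in> carrier E \<Longrightarrow> s (q x) = t (q x)"
    using co by (auto simp: loc_coequaliser_def)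
  have univ: "\<exists>k. frame_hom K E k \<and> (\<forall>x\<in>carrier K. q (k x) = h x) \<and>
      (\<forall>k'. frame_hom K E k' \<and> (\<forall>x\<in>carrier K. q (k' x) = h x) \<longrightarrow> (\<forall>x\<in>carrier K. k' x = k x))"
    if "frame K" "frame_hom K L0 h" "\<forall>x\<in>carrier K. s (h x) = t (h x)"
    for K :: "'g set set gorder" and h
    using co that by (auto simp: loc_coequaliser_def)
  have "\<forall>x\<in>carrier ?Q. s (id x) = t (id x)" using Eq(3) by simp
  then obtain k where k: "frame_hom ?Q E k" "\<And>x. x \<in> carrier ?Q \<Longrightarrow> q (k x) = x"
    using univ[OF Eq(1,2)] by auto
  have inj: "x = y" if xy: "x \<in> carrier E" "y \<in> carrier E" "q x = q y" for x y
  proof -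
    define P :: "('g, unit) prop_theory" where "P = \<lparr>props = {undefined}, paxioms = {}\<rparr>"
    have P: "propositional_theory P" by (simp add: P_def propositional_theory_def)
    have fr: "\<exists>h. frame_hom (classifying_frame P) E h \<and> (\<forall>g\<in>props P. h (generator P g) = x)"
      if "x \<in> carrier E" for x
      by (rule classifying_frame_universal[OF E P]) (use that in \<open>auto simp: P_def\<close>)
    obtain h1 where h1: "frame_hom (classifying_frame P) E h1" "h1 (generator P undefined) = x"
      using fr[OF xy(1)] by (auto simp: P_def)
    obtain h2 where h2: "frame_hom (classifying_frame P) E h2" "h2 (generator P undefined) = y"
      using fr[OF xy(2)] by (auto simp: P_def)
    have qh: "frame_hom (classifying_frame P) L0 (q \<circ> h1)" "frame_hom (classifying_frame P) L0 (q \<circ> h2)"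
      using frame_hom_comp h1 h2 q by blast+
    have eq: "(q \<circ> h1) D = (q \<circ> h2) D" if "D \<in> carrier (classifying_frame P)" for D
      by (rule classifying_frame_hom_unique[OF qh _ that]) (simp add: P_def[symmetric], use h1 h2 xy in \<open>auto simp: P_def\<close>)
    have "\<forall>D\<in>carrier (classifying_frame P). s ((q \<circ> h1) D) = t ((q \<circ> h1) D)"
      using sq frame_homD(1)[OF h1(1)] by auto
    from univ[OF classifying_frame(1) qh(1) this]
    have "\<forall>D\<in>carrier (classifying_frame P). h1 D = h2 D"
      using h1(1) h2(1) eq by (metis comp_apply)
    then show "x = y" using h1 h2 generator_closed by metis
  qed
  show ?thesis
    unfolding loc_coequaliser_def
  proof (intro conjI ballI allI impI E q sq)
    fix K :: "'m gorder" and h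
    assume *: "frame K \<and> frame_hom K L0 h \<and> (\<forall>x\<in>carrier K. s (h x) = t (h x))"
    then have h: "frame_hom K ?Q h" using Eq(4) by blast
    have kh: "frame_hom K E (k \<circ> h)" by (rule frame_hom_comp[OF h k(1)])
    have qkh: "q ((k \<circ> h) x) = h x" if "x \<in> carrier K" for x
      using k(2) frame_homD(1)[OF h that] by simp
    show "\<exists>k. frame_hom K E k \<and> (\<forall>x\<in>carrier K. q (k x) = h x) \<and>
      (\<forall>k'. frame_hom K E k' \<and> (\<forall>x\<in>carrier K. q (k' x) = h x) \<longrightarrow> (\<forall>x\<in>carrier K. k' x = k x))"
      by (rule exI[of _ "k \<circ> h"]) (use kh qkh inj frame_homD(1) in metis)
  qed
qed


subsection \<open>Well-formedness\<close>

lemma wf_rename: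
  "wf_form T \<Gamma> \<phi> \<Longrightarrow> renaming \<Gamma> \<Delta> \<rho> \<Longrightarrow> wf_form T \<Delta> (rename \<rho> \<phi>)"
proof (induction \<phi> arbitrary: \<Gamma> \<Delta> \<rho>)
  case (Atom r vs)
  then show ?case
    by (auto simp: renaming_def list_all2_map1 elim!: list_all2_mono)
next
  case (Exists X \<phi>)
  have "renaming (X # \<Gamma>) (X # \<Delta>) (lift_ren \<rho>)"
    unfolding renaming_def
  proof (intro allI impI)
    fix v assume "v < length (X # \<Gamma>)"
    then show "lift_ren \<rho> v < length (X # \<Delta>) \<and> (X # \<Delta>) ! lift_ren \<rho> v = (X # \<Gamma>) ! v"
      using Exists.prems(2) by (cases v) (auto simp: renaming_def)
  qed
  then show ?case using Exists by auto
qed (auto simp: renaming_def)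

lemma renaming_Suc: "renaming \<Gamma> (X # \<Gamma>) Suc"
  by (simp add: renaming_def)

lemma renaming_subst: "v < length \<Gamma> \<Longrightarrow> \<Gamma> ! v = X \<Longrightarrow> renaming (X # \<Gamma>) \<Gamma> (case_nat v id)"
  by (auto simp: renaming_def split: nat.split)

theorem proves_in_context:
  assumes "geometric_theory T" "proves T \<Gamma> \<phi> \<psi>"
  shows "form_in_context T \<Gamma> \<phi> \<and> form_in_context T \<Gamma> \<psi>"
  using assms(2)
proof induction
  case (axiom \<Gamma> \<phi> \<psi>)
  then show ?case using assms(1) by (auto simp: geometric_theory_def)
next
  case (disj_left \<Gamma> \<psi> I f)
  then show ?case by (auto simp: form_in_context_def)
next
  case (exists_left_inverse \<Gamma> X \<phi> \<psi>)
  then show ?case by (auto simp: form_in_context_def intro: wf_rename renaming_Suc)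
qed (auto simp: form_in_context_def intro: wf_rename renaming_subst renaming_Suc)

lemma wf_map_form:
  assumes "\<And>r. r \<in> rels T \<Longrightarrow> g r \<in> rels T' \<and> arity T' (g r) = map f (arity T r)"
    and "f ` sorts T \<subseteq> sorts T'"
  shows "wf_form T \<Gamma> \<phi> \<Longrightarrow> wf_form T' (map f \<Gamma>) (map_form f g \<phi>)"
proof (induction \<phi> arbitrary: \<Gamma>)
  case (Atom r vs)
  then have "list_all2 (\<lambda>v X. v < length \<Gamma> \<and> \<Gamma> ! v = X) vs (arity T r)" by simp
  then have "list_all2 (\<lambda>v X. v < length \<Gamma> \<and> map f \<Gamma> ! v = f X) vs (arity T r)"
    by (rule list_all2_mono) auto
  then show ?case using Atom assms(1)[of r] by (simp add: list_all2_map2)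
next
  case (Exists X \<phi>)
  from Exists.IH[of "X # \<Gamma>"] Exists.prems assms(2) show ?case by auto
qed auto

lemma wf_Conjs: "wf_form T \<Gamma> (Conjs xs) \<longleftrightarrow> (\<forall>\<phi>\<in>set xs. wf_form T \<Gamma> \<phi>)"
  by (induction xs) (auto simp: Conjs_def)

theorem geometric_theory_iso_theory:
  assumes T: "geometric_theory T"
  shows "geometric_theory (iso_theory T)"
proof -
  let ?I = "iso_theory T"
  have ar: "set (arity ?I r) \<subseteq> sorts ?I" if "r \<in> rels ?I" for r
  proof -
    have "\<And>r X. r \<in> rels T \<Longrightarrow> X \<in> set (arity T r) \<Longrightarrow> X \<in> sorts T"
      using T unfolding geometric_theory_def by blast
    then show ?thesis using that by (auto simp: iso_theory_def)
  qed
  have wf1: "form_in_context ?I (map Sort1 \<Gamma>) (map_form Sort1 Rel1 \<phi>)"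
    if "form_in_context T \<Gamma> \<phi>" for \<Gamma> \<phi>
    using that wf_map_form[of T Rel1 ?I Sort1 \<Gamma> \<phi>]
    by (auto simp: form_in_context_def iso_theory_def)
  have wf2: "form_in_context ?I (map Sort2 \<Gamma>) (map_form Sort2 Rel2 \<phi>)"
    if "form_in_context T \<Gamma> \<phi>" for \<Gamma> \<phi>
    using that wf_map_form[of T Rel2 ?I Sort2 \<Gamma> \<phi>]
    by (auto simp: form_in_context_def iso_theory_def)
  have al: "form_in_context ?I \<Gamma> \<phi> \<and> form_in_context ?I \<Gamma> \<psi>"
    if "X \<in> sorts T" "(\<Gamma>, \<phi>, \<psi>) \<in> iso_alpha_axioms X" for X \<Gamma> \<phi> \<psi>
    using that by (auto simp: iso_alpha_axioms_def Let_def form_in_context_def iso_theory_def)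
  have re: "form_in_context ?I \<Gamma> \<phi> \<and> form_in_context ?I \<Gamma> \<psi>"
    if r: "r \<in> rels T" and ax: "(\<Gamma>, \<phi>, \<psi>) \<in> iso_rel_axioms T r" for r \<Gamma> \<phi> \<psi>
  proof -
    let ?k = "length (arity T r)"
    let ?G = "map Sort1 (arity T r) @ map Sort2 (arity T r)"
    let ?\<alpha> = "Conjs (map (\<lambda>i. Atom (Alpha (arity T r ! i)) [i, ?k + i]) [0..<?k])"
    have s: "set (arity T r) \<subseteq> sorts T" using T r by (auto simp: geometric_theory_def)
    have "wf_form ?I ?G ?\<alpha>"
      using subsetD[OF s nth_mem] by (auto simp: wf_Conjs nth_append iso_theory_def)
    moreover have "wf_form ?I ?G (Atom (Rel1 r) [0..<?k])"
      using r by (auto simp: iso_theory_def list_all2_conv_all_nth nth_append)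
    moreover have "wf_form ?I ?G (Atom (Rel2 r) [?k..<2 * ?k])"
      using r by (auto simp: iso_theory_def list_all2_conv_all_nth nth_append)
    moreover have "set ?G \<subseteq> sorts ?I" using s by (auto simp: iso_theory_def)
    ultimately have "form_in_context ?I ?G (Conj ?\<alpha> (Atom (Rel1 r) [0..<?k]))"
      "form_in_context ?I ?G (Conj ?\<alpha> (Atom (Rel2 r) [?k..<2 * ?k]))"
      unfolding form_in_context_def wf_form.simps(4) by blast+
    then show ?thesis using ax by (auto simp only: iso_rel_axioms_def Let_def prod.inject insert_iff empty_iff)
  qed
  have "form_in_context ?I \<Gamma> \<phi> \<and> form_in_context ?I \<Gamma> \<psi>" if "(\<Gamma>, \<phi>, \<psi>) \<in> axioms ?I" for \<Gamma> \<phi> \<psi>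
  proof -
    from that consider \<Gamma>' \<phi>' \<psi>' where "(\<Gamma>', \<phi>', \<psi>') \<in> axioms T" "\<Gamma> = map Sort1 \<Gamma>'"
        "\<phi> = map_form Sort1 Rel1 \<phi>'" "\<psi> = map_form Sort1 Rel1 \<psi>'"
      | \<Gamma>' \<phi>' \<psi>' where "(\<Gamma>', \<phi>', \<psi>') \<in> axioms T" "\<Gamma> = map Sort2 \<Gamma>'"
        "\<phi> = map_form Sort2 Rel2 \<phi>'" "\<psi> = map_form Sort2 Rel2 \<psi>'"
      | X where "X \<in> sorts T" "(\<Gamma>, \<phi>, \<psi>) \<in> iso_alpha_axioms X"
      | r where "r \<in> rels T" "(\<Gamma>, \<phi>, \<psi>) \<in> iso_rel_axioms T r"
      unfolding iso_theory_def by auto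
    then show ?thesis
    proof cases
      case 1
      then have "form_in_context T \<Gamma>' \<phi>'" "form_in_context T \<Gamma>' \<psi>'"
        using T by (auto simp: geometric_theory_def)
      then show ?thesis using 1 wf1 by simp
    next
      case 2
      then have "form_in_context T \<Gamma>' \<phi>'" "form_in_context T \<Gamma>' \<psi>'"
        using T by (auto simp: geometric_theory_def)
      then show ?thesis using 2 wf2 by simp
    next
      case 3 then show ?thesis by (rule al)
    next
      case 4 then show ?thesis by (rule re)
    qed
  qed
  then show ?thesis using ar unfolding geometric_theory_def by auto
qed

lemma pform_over_PConjs: "pform_over G (PConjs xs) \<longleftrightarrow> (\<forall>a\<in>set xs. pform_over G a)"
  by (induction xs) (auto simp: PConjs_def)

lemma pform_over_sims:
  "set Xs \<subseteq> sorts T \<Longrightarrow> pform_over (props (nat_theory T)) (sims Xs ns ms)"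
  by (auto simp: sims_def pform_over_PConjs nat_theory_def)

lemma pform_over_inst:
  "wf_form T \<Gamma> \<phi> \<Longrightarrow> set \<Gamma> \<subseteq> sorts T \<Longrightarrow> pform_over (props (nat_theory T)) (inst \<phi> ns)"
proof (induction \<phi> arbitrary: \<Gamma> ns)
  case (Atom r vs)
  then show ?case by (auto simp: nat_theory_def dest: list_all2_lengthD)
next
  case (Equal X v w)
  then show ?case by (auto simp: nat_theory_def)
next
  case (Exists X \<phi>)
  from Exists.IH[of "X # \<Gamma>"] Exists.prems show ?case by (auto simp: nat_theory_def)
qed auto

theorem propositional_theory_nat_theory:
  assumes T: "geometric_theory T"
  shows "propositional_theory (nat_theory T)"
proof -
  have s: "set (arity T r) \<subseteq> sorts T" if "r \<in> rels T" for r
    using T that by (auto simp: geometric_theory_def)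
  have ax: "set \<Gamma> \<subseteq> sorts T \<and> wf_form T \<Gamma> \<phi> \<and> wf_form T \<Gamma> \<psi>" if "(\<Gamma>, \<phi>, \<psi>) \<in> axioms T" for \<Gamma> \<phi> \<psi>
    using T that by (auto simp: geometric_theory_def form_in_context_def)
  have Sim: "Sim X n m \<in> props (nat_theory T)" if "X \<in> sorts T" for X n m
    using that by (auto simp: nat_theory_def)
  have Holds: "Holds r ns \<in> props (nat_theory T)" if "r \<in> rels T" "length ns = length (arity T r)" for r ns
    using that by (auto simp: nat_theory_def)
  have "pform_over (props (nat_theory T)) a \<and> pform_over (props (nat_theory T)) b"
    if "(a, b) \<in> paxioms (nat_theory T)" for a b
  proof -
    let ?ok = "\<lambda>a. pform_over (props (nat_theory T)) a"
    from that consider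
        X n m where "X \<in> sorts T" "a = Prop (Sim X n m)" "b = Prop (Sim X m n)"
      | X n m l where "X \<in> sorts T" "a = PConj (Prop (Sim X n m)) (Prop (Sim X m l))" "b = Prop (Sim X n l)"
      | r ns ms where "r \<in> rels T" "length ns = length (arity T r)" "length ms = length (arity T r)"
          "a = PConj (Prop (Holds r ns)) (sims (arity T r) ns ms)" "b = Prop (Holds r ms)"
      | r ns where "r \<in> rels T" "length ns = length (arity T r)"
          "a = Prop (Holds r ns)" "b = sims (arity T r) ns ns"
      | \<Gamma> \<phi> \<psi> ns where "(\<Gamma>, \<phi>, \<psi>) \<in> axioms T" "a = PConj (sims \<Gamma> ns ns) (inst \<phi> ns)" "b = inst \<psi> ns"
      by (auto simp: nat_theory_def)
    then show ?thesis
    proof cases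
      case 5
      then show ?thesis using ax[OF 5(1)] pform_over_sims pform_over_inst by fastforce
    qed (auto simp: Sim Holds pform_over_sims s)
  qed
  then show ?thesis unfolding propositional_theory_def by auto
qed


subsection \<open>The source and target maps exist and are unique\<close>

lemma peval_map_pform: "peval M j (map_pform k a) = peval M (j \<circ> k) a"
  by (induction a) (simp_all cong: image_cong)

lemma map_PConjs: "map_pform k (PConjs xs) = PConjs (map (map_pform k) xs)"
  by (induction xs) (auto simp: PConjs_def)

lemma map_sims:
  "map_pform (map_nat_prop f g) (sims Xs ns ms) = sims (map f Xs) ns ms"
  by (auto simp: sims_def map_PConjs intro!: arg_cong[where f = PConjs])

lemma map_inst:
  "map_pform (map_nat_prop f g) (inst \<phi> ns) = inst (map_form f g \<phi>) ns"
proof (induction \<phi> arbitrary: ns)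
  case (Disj I h)
  then show ?case by (auto simp: fun_eq_iff split: sum.split)
next
  case (Exists X \<phi>)
  then show ?case by (auto simp: fun_eq_iff split: sum.split)
qed auto

lemma interpretation_hom_exists:
  assumes T: "geometric_theory T"
    and rels: "\<And>r. r \<in> rels T \<Longrightarrow>
      g r \<in> rels (iso_theory T) \<and> arity (iso_theory T) (g r) = map f (arity T r)"
    and sorts: "\<And>X. X \<in> sorts T \<Longrightarrow> f X \<in> sorts (iso_theory T)"
    and axioms: "\<And>\<Gamma> \<phi> \<psi>. (\<Gamma>, \<phi>, \<psi>) \<in> axioms T \<Longrightarrow>
      (map f \<Gamma>, map_form f g \<phi>, map_form f g \<psi>) \<in> axioms (iso_theory T)"
  shows "\<exists>h. frame_hom (G0_frame T) (G1_frame T) h \<and>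
    (\<forall>p\<in>props (nat_theory T).
       h (generator (nat_theory T) p) = generator (nat_theory (iso_theory T)) (map_nat_prop f g p))"
proof -
  let ?P = "nat_theory T" and ?Q = "nat_theory (iso_theory T)" and ?k = "map_nat_prop f g"
  have P: "propositional_theory ?P" by (rule propositional_theory_nat_theory[OF T])
  have Q: "propositional_theory ?Q"
    by (rule propositional_theory_nat_theory[OF geometric_theory_iso_theory[OF T]])
  have ax: "(map_pform ?k a, map_pform ?k b) \<in> paxioms ?Q" if "(a, b) \<in> paxioms ?P" for a b
  proof -
    from that consider
        X n m where "X \<in> sorts T" "a = Prop (Sim X n m)" "b = Prop (Sim X m n)"
      | X n m l where "X \<in> sorts T" "a = PConj (Prop (Sim X n m)) (Prop (Sim X m l))" "b = Prop (Sim X n l)"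
      | r ns ms where "r \<in> rels T" "length ns = length (arity T r)" "length ms = length (arity T r)"
          "a = PConj (Prop (Holds r ns)) (sims (arity T r) ns ms)" "b = Prop (Holds r ms)"
      | r ns where "r \<in> rels T" "length ns = length (arity T r)"
          "a = Prop (Holds r ns)" "b = sims (arity T r) ns ns"
      | \<Gamma> \<phi> \<psi> ns where "(\<Gamma>, \<phi>, \<psi>) \<in> axioms T" "length ns = length \<Gamma>"
          "a = PConj (sims \<Gamma> ns ns) (inst \<phi> ns)" "b = inst \<psi> ns"
      by (auto simp: nat_theory_def)
    then show ?thesis
    proof cases
      case 1 then show ?thesis using sorts by (simp add: nat_theory_def)
    next
      case 2 then show ?thesis using sorts by (simp add: nat_theory_def)
    next
      case 3
      have "(PConj (Prop (Holds (g r) ns)) (sims (arity (iso_theory T) (g r)) ns ms), Prop (Holds (g r) ms))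
          \<in> paxioms ?Q"
        using 3 rels[OF 3(1)] unfolding nat_theory_def by force
      then show ?thesis using 3 rels[OF 3(1)] by (simp add: map_sims)
    next
      case 4
      have "(Prop (Holds (g r) ns), sims (arity (iso_theory T) (g r)) ns ns) \<in> paxioms ?Q"
        using 4 rels[OF 4(1)] unfolding nat_theory_def by force
      then show ?thesis using 4 rels[OF 4(1)] by (simp add: map_sims)
    next
      case 5
      have "(PConj (sims (map f \<Gamma>) ns ns) (inst (map_form f g \<phi>) ns), inst (map_form f g \<psi>) ns)
          \<in> paxioms ?Q"
        using 5(2) axioms[OF 5(1)] unfolding nat_theory_def by force
      then show ?thesis using 5 by (simp add: map_sims map_inst)
    qed
  qed
  have "\<exists>h. frame_hom (G0_frame T) (G1_frame T) h \<and>
      (\<forall>p\<in>props ?P. h (generator ?P p) = (generator ?Q \<circ> ?k) p)"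
  proof (rule classifying_frame_universal[OF classifying_frame(1) P])
    show "(generator ?Q \<circ> ?k) p \<in> carrier (G1_frame T)" for p
      using generator_closed by simp
    fix a b assume "(a, b) \<in> paxioms ?P"
    from paxiom_le[OF Q ax[OF this]]
    show "peval (G1_frame T) (generator ?Q \<circ> ?k) a \<sqsubseteq>\<^bsub>G1_frame T\<^esub>
          peval (G1_frame T) (generator ?Q \<circ> ?k) b"
      by (simp add: peval_map_pform)
  qed
  then show ?thesis by simp
qed

theorem source_map_exists:
  assumes T: "geometric_theory T"
  shows "\<exists>s. source_map T s"
proof -
  have "\<exists>h. frame_hom (G0_frame T) (G1_frame T) h \<and>
    (\<forall>p\<in>props (nat_theory T). h (generator (nat_theory T) p) =
       generator (nat_theory (iso_theory T)) (map_nat_prop Sort1 Rel1 p))"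
    by (rule interpretation_hom_exists[OF T]) (auto simp: iso_theory_def)
  then show ?thesis unfolding source_map_def by (force simp: nat_theory_def)
qed

theorem target_map_exists:
  assumes T: "geometric_theory T"
  shows "\<exists>t. target_map T t"
proof -
  have "\<exists>h. frame_hom (G0_frame T) (G1_frame T) h \<and>
    (\<forall>p\<in>props (nat_theory T). h (generator (nat_theory T) p) =
       generator (nat_theory (iso_theory T)) (map_nat_prop Sort2 Rel2 p))"
    by (rule interpretation_hom_exists[OF T]) (auto simp: iso_theory_def)
  then show ?thesis unfolding target_map_def by (force simp: nat_theory_def)
qed

theorem source_map_unique:
  assumes "source_map T s" "source_map T s'" "D \<in> carrier (G0_frame T)"
  shows "s D = s' D"
  by (rule classifying_frame_hom_unique[where P = "nat_theory T" and M = "G1_frame T"])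
    (use assms in \<open>auto simp: source_map_def nat_theory_def\<close>)

theorem target_map_unique:
  assumes "target_map T t" "target_map T t'" "D \<in> carrier (G0_frame T)"
  shows "t D = t' D"
  by (rule classifying_frame_hom_unique[where P = "nat_theory T" and M = "G1_frame T"])
    (use assms in \<open>auto simp: target_map_def nat_theory_def\<close>)

end

theory Submission
  imports Defs
begin

text \<open>
  A point of \<open>G\<^sub>0\<close> is a model \<open>M\<close> of \<open>T\<close> with an enumeration \<open>e\<close>, that is, a partial surjection
  from the natural numbers onto each sort, and an open of the coequaliser of \<open>s\<close> and \<open>t\<close> is
  an open \<open>D\<close> of \<open>G\<^sub>0\<close> with \<open>s D = t D\<close>.  A sentence \<open>\<phi>\<close> defines the open
  \<open>V \<phi> = cover (nat_theory T) (pform_val (inst \<phi> []))\<close> of those enumerated models in which it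
  holds.  The proof shows that \<open>V\<close> induces an isomorphism of posets from the sentences modulo
  provability onto the opens \<open>D\<close> with \<open>s D = t D\<close>.  Such an isomorphism preserves finite meets
  and arbitrary joins, because these are determined by the order.

  That \<open>V\<close> preserves the order is the soundness of geometric logic (\<open>soundness\<close>), and that its
  values are equalised by \<open>s\<close> and \<open>t\<close> is the invariance of truth under isomorphism
  (\<open>sentence_equalised\<close>).  Both use that the truth of a formula can be transported along a total
  relation compatible with the basic propositions (\<open>inst_transfer\<close>): along the equality of
  \<open>T\<close> in the first case and along the isomorphism \<open>\<alpha>\<close> in the second.

  That \<open>V\<close> reflects the order (\<open>conservativity\<close>) would follow from a completeness theorem if
  there were enough models.  The role of models is played by formulae in context: a formula
  \<open>\<theta>\<close> in a context \<open>\<Delta>\<close>, with a naming \<open>e\<close> of variables in \<open>\<Delta>\<close> by numbers, forces the basic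
  propositions that it proves when read through \<open>e\<close>.  For a sentence \<open>\<psi>\<close>, the finite sets of
  basic propositions such that every \<open>\<theta>\<close> forcing them proves \<open>\<psi>\<close> form an element of the frame
  of \<open>G\<^sub>0\<close> that contains \<open>V \<psi>\<close> (\<open>theory_ideal_consequence\<close>).  The point is that an
  existential quantifier, which has become a disjunction over all numbers, can be tested on one
  number that has not been used before; that number names the variable introduced by the rule
  for the quantifier (\<open>forces_step\<close>).

  For surjectivity, let \<open>\<sigma>\<close> consist of a surjection from the natural numbers to themselves for
  each sort.  Then \<open>e \<circ> \<sigma>\<close> is again an enumeration of \<open>M\<close>, and the identity of \<open>M\<close> is an
  isomorphism from \<open>(M, e)\<close> to \<open>(M, e \<circ> \<sigma>)\<close>.  This gives a map from \<open>G\<^sub>0\<close> to \<open>G\<^sub>1\<close> that is a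
  section of the source map and whose composite with the target map renumbers by \<open>\<sigma>\<close>.
  Hence an open \<open>D\<close> with \<open>s D = t D\<close> is closed under renumbering (\<open>renumber_equalised\<close>).  Every
  finite substitution of numbers extends to such a \<open>\<sigma>\<close>, so the sentence \<open>\<phi>\<close> which says that some
  elements satisfy the finite diagram \<open>A \<in> D\<close> has \<open>A \<in> V \<phi> \<subseteq> D\<close>, and \<open>D\<close> is \<open>V\<close> of the
  disjunction of these sentences (\<open>equalised_sentence\<close>).  There are few enough finite diagrams
  for this disjunction to be a formula (\<open>inj_finite_props\<close>).
\<close>

section \<open>Covers in presented frames\<close>

text \<open>
  The element of the frame presented by \<open>P\<close> that a set \<open>U\<close> of finite conjunctions generates.
  \<open>A \<in> cover P U\<close> says that \<open>P\<close> derives the disjunction of \<open>U\<close> from the conjunction of \<open>A\<close>.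
\<close>

definition cover :: "('g, 'i) prop_theory \<Rightarrow> 'g set set \<Rightarrow> 'g set set" where
  "cover P U = ideal_closure P (Fpow (props P) \<inter> U)"

lemma theory_ideal_cover: "theory_ideal P (cover P U)"
  unfolding cover_def by (rule theory_ideal_closure) auto

lemma cover_closed: "cover P U \<in> carrier (classifying_frame P)"
  by (simp add: classifying_frame_def theory_ideal_cover)

lemma cover_Fpow: "A \<in> cover P U \<Longrightarrow> A \<in> Fpow (props P)"
  using theory_idealD(1)[OF theory_ideal_cover] by blast

lemma cover_return: "A \<in> Fpow (props P) \<Longrightarrow> A \<in> U \<Longrightarrow> A \<in> cover P U"
  unfolding cover_def using ideal_closure_upper by blast

lemma cover_up: "A \<in> cover P U \<Longrightarrow> B \<in> Fpow (props P) \<Longrightarrow> A \<subseteq> B \<Longrightarrow> B \<in> cover P U"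
  by (rule theory_idealD(2)[OF theory_ideal_cover])

lemma cover_least: "theory_ideal P D \<Longrightarrow> Fpow (props P) \<inter> U \<subseteq> D \<Longrightarrow> cover P U \<subseteq> D"
  unfolding cover_def by (rule ideal_closure_least)

lemma cover_mono: "U \<subseteq> W \<Longrightarrow> cover P U \<subseteq> cover P W"
  unfolding cover_def by (rule ideal_closure_mono) auto

text \<open>
  The main rule for reasoning with covers: to derive \<open>W\<close> from \<open>A\<close>, it suffices to derive it
  from every extension of \<open>A\<close> that lies in a cover of \<open>A\<close>.  It combines cut with the
  distributivity of meets over joins.
\<close>

lemma cover_bind:
  assumes A: "A \<in> cover P U" and U: "\<And>C B. C \<in> U \<Longrightarrow> C \<subseteq> B \<Longrightarrow> B \<in> U"
    and step: "\<And>B. B \<in> Fpow (props P) \<Longrightarrow> A \<subseteq> B \<Longrightarrow> B \<in> U \<Longrightarrow> B \<in> cover P W"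
  shows "A \<in> cover P W"
proof -
  let ?F = "Fpow (props P)"
  have AF: "A \<in> ?F" by (rule cover_Fpow[OF A])
  have "cover P U \<inter> cover P {B. A \<subseteq> B} = ideal_closure P ((?F \<inter> U) \<inter> (?F \<inter> {B. A \<subseteq> B}))"
    unfolding cover_def by (rule ideal_closure_Int) (auto intro: U)
  moreover have "A \<in> cover P {B. A \<subseteq> B}" by (rule cover_return[OF AF]) auto
  ultimately have "A \<in> ideal_closure P ((?F \<inter> U) \<inter> (?F \<inter> {B. A \<subseteq> B}))" using A by auto
  moreover have "ideal_closure P ((?F \<inter> U) \<inter> (?F \<inter> {B. A \<subseteq> B})) \<subseteq> cover P W"
    by (rule ideal_closure_least[OF theory_ideal_cover]) (use step in auto)
  ultimately show ?thesis by auto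
qed

lemma paxiom_cover:
  assumes "(a, b) \<in> paxioms P" "A \<in> Fpow (props P)" "A \<in> pform_val a"
  shows "A \<in> cover P (pform_val b)"
  by (rule theory_idealD(3)[OF theory_ideal_cover assms(1), of "{}"])
    (use assms(2,3) cover_return in \<open>auto simp: empty_in_Fpow\<close>)

lemma cover_all:
  assumes "finite Q" "A \<in> Fpow (props P)" "\<And>q. q \<in> Q \<Longrightarrow> A \<in> cover P {B. q \<in> B}"
  shows "A \<in> cover P {B. Q \<subseteq> B}"
  using assms(1,3)
proof (induction Q rule: finite_induct)
  case empty
  then show ?case by (intro cover_return assms(2)) auto
next
  case (insert q Q)
  have IH: "A \<in> cover P {B. Q \<subseteq> B}" using insert by auto
  show ?case
  proof (rule cover_bind[OF IH])
    fix B assume B: "B \<in> Fpow (props P)" "A \<subseteq> B" "B \<in> {B. Q \<subseteq> B}"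
    have "B \<in> cover P {B. q \<in> B}" by (rule cover_up[OF insert.prems B(1,2)]) simp
    then show "B \<in> cover P {B. insert q Q \<subseteq> B}"
      by (rule cover_bind) (use B in \<open>auto intro: cover_return\<close>)
  qed auto
qed

lemma pform_val_map: "A \<in> pform_val (map_pform k a) \<longleftrightarrow> k -` A \<in> pform_val a"
  by (induction a) auto

lemma pform_over_map:
  "pform_over G a \<Longrightarrow> (\<And>g. g \<in> G \<Longrightarrow> k g \<in> H) \<Longrightarrow> pform_over H (map_pform k a)"
  by (induction a) auto

lemma frame_hom_peval:
  assumes h: "frame_hom L M h" and L: "frame L" and j: "\<And>g. g \<in> G \<Longrightarrow> j g \<in> carrier L"
    and a: "pform_over G a"
  shows "peval L j a \<in> carrier L \<and> h (peval L j a) = peval M (h \<circ> j) a"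
  using a
proof (induction a)
  interpret L: frame L by (rule L)
  note hh = frame_homD[OF h]
  case (PDisj I f)
  then have sub: "(\<lambda>i. peval L j (f i)) ` I \<subseteq> carrier L" by auto
  have "h ` (\<lambda>i. peval L j (f i)) ` I = (\<lambda>i. peval M (h \<circ> j) (f i)) ` I"
    unfolding image_image by (rule image_cong) (use PDisj in \<open>auto simp: comp_def\<close>)
  then show ?case using hh(4)[OF sub] sub by (simp add: comp_def)
next
  interpret L: frame L by (rule L)
  note hh = frame_homD[OF h]
  { case (Prop g) then show ?case using j by simp
  next case PTop then show ?case using hh(2) by simp
  next case (PConj a b) then show ?case using hh(3) by simp }
qed

lemma peval_cong:
  "pform_over G a \<Longrightarrow> (\<And>g. g \<in> G \<Longrightarrow> j g = j' g) \<Longrightarrow> peval M j a = peval M j' a"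
proof (induction a)
  case (PDisj I f)
  then have "(\<lambda>i. peval M j (f i)) ` I = (\<lambda>i. peval M j' (f i)) ` I" by (intro image_cong) auto
  then show ?case by simp
qed auto

lemma hom_cover:
  assumes h: "frame_hom (classifying_frame P) (classifying_frame Q) h"
    and k: "\<And>p. p \<in> props P \<Longrightarrow> k p \<in> props Q"
    and hk: "\<And>p. p \<in> props P \<Longrightarrow> h (generator P p) = generator Q (k p)"
    and a: "pform_over (props P) a"
  shows "h (cover P (pform_val a)) = cover Q {B. k -` B \<in> pform_val a}"
proof -
  have "cover P (pform_val a) = peval (classifying_frame P) (generator P) a"
    unfolding cover_def by (rule peval_generator[OF a, symmetric])
  then have "h (cover P (pform_val a)) = peval (classifying_frame Q) (h \<circ> generator P) a"
    using frame_hom_peval[OF h classifying_frame(1) _ a, of "generator P"] generator_closed by metis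
  also have "\<dots> = peval (classifying_frame Q) (generator Q \<circ> k) a"
    by (rule peval_cong[OF a]) (simp add: hk)
  also have "\<dots> = peval (classifying_frame Q) (generator Q) (map_pform k a)"
    by (simp add: peval_map_pform)
  also have "\<dots> = cover Q (pform_val (map_pform k a))"
    unfolding cover_def by (rule peval_generator[OF pform_over_map[OF a k]])
  also have "pform_val (map_pform k a) = {B. k -` B \<in> pform_val a}"
    using pform_val_map by blast
  finally show ?thesis .
qed

lemma pform_val_PConjs: "A \<in> pform_val (PConjs xs) \<longleftrightarrow> (\<forall>a\<in>set xs. A \<in> pform_val a)"
  by (induction xs) (auto simp: PConjs_def)

lemma frame_hom_mono:
  assumes h: "frame_hom L M h" and L: "frame L" and M: "frame M"
    and xy: "x \<in> carrier L" "y \<in> carrier L" "x \<sqsubseteq>\<^bsub>L\<^esub> y"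
  shows "h x \<sqsubseteq>\<^bsub>M\<^esub> h y"
proof -
  interpret L: frame L by (rule L)
  interpret M: frame M by (rule M)
  note hh = frame_homD[OF h]
  have "x \<sqinter>\<^bsub>L\<^esub> y = x" by (rule L.meet_eqI) (use xy in auto)
  then have "h x = h x \<sqinter>\<^bsub>M\<^esub> h y" using hh(3)[OF xy(1,2)] by simp
  then show ?thesis using M.meet_right[OF hh(1)[OF xy(1)] hh(1)[OF xy(2)]] by simp
qed

text \<open>
  A finite conjunction is itself a propositional formula, so a homomorphism given on generators
  is known on it as well; the claim then follows by monotonicity.
\<close>

lemma hom_image_mem:
  assumes h: "frame_hom (classifying_frame P) (classifying_frame Q) h"
    and k: "\<And>p. p \<in> props P \<Longrightarrow> k p \<in> props Q"
    and hk: "\<And>p. p \<in> props P \<Longrightarrow> h (generator P p) = generator Q (k p)"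
    and D: "D \<in> carrier (classifying_frame P)" and A: "A \<in> D"
  shows "k ` A \<in> h D"
proof -
  have DI: "theory_ideal P D" using D by (simp add: classifying_frame_def)
  have AF: "A \<in> Fpow (props P)" using theory_idealD(1)[OF DI] A by blast
  then obtain as where as: "set as = A" using finite_list by (auto simp: Fpow_def)
  define a :: "('a, 'b) pform" where "a = PConjs (map Prop as)"
  have a: "pform_over (props P) a"
    using AF as by (auto simp: a_def pform_over_PConjs Fpow_def)
  have val: "\<And>B. B \<in> pform_val a \<longleftrightarrow> A \<subseteq> B"
    using as by (auto simp: a_def pform_val_PConjs)
  have "cover P (pform_val a) \<subseteq> D"
    by (rule cover_least[OF DI]) (use val theory_idealD(2)[OF DI A] in auto)
  then have "cover P (pform_val a) \<sqsubseteq>\<^bsub>classifying_frame P\<^esub> D" by (simp add: classifying_frame_def)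
  from frame_hom_mono[OF h classifying_frame(1) classifying_frame(1) cover_closed D this]
  have le: "h (cover P (pform_val a)) \<subseteq> h D" by (simp add: classifying_frame_def)
  have "k ` A \<in> cover Q {B. k -` B \<in> pform_val a}"
    by (rule cover_return) (use AF k val in \<open>auto simp: Fpow_def\<close>)
  also have "\<dots> = h (cover P (pform_val a))" by (rule hom_cover[OF h k hk a, symmetric])
  finally show ?thesis using le by blast
qed

text \<open>
  The universal property of the presented frame, for homomorphisms into another presented frame
  that send generators to generators: only the derivability of the translated axioms is left.
\<close>

lemma interpretation_exists:
  assumes P: "propositional_theory P"
    and k: "\<And>p. p \<in> props P \<Longrightarrow> k p \<in> props Q"
    and sound: "\<And>a b A. (a, b) \<in> paxioms P \<Longrightarrow> A \<in> Fpow (props Q) \<Longrightarrow> k -` A \<in> pform_val a \<Longrightarrow>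
      A \<in> cover Q {B. k -` B \<in> pform_val b}"
  shows "\<exists>h. frame_hom (classifying_frame P) (classifying_frame Q) h \<and>
    (\<forall>p\<in>props P. h (generator P p) = generator Q (k p))"
proof -
  have ev: "peval (classifying_frame Q) (generator Q \<circ> k) a = cover Q {B. k -` B \<in> pform_val a}"
    if "pform_over (props P) a" for a :: "('a, 'b) pform"
  proof -
    have "{B. k -` B \<in> pform_val a} = pform_val (map_pform k a)" using pform_val_map by blast
    then show ?thesis
      using peval_generator[OF pform_over_map[OF that k]] by (simp add: peval_map_pform cover_def)
  qed
  have "\<exists>h. frame_hom (classifying_frame P) (classifying_frame Q) h \<and>
    (\<forall>p\<in>props P. h (generator P p) = (generator Q \<circ> k) p)"
  proof (rule classifying_frame_universal[OF classifying_frame(1) P])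
    show "(generator Q \<circ> k) p \<in> carrier (classifying_frame Q)" for p
      using generator_closed by simp
    fix a b assume ab: "(a, b) \<in> paxioms P"
    then have over: "pform_over (props P) a" "pform_over (props P) b"
      using P by (auto simp: propositional_theory_def)
    have "cover Q {B. k -` B \<in> pform_val a} \<subseteq> cover Q {B. k -` B \<in> pform_val b}"
      by (rule cover_least[OF theory_ideal_cover]) (use sound[OF ab] in auto)
    then show "peval (classifying_frame Q) (generator Q \<circ> k) a \<sqsubseteq>\<^bsub>classifying_frame Q\<^esub>
        peval (classifying_frame Q) (generator Q \<circ> k) b"
      unfolding ev[OF over(1)] ev[OF over(2)] by (simp add: classifying_frame_def)
  qed
  then show ?thesis by simp
qed

section \<open>Finite information about enumerated models\<close>

text \<open>
  The truth of \<open>sims Xs ns ms\<close>, stated without the type of indices of its disjunctions.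
\<close>

definition related :: "'s list \<Rightarrow> nat list \<Rightarrow> nat list \<Rightarrow> ('s, 'r) nat_prop set \<Rightarrow> bool" where
  "related Xs ns ms A \<longleftrightarrow> (\<forall>i<length Xs. Sim (Xs ! i) (ns ! i) (ms ! i) \<in> A)"

lemma sims_val: "A \<in> pform_val (sims Xs ns ms) \<longleftrightarrow> related Xs ns ms A"
  by (auto simp: sims_def pform_val_PConjs related_def)

lemma sims_val_set: "pform_val (sims Xs ns ms) = {A. related Xs ns ms A}"
  using sims_val by blast

lemma related_Cons:
  "related (X # Xs) (n # ns) (m # ms) A \<longleftrightarrow> Sim X n m \<in> A \<and> related Xs ns ms A"
  by (auto simp: related_def nth_Cons less_Suc_eq_0_disj split: nat.split)

lemma related_mono: "related Xs ns ms A \<Longrightarrow> A \<subseteq> B \<Longrightarrow> related Xs ns ms B"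
  by (auto simp: related_def)

lemma inst_Disj_val:
  "A \<in> pform_val (inst (Disj I f) ns) \<longleftrightarrow> (\<exists>i\<in>I. A \<in> pform_val (inst (f i) ns))"
  by auto

lemma inst_Exists_val:
  "A \<in> pform_val (inst (Exists X \<phi>) ns) \<longleftrightarrow>
     (\<exists>n. Sim X n n \<in> A \<and> A \<in> pform_val (inst \<phi> (n # ns)))"
  by auto

declare inst.simps(5,6) [simp del] inst_Disj_val [simp] inst_Exists_val [simp]

lemma props_Sim: "Sim X n m \<in> props (nat_theory T) \<longleftrightarrow> X \<in> sorts T"
  by (auto simp: nat_theory_def)

lemma props_Holds:
  "Holds r ns \<in> props (nat_theory T) \<longleftrightarrow> r \<in> rels T \<and> length ns = length (arity T r)"
  by (auto simp: nat_theory_def)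

lemma wf_Atom:
  "wf_form T \<Gamma> (Atom r vs) \<longleftrightarrow> r \<in> rels T \<and> length vs = length (arity T r) \<and>
     (\<forall>i<length (arity T r). vs ! i < length \<Gamma> \<and> \<Gamma> ! (vs ! i) = arity T r ! i)"
  by (auto simp: list_all2_conv_all_nth)

lemma Fpow_mem: "A \<in> Fpow S \<Longrightarrow> p \<in> A \<Longrightarrow> p \<in> S"
  by (auto simp: Fpow_def)

context
  fixes T :: "('s, 'r, 'i) geo_theory" and A :: "('s, 'r) nat_prop set"
  assumes A: "A \<in> Fpow (props (nat_theory T))"
begin

lemma sim_sym: "Sim X n m \<in> A \<Longrightarrow> A \<in> cover (nat_theory T) {B. Sim X m n \<in> B}"
  using paxiom_cover[of "Prop (Sim X n m)" "Prop (Sim X m n)" "nat_theory T" A] A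
    Fpow_mem[OF A, of "Sim X n m"]
  by (auto simp: nat_theory_def)

lemma sim_trans:
  assumes "Sim X n m \<in> A" "Sim X m l \<in> A"
  shows "A \<in> cover (nat_theory T) {B. Sim X n l \<in> B}"
  using paxiom_cover[of "PConj (Prop (Sim X n m)) (Prop (Sim X m l))" "Prop (Sim X n l)" "nat_theory T" A]
    A assms Fpow_mem[OF A assms(1)]
  by (auto simp: nat_theory_def)

lemma holds_subst:
  assumes "Holds r ns \<in> A" "length ms = length (arity T r)"
    "\<And>i. i < length (arity T r) \<Longrightarrow> Sim (arity T r ! i) (ns ! i) (ms ! i) \<in> A"
  shows "A \<in> cover (nat_theory T) {B. Holds r ms \<in> B}"
proof -
  have r: "r \<in> rels T" "length ns = length (arity T r)"
    using Fpow_mem[OF A assms(1)] by (auto simp: props_Holds)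
  have "(PConj (Prop (Holds r ns)) (sims (arity T r) ns ms), Prop (Holds r ms)) \<in> paxioms (nat_theory T)"
    unfolding nat_theory_def using r assms(2) by auto
  from paxiom_cover[OF this A] show ?thesis using assms by (auto simp: sims_val related_def)
qed

lemma holds_sim:
  assumes "Holds r ns \<in> A" "i < length (arity T r)"
  shows "A \<in> cover (nat_theory T) {B. Sim (arity T r ! i) (ns ! i) (ns ! i) \<in> B}"
proof -
  have r: "r \<in> rels T" "length ns = length (arity T r)"
    using Fpow_mem[OF A assms(1)] by (auto simp: props_Holds)
  have "(Prop (Holds r ns), sims (arity T r) ns ns) \<in> paxioms (nat_theory T)"
    unfolding nat_theory_def using r by auto
  from paxiom_cover[OF this A]
  have "A \<in> cover (nat_theory T) {B. related (arity T r) ns ns B}"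
    using assms by (simp add: sims_val_set)
  moreover have "{B. related (arity T r) ns ns B} \<subseteq>
      {B. Sim (arity T r ! i) (ns ! i) (ns ! i) \<in> (B :: ('s, 'r) nat_prop set)}"
    using assms(2) by (auto simp: related_def)
  ultimately show ?thesis using cover_mono by blast
qed

lemma geometric_axiom_cover:
  assumes "(\<Gamma>, \<phi>, \<psi>) \<in> axioms T" "length ns = length \<Gamma>"
    "related \<Gamma> ns ns A" "A \<in> pform_val (inst \<phi> ns)"
  shows "A \<in> cover (nat_theory T) (pform_val (inst \<psi> ns))"
proof -
  have "(PConj (sims \<Gamma> ns ns) (inst \<phi> ns), inst \<psi> ns) \<in> paxioms (nat_theory T)"
    unfolding nat_theory_def using assms by auto
  from paxiom_cover[OF this A] show ?thesis using assms by (simp add: sims_val)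
qed

lemma sim_self:
  assumes "Sim X n m \<in> A"
  shows "A \<in> cover (nat_theory T) {B. Sim X n n \<in> B}" "A \<in> cover (nat_theory T) {B. Sim X m m \<in> B}"
proof -
  note c = paxiom_cover[of "PConj (Prop (Sim X n m)) (Prop (Sim X m n))" "Prop (Sim X n n)" "nat_theory T"]
    paxiom_cover[of "PConj (Prop (Sim X m n)) (Prop (Sim X n m))" "Prop (Sim X m m)" "nat_theory T"]
  have X: "X \<in> sorts T" using Fpow_mem[OF A assms] by (simp add: props_Sim)
  show "A \<in> cover (nat_theory T) {B. Sim X n n \<in> B}"
    by (rule cover_bind[OF sim_sym[OF assms]]) (use X assms c in \<open>auto simp: nat_theory_def\<close>)
  show "A \<in> cover (nat_theory T) {B. Sim X m m \<in> B}"
    by (rule cover_bind[OF sim_sym[OF assms]]) (use X assms c in \<open>auto simp: nat_theory_def\<close>)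
qed

end

section \<open>Transport of formulae along a total relation\<close>

text \<open>
  The maps \<open>k\<close> and \<open>k'\<close> interpret the basic propositions over \<open>T\<close> as basic propositions of \<open>P\<close>,
  and so describe two structures on subquotients of the natural numbers; \<open>a X\<close> is a relation
  between their carriers at sort \<open>X\<close>.  If it is total and preserves equality and the relation
  symbols, then it preserves all geometric formulae: totality provides the witnesses for
  existential quantifiers.  Taking equality for \<open>a\<close> gives the substitution of equals, and taking
  \<open>\<alpha>\<close> or its converse gives invariance under isomorphism.
\<close>

lemma inst_transfer:
  fixes T :: "('s, 'r, 'i) geo_theory" and P :: "('g, 'j) prop_theory"
    and k k' :: "('s, 'r) nat_prop \<Rightarrow> 'g" and a :: "'s \<Rightarrow> nat \<Rightarrow> nat \<Rightarrow> 'g"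
  assumes eq: "\<And>A X n n' m m'. A \<in> Fpow (props P) \<Longrightarrow> X \<in> sorts T \<Longrightarrow>
      a X n m \<in> A \<Longrightarrow> a X n' m' \<in> A \<Longrightarrow> k (Sim X n n') \<in> A \<Longrightarrow> A \<in> cover P {B. k' (Sim X m m') \<in> B}"
    and rel: "\<And>A r ns ms. A \<in> Fpow (props P) \<Longrightarrow> r \<in> rels T \<Longrightarrow>
      length ns = length (arity T r) \<Longrightarrow> length ms = length (arity T r) \<Longrightarrow>
      (\<And>i. i < length (arity T r) \<Longrightarrow> a (arity T r ! i) (ns ! i) (ms ! i) \<in> A) \<Longrightarrow>
      k (Holds r ns) \<in> A \<Longrightarrow> A \<in> cover P {B. k' (Holds r ms) \<in> B}"
    and total: "\<And>A X n. A \<in> Fpow (props P) \<Longrightarrow> X \<in> sorts T \<Longrightarrow> k (Sim X n n) \<in> A \<Longrightarrow>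
      A \<in> cover P {B. \<exists>m. a X n m \<in> B \<and> k' (Sim X m m) \<in> B}"
  shows "wf_form T \<Gamma> \<phi> \<Longrightarrow> set \<Gamma> \<subseteq> sorts T \<Longrightarrow> length ns = length \<Gamma> \<Longrightarrow> length ms = length \<Gamma> \<Longrightarrow>
    (\<And>i. i < length \<Gamma> \<Longrightarrow> a (\<Gamma> ! i) (ns ! i) (ms ! i) \<in> A) \<Longrightarrow> A \<in> Fpow (props P) \<Longrightarrow>
    k -` A \<in> pform_val (inst \<phi> ns) \<Longrightarrow> A \<in> cover P {B. k' -` B \<in> pform_val (inst \<phi> ms)}"
proof (induction \<phi> arbitrary: \<Gamma> ns ms A)
  case (Atom r vs)
  note wf = Atom.prems(1)[unfolded wf_Atom]
  have "A \<in> cover P {B. k' (Holds r (map ((!) ms) vs)) \<in> B}"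
  proof (rule rel[of _ _ "map ((!) ns) vs"])
    fix i assume i: "i < length (arity T r)"
    then show "a (arity T r ! i) (map ((!) ns) vs ! i) (map ((!) ms) vs ! i) \<in> A"
      using wf Atom.prems(5)[of "vs ! i"] by auto
  qed (use wf Atom.prems in auto)
  then show ?case by simp
next
  case (Equal X v w)
  have "A \<in> cover P {B. k' (Sim X (ms ! v) (ms ! w)) \<in> B}"
    by (rule eq[of _ _ "ns ! v" _ "ns ! w"])
      (use Equal.prems Equal.prems(5)[of v] Equal.prems(5)[of w] in auto)
  then show ?case by simp
next
  case TT
  then show ?case by (auto intro: cover_return)
next
  case (Conj \<phi> \<psi>)
  have 1: "A \<in> cover P {B. k' -` B \<in> pform_val (inst \<phi> ms)}"
    by (rule Conj.IH(1)[of \<Gamma> ns]) (use Conj.prems in auto)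
  show ?case
  proof (rule cover_bind[OF 1])
    fix B assume B: "B \<in> Fpow (props P)" "A \<subseteq> B" "B \<in> {B. k' -` B \<in> pform_val (inst \<phi> ms)}"
    have "k -` B \<in> pform_val (inst \<psi> ns)"
      by (rule pform_val_mono[of "k -` A"]) (use Conj.prems B in auto)
    then have 2: "B \<in> cover P {B. k' -` B \<in> pform_val (inst \<psi> ms)}"
      by (intro Conj.IH(2)[of \<Gamma> ns]) (use Conj.prems B in auto)
    show "B \<in> cover P {B. k' -` B \<in> pform_val (inst (Conj \<phi> \<psi>) ms)}"
    proof (rule cover_bind[OF 2])
      fix C assume C: "C \<in> Fpow (props P)" "B \<subseteq> C" "C \<in> {B. k' -` B \<in> pform_val (inst \<psi> ms)}"
      have "k' -` C \<in> pform_val (inst \<phi> ms)"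
        by (rule pform_val_mono[of "k' -` B"]) (use C B in auto)
      then show "C \<in> cover P {B. k' -` B \<in> pform_val (inst (Conj \<phi> \<psi>) ms)}"
        by (intro cover_return) (use C in auto)
    next
      fix C B assume "C \<in> {B. k' -` B \<in> pform_val (inst \<psi> ms)}" "C \<subseteq> B"
      then show "B \<in> {B. k' -` B \<in> pform_val (inst \<psi> ms)}"
        using pform_val_mono[OF _ vimage_mono] by blast
    qed
  next
    fix C B assume "C \<in> {B. k' -` B \<in> pform_val (inst \<phi> ms)}" "C \<subseteq> B"
    then show "B \<in> {B. k' -` B \<in> pform_val (inst \<phi> ms)}"
      using pform_val_mono[OF _ vimage_mono] by blast
  qed
next
  case (Disj I f)
  then obtain i where i: "i \<in> I" "k -` A \<in> pform_val (inst (f i) ns)" by auto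
  have "A \<in> cover P {B. k' -` B \<in> pform_val (inst (f i) ms)}"
    by (rule Disj.IH[of _ \<Gamma> ns]) (use Disj.prems i in auto)
  moreover have "{B. k' -` B \<in> pform_val (inst (f i) ms)} \<subseteq> {B. k' -` B \<in> pform_val (inst (Disj I f) ms)}"
    using i by auto
  ultimately show ?case using cover_mono by blast
next
  case (Exists X \<phi>)
  then obtain n where n: "k (Sim X n n) \<in> A" "k -` A \<in> pform_val (inst \<phi> (n # ns))" by auto
  have X: "X \<in> sorts T" using Exists.prems by simp
  show ?case
  proof (rule cover_bind[OF total[OF Exists.prems(6) X n(1)]])
    fix B assume B: "B \<in> Fpow (props P)" "A \<subseteq> B" "B \<in> {B. \<exists>m. a X n m \<in> B \<and> k' (Sim X m m) \<in> B}"
    then obtain m where m: "a X n m \<in> B" "k' (Sim X m m) \<in> B" by auto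
    have "k -` B \<in> pform_val (inst \<phi> (n # ns))"
      by (rule pform_val_mono[of "k -` A"]) (use n B in auto)
    then have 1: "B \<in> cover P {B. k' -` B \<in> pform_val (inst \<phi> (m # ms))}"
      by (intro Exists.IH[of "X # \<Gamma>" "n # ns"])
        (use Exists.prems B m Exists.prems(5) in \<open>auto simp: nth_Cons split: nat.split\<close>)
    show "B \<in> cover P {B. k' -` B \<in> pform_val (inst (Exists X \<phi>) ms)}"
    proof (rule cover_bind[OF 1])
      fix C assume "C \<in> Fpow (props P)" "B \<subseteq> C" "C \<in> {B. k' -` B \<in> pform_val (inst \<phi> (m # ms))}"
      then show "C \<in> cover P {B. k' -` B \<in> pform_val (inst (Exists X \<phi>) ms)}"
        by (intro cover_return) (use m in auto)
    next
      fix C B assume "C \<in> {B. k' -` B \<in> pform_val (inst \<phi> (m # ms))}" "C \<subseteq> B"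
      then show "B \<in> {B. k' -` B \<in> pform_val (inst \<phi> (m # ms))}"
        using pform_val_mono[OF _ vimage_mono] by blast
    qed
  qed auto
qed

section \<open>Soundness of geometric logic in the frame of enumerated models\<close>

text \<open>
  The formulae \<open>f i\<close> with \<open>i \<notin> I\<close> in a disjunction \<open>Disj I f\<close> are arbitrary and need not be
  well-formed, so the two instances are not equal as propositional formulae; they have the same
  truth value.
\<close>

lemma inst_rename_val:
  "wf_form T \<Gamma> \<phi> \<Longrightarrow> (\<And>v. v < length \<Gamma> \<Longrightarrow> ns ! v = ms ! \<rho> v) \<Longrightarrow>
     A \<in> pform_val (inst (rename \<rho> \<phi>) ms) \<longleftrightarrow> A \<in> pform_val (inst \<phi> ns)"
proof (induction \<phi> arbitrary: \<Gamma> \<rho> ns ms)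
  case (Atom r vs)
  have "map ((!) ms \<circ> \<rho>) vs = map ((!) ns) vs"
    unfolding list_eq_iff_nth_eq using Atom[unfolded wf_Atom] by auto
  then show ?case by (simp only: rename.simps inst.simps map_map)
next
  case (Conj \<phi> \<psi>)
  from Conj.IH(1)[of \<Gamma> ns ms \<rho>] Conj.IH(2)[of \<Gamma> ns ms \<rho>] Conj.prems show ?case by simp
next
  case (Disj I f)
  have "A \<in> pform_val (inst (rename \<rho> (f i)) ms) \<longleftrightarrow> A \<in> pform_val (inst (f i) ns)" if "i \<in> I" for i
    using Disj.IH[of "f i" \<Gamma> ns ms \<rho>] Disj.prems that by auto
  then show ?case by auto
next
  case (Exists X \<phi>)
  have "A \<in> pform_val (inst (rename (lift_ren \<rho>) \<phi>) (n # ms)) \<longleftrightarrow> A \<in> pform_val (inst \<phi> (n # ns))" for n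
  proof (rule Exists.IH[of "X # \<Gamma>"])
    show "(n # ns) ! v = (n # ms) ! lift_ren \<rho> v" if "v < length (X # \<Gamma>)" for v
      using that Exists.prems(2) by (cases v) auto
  qed (use Exists.prems in auto)
  then show ?case by simp
qed auto

lemma inst_sim_cover:
  fixes T :: "('s, 'r, 'i) geo_theory"
  assumes "wf_form T \<Gamma> \<phi>" "set \<Gamma> \<subseteq> sorts T" "length ns = length \<Gamma>" "length ms = length \<Gamma>"
    "A \<in> Fpow (props (nat_theory T))" "related \<Gamma> ns ms A" "A \<in> pform_val (inst \<phi> ns)"
  shows "A \<in> cover (nat_theory T) (pform_val (inst \<phi> ms))"
proof -
  let ?P = "nat_theory T"
  have "A \<in> cover ?P {B. id -` B \<in> pform_val (inst \<phi> ms)}"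
  proof (rule inst_transfer[where T = T and k = id and a = Sim and \<Gamma> = \<Gamma> and ns = ns])
    fix A X n n' m m'
    assume A: "A \<in> Fpow (props ?P)" "Sim X n m \<in> A" "Sim X n' m' \<in> A" "id (Sim X n n') \<in> A"
    show "A \<in> cover ?P {B. id (Sim X m m') \<in> B}"
    proof (rule cover_bind[OF sim_sym[OF A(1,2)]])
      fix B assume B: "B \<in> Fpow (props ?P)" "A \<subseteq> B" "B \<in> {B. Sim X m n \<in> B}"
      have "B \<in> cover ?P {B. Sim X m n' \<in> B}" by (rule sim_trans[of _ _ _ _ n]) (use A B in auto)
      then show "B \<in> cover ?P {B. id (Sim X m m') \<in> B}"
      proof (rule cover_bind)
        fix C assume C: "C \<in> Fpow (props ?P)" "B \<subseteq> C" "C \<in> {B. Sim X m n' \<in> B}"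
        have "C \<in> cover ?P {B. Sim X m m' \<in> B}" by (rule sim_trans[of _ _ _ _ n']) (use A B C in auto)
        then show "C \<in> cover ?P {B. id (Sim X m m') \<in> B}" by simp
      qed auto
    qed auto
  next
    fix A r ns ms
    assume "A \<in> Fpow (props ?P)" "length ms = length (arity T r)"
      "\<And>i. i < length (arity T r) \<Longrightarrow> Sim (arity T r ! i) (ns ! i) (ms ! i) \<in> A" "id (Holds r ns) \<in> A"
    then have "A \<in> cover ?P {B. Holds r ms \<in> B}" by (intro holds_subst[of _ _ _ ns]) auto
    then show "A \<in> cover ?P {B. id (Holds r ms) \<in> B}" by simp
  next
    fix A X n assume "A \<in> Fpow (props ?P)" "id (Sim X n n) \<in> A"
    then show "A \<in> cover ?P {B. \<exists>m. Sim X n m \<in> B \<and> id (Sim X m m) \<in> B}"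
      by (intro cover_return) auto
  qed (use assms in \<open>auto simp: related_def\<close>)
  then show ?thesis by simp
qed

theorem soundness:
  fixes T :: "('s, 'r, 'i) geo_theory"
  assumes T: "geometric_theory T" and "proves T \<Gamma> \<phi> \<psi>"
  shows "length ns = length \<Gamma> \<Longrightarrow> A \<in> Fpow (props (nat_theory T)) \<Longrightarrow>
    related \<Gamma> ns ns A \<Longrightarrow> A \<in> pform_val (inst \<phi> ns) \<Longrightarrow>
    A \<in> cover (nat_theory T) (pform_val (inst \<psi> ns))"
  using assms(2)
proof (induction arbitrary: ns A)
  case (axiom \<Gamma> \<phi> \<psi>)
  then show ?case by (intro geometric_axiom_cover) auto
next
  case (cut \<Gamma> \<phi> \<psi> \<chi>)
  have "A \<in> cover (nat_theory T) (pform_val (inst \<psi> ns))" by (rule cut.IH(1)) (use cut.prems in auto)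
  then show ?case
    by (rule cover_bind) (use cut.prems cut.IH(2) pform_val_mono related_mono in blast)+
next
  case (substitution \<Gamma> \<phi> \<psi> \<Delta> \<rho>)
  have wf: "wf_form T \<Gamma> \<phi>" "wf_form T \<Gamma> \<psi>"
    using proves_in_context[OF T substitution.hyps(1)] by (auto simp: form_in_context_def)
  let ?ns = "map (\<lambda>v. ns ! \<rho> v) [0..<length \<Gamma>]"
  have ns: "\<And>v. v < length \<Gamma> \<Longrightarrow> ?ns ! v = ns ! \<rho> v" by simp
  have \<rho>: "\<And>v. v < length \<Gamma> \<Longrightarrow> \<rho> v < length \<Delta> \<and> \<Delta> ! \<rho> v = \<Gamma> ! v"
    using substitution.hyps by (auto simp: renaming_def)
  have "Sim (\<Gamma> ! v) (ns ! \<rho> v) (ns ! \<rho> v) \<in> A" if "v < length \<Gamma>" for v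
    using substitution.prems(3) \<rho>[OF that] by (metis related_def)
  then have "related \<Gamma> ?ns ?ns A" by (auto simp: related_def)
  moreover have "A \<in> pform_val (inst \<phi> ?ns)"
    using substitution.prems(4) inst_rename_val[OF wf(1) ns] by simp
  ultimately have "A \<in> cover (nat_theory T) (pform_val (inst \<psi> ?ns))"
    using substitution.IH[of ?ns A] substitution.prems by simp
  moreover have "pform_val (inst \<psi> ?ns) = pform_val (inst (rename \<rho> \<psi>) ns)"
    using inst_rename_val[OF wf(2) ns] by blast
  ultimately show ?case by simp
next
  case (equal_refl \<Gamma> X v)
  then show ?case by (intro cover_return) (auto simp: form_in_context_def related_def)
next
  case (equal_subst \<Gamma> X v w \<phi>)
  have wf: "v < length \<Gamma>" "w < length \<Gamma>" "\<Gamma> ! v = X" "wf_form T (X # \<Gamma>) \<phi>" "set (X # \<Gamma>) \<subseteq> sorts T"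
    using equal_subst.hyps by (auto simp: form_in_context_def)
  have r: "B \<in> pform_val (inst (rename (case_nat u id) \<phi>) ns) \<longleftrightarrow> B \<in> pform_val (inst \<phi> (ns ! u # ns))"
    for u B by (rule inst_rename_val[OF wf(4)]) (auto simp: nth_Cons split: nat.split)
  have "A \<in> cover (nat_theory T) (pform_val (inst \<phi> (ns ! w # ns)))"
    by (rule inst_sim_cover[OF wf(4,5), of "ns ! v # ns"])
      (use equal_subst.prems r[of A v] in \<open>auto simp: related_Cons\<close>)
  moreover have "pform_val (inst \<phi> (ns ! w # ns)) = pform_val (inst (rename (case_nat w id) \<phi>) ns)"
    using r by blast
  ultimately show ?case by simp
next
  case (conj_right \<Gamma> \<phi> \<psi> \<chi>)
  have "A \<in> cover (nat_theory T) (pform_val (inst \<psi> ns))"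
    by (rule conj_right.IH(1)) (use conj_right.prems in auto)
  then show ?case
  proof (rule cover_bind)
    fix B assume B: "B \<in> Fpow (props (nat_theory T))" "A \<subseteq> B" "B \<in> pform_val (inst \<psi> ns)"
    have "B \<in> cover (nat_theory T) (pform_val (inst \<chi> ns))"
      by (rule conj_right.IH(2)) (use conj_right.prems B pform_val_mono related_mono in blast)+
    then show "B \<in> cover (nat_theory T) (pform_val (inst (Conj \<psi> \<chi>) ns))"
    proof (rule cover_bind)
      fix C assume "C \<in> Fpow (props (nat_theory T))" "B \<subseteq> C" "C \<in> pform_val (inst \<chi> ns)"
      then show "C \<in> cover (nat_theory T) (pform_val (inst (Conj \<psi> \<chi>) ns))"
        using pform_val_mono[OF B(3)] by (intro cover_return) auto
    qed (auto intro: pform_val_mono)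
  qed (auto intro: pform_val_mono)
next
  case (disj_right \<Gamma> I f i)
  then show ?case by (intro cover_return) auto
next
  case (disj_left \<Gamma> \<psi> I f)
  then obtain i where "i \<in> I" "A \<in> pform_val (inst (f i) ns)" by auto
  then show ?case using disj_left.IH disj_left.prems by auto
next
  case (exists_left \<Gamma> \<psi> X \<phi>)
  then obtain n where n: "Sim X n n \<in> A" "A \<in> pform_val (inst \<phi> (n # ns))" by auto
  have "A \<in> cover (nat_theory T) (pform_val (inst (rename Suc \<psi>) (n # ns)))"
    by (rule exists_left.IH) (use exists_left.prems n in \<open>auto simp: related_Cons\<close>)
  moreover have "pform_val (inst (rename Suc \<psi>) (n # ns)) = pform_val (inst \<psi> ns)"
    using inst_rename_val[of T \<Gamma> \<psi> ns "n # ns" Suc] exists_left.hyps by (auto simp: form_in_context_def)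
  ultimately show ?case by simp
next
  case (exists_left_inverse \<Gamma> X \<phi> \<psi>)
  have wf: "wf_form T \<Gamma> \<psi>"
    using proves_in_context[OF T exists_left_inverse.hyps] by (auto simp: form_in_context_def)
  obtain n ms where ns: "ns = n # ms" "length ms = length \<Gamma>"
    using exists_left_inverse.prems(1) by (cases ns) auto
  have "A \<in> cover (nat_theory T) (pform_val (inst \<psi> ms))"
    by (rule exists_left_inverse.IH) (use exists_left_inverse.prems ns in \<open>auto simp: related_Cons\<close>)
  moreover have "pform_val (inst (rename Suc \<psi>) ns) = pform_val (inst \<psi> ms)"
    using inst_rename_val[OF wf, of ms ns Suc] ns by auto
  ultimately show ?case by simp
next
  case (distributivity \<Gamma> \<phi> I f)
  then show ?case by (intro cover_return) auto
next
  case (frobenius \<Gamma> \<phi> X \<psi>)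
  then obtain n where n: "Sim X n n \<in> A" "A \<in> pform_val (inst \<psi> (n # ns))" "A \<in> pform_val (inst \<phi> ns)"
    by auto
  have "A \<in> pform_val (inst (rename Suc \<phi>) (n # ns))"
    using inst_rename_val[of T \<Gamma> \<phi> ns "n # ns" Suc] frobenius.hyps n by (auto simp: form_in_context_def)
  then show ?case using n frobenius.prems by (intro cover_return) auto
qed (auto intro: cover_return)

section \<open>Derived rules of geometric logic\<close>

lemma lift_ren_id: "lift_ren id = id"
proof
  fix v show "lift_ren id v = id v" by (cases v) auto
qed

lemma rename_id: "rename id \<phi> = \<phi>"
proof (induction \<phi>)
  case (Exists X \<phi>)
  then show ?case by (simp only: rename.simps lift_ren_id)
qed auto

lemma lift_ren_comp: "lift_ren \<rho> \<circ> lift_ren \<sigma> = lift_ren (\<rho> \<circ> \<sigma>)"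
proof
  fix v show "(lift_ren \<rho> \<circ> lift_ren \<sigma>) v = lift_ren (\<rho> \<circ> \<sigma>) v" by (cases v) auto
qed

lemma rename_comp: "rename \<rho> (rename \<sigma> \<phi>) = rename (\<rho> \<circ> \<sigma>) \<phi>"
  by (induction \<phi> arbitrary: \<rho> \<sigma>) (auto simp: lift_ren_comp)

lemma renaming_comp: "renaming \<Gamma> \<Delta> \<rho> \<Longrightarrow> renaming \<Delta> \<Delta>' \<kappa> \<Longrightarrow> renaming \<Gamma> \<Delta>' (\<kappa> \<circ> \<rho>)"
  by (auto simp: renaming_def)

lemma renaming_id: "renaming \<Gamma> \<Gamma> id"
  by (simp add: renaming_def)

lemma form_in_context_rename:
  "form_in_context T \<Gamma> \<phi> \<Longrightarrow> renaming \<Gamma> \<Delta> \<rho> \<Longrightarrow> set \<Delta> \<subseteq> sorts T \<Longrightarrow> form_in_context T \<Delta> (rename \<rho> \<phi>)"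
  by (auto simp: form_in_context_def intro: wf_rename)

context
  fixes T :: "('s, 'r, 'i) geo_theory"
  assumes T: "geometric_theory T"
begin

lemma conj_proj1: "proves T \<Gamma> \<theta> (Conj \<phi> \<psi>) \<Longrightarrow> proves T \<Gamma> \<theta> \<phi>"
  using proves_in_context[OF T] by (blast intro: proves.intros)

lemma conj_proj2: "proves T \<Gamma> \<theta> (Conj \<phi> \<psi>) \<Longrightarrow> proves T \<Gamma> \<theta> \<psi>"
  using proves_in_context[OF T] by (blast intro: proves.intros)

lemma exists_right:
  assumes ctx: "form_in_context T \<Delta> (Exists X \<chi>)" and v: "v < length \<Delta>" "\<Delta> ! v = X"
    and p: "proves T \<Delta> \<theta> (rename (case_nat v id) \<chi>)"
  shows "proves T \<Delta> \<theta> (Exists X \<chi>)"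
proof (rule proves.cut[OF p])
  have "proves T (X # \<Delta>) \<chi> (rename Suc (Exists X \<chi>))"
    by (rule proves.exists_left_inverse[OF proves.identity[OF ctx]])
  then have "proves T \<Delta> (rename (case_nat v id) \<chi>) (rename (case_nat v id) (rename Suc (Exists X \<chi>)))"
    by (rule proves.substitution) (use ctx renaming_subst[OF v] in \<open>auto simp: form_in_context_def\<close>)
  moreover have "case_nat v id \<circ> Suc = id" by auto
  ultimately show "proves T \<Delta> (rename (case_nat v id) \<chi>) (Exists X \<chi>)"
    by (simp only: rename_comp rename_id)
qed

lemma proves_weaken:
  assumes "proves T \<Gamma> \<phi> \<psi>" "renaming \<Gamma> \<Delta> \<kappa>" "proves T \<Delta> \<theta> (rename \<kappa> \<phi>)"
  shows "proves T \<Delta> \<theta> (rename \<kappa> \<psi>)"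
proof (rule proves.cut[OF assms(3)])
  have "set \<Delta> \<subseteq> sorts T" using proves_in_context[OF T assms(3)] by (simp add: form_in_context_def)
  then show "proves T \<Delta> (rename \<kappa> \<phi>) (rename \<kappa> \<psi>)"
    using proves.substitution[OF assms(1) _ assms(2)] by blast
qed

lemma exists_elim:
  assumes p: "proves T \<Delta> \<theta> (Exists X \<chi>)" and \<psi>: "form_in_context T \<Delta> \<psi>"
    and q: "proves T (X # \<Delta>) (Conj (rename Suc \<theta>) \<chi>) (rename Suc \<psi>)"
  shows "proves T \<Delta> \<theta> \<psi>"
proof -
  have \<theta>: "form_in_context T \<Delta> \<theta>" and e: "form_in_context T \<Delta> (Exists X \<chi>)" using proves_in_context[OF T p] by auto
  have X: "X \<in> sorts T" using e by (simp add: form_in_context_def)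
  have "proves T \<Delta> \<theta> (Conj \<theta> (Exists X \<chi>))"
    by (rule proves.conj_right[OF proves.identity[OF \<theta>] p])
  then have "proves T \<Delta> \<theta> (Exists X (Conj (rename Suc \<theta>) \<chi>))"
    by (rule proves.cut[OF _ proves.frobenius[OF \<theta> e]])
  then show ?thesis by (rule proves.cut[OF _ proves.exists_left[OF \<psi> X q]])
qed

lemma disj_elim:
  assumes p: "proves T \<Delta> \<theta> (Disj I f)" and \<psi>: "form_in_context T \<Delta> \<psi>"
    and q: "\<And>i. i \<in> I \<Longrightarrow> proves T \<Delta> (Conj \<theta> (f i)) \<psi>"
  shows "proves T \<Delta> \<theta> \<psi>"
proof -
  have \<theta>: "form_in_context T \<Delta> \<theta>" and e: "form_in_context T \<Delta> (Disj I f)" using proves_in_context[OF T p] by auto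
  have "proves T \<Delta> \<theta> (Conj \<theta> (Disj I f))"
    by (rule proves.conj_right[OF proves.identity[OF \<theta>] p])
  then have "proves T \<Delta> \<theta> (Disj I (\<lambda>i. Conj \<theta> (f i)))"
    by (rule proves.cut[OF _ proves.distributivity[OF \<theta> e]])
  then show ?thesis by (rule proves.cut[OF _ proves.disj_left[OF \<psi> q]])
qed

lemma equal_rewrite:
  assumes eq: "proves T \<Delta> \<theta> (Equal X v w)" and \<phi>: "form_in_context T (X # \<Delta>) \<phi>"
    and p: "proves T \<Delta> \<theta> (rename (case_nat v id) \<phi>)"
  shows "proves T \<Delta> \<theta> (rename (case_nat w id) \<phi>)"
  by (rule proves.cut[OF proves.conj_right[OF eq p] proves.equal_subst])
    (use proves_in_context[OF T eq] \<phi> in auto)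

lemma equal_sym:
  assumes eq: "proves T \<Delta> \<theta> (Equal X v w)"
  shows "proves T \<Delta> \<theta> (Equal X w v)"
proof -
  have c: "form_in_context T \<Delta> (Equal X v w)" "form_in_context T \<Delta> \<theta>" using proves_in_context[OF T eq] by auto
  then have X: "X \<in> sorts T" by (auto simp: form_in_context_def)
  have "proves T \<Delta> \<theta> (Equal X v v)"
    by (rule proves.cut[OF proves.top[OF c(2)] proves.equal_refl])
      (use c in \<open>auto simp: form_in_context_def\<close>)
  then show ?thesis
    using equal_rewrite[OF eq, of "Equal X 0 (Suc v)"] c X by (auto simp: form_in_context_def)
qed

lemma equal_trans:
  assumes eq: "proves T \<Delta> \<theta> (Equal X u v)" "proves T \<Delta> \<theta> (Equal X v w)"
  shows "proves T \<Delta> \<theta> (Equal X u w)"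
proof -
  have c: "form_in_context T \<Delta> (Equal X u v)" using proves_in_context[OF T eq(1)] by auto
  then have X: "X \<in> sorts T" by (auto simp: form_in_context_def)
  show ?thesis
    using equal_rewrite[OF eq(2), of "Equal X (Suc u) 0"] eq(1) c X by (auto simp: form_in_context_def)
qed

lemma equal_self:
  assumes eq: "form_in_context T \<Delta> \<theta>" "v < length \<Delta>"
  shows "proves T \<Delta> \<theta> (Equal (\<Delta> ! v) v v)"
  by (rule proves.cut[OF proves.top[OF eq(1)] proves.equal_refl])
    (use eq in \<open>auto simp: form_in_context_def\<close>)

text \<open>
  The rule for equality replaces one variable at a time, so the arguments are replaced from left
  to right; after \<open>j\<close> steps the first \<open>j\<close> of them have been replaced.
\<close>

lemma atom_rewrite:
  assumes p: "proves T \<Delta> \<theta> (Atom r us)" and l: "length ws = length (arity T r)"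
    and eq: "\<And>i. i < length (arity T r) \<Longrightarrow> proves T \<Delta> \<theta> (Equal (arity T r ! i) (us ! i) (ws ! i))"
  shows "proves T \<Delta> \<theta> (Atom r ws)"
proof -
  have wf: "wf_form T \<Delta> (Atom r us)" and \<Delta>: "set \<Delta> \<subseteq> sorts T"
    using proves_in_context[OF T p] by (auto simp: form_in_context_def)
  have lu: "length us = length (arity T r)" using wf[unfolded wf_Atom] by auto
  have "proves T \<Delta> \<theta> (Atom r (take j ws @ drop j us))" if "j \<le> length (arity T r)" for j
    using that
  proof (induction j)
    case 0
    then show ?case using p by simp
  next
    case (Suc j)
    let ?X = "arity T r ! j" and ?vs = "map Suc (take j ws) @ 0 # map Suc (drop (Suc j) us)"
    have IH: "proves T \<Delta> \<theta> (Atom r (take j ws @ drop j us))" using Suc by simp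
    have dj: "drop j us = us ! j # drop (Suc j) us" using Suc.prems lu by (intro Cons_nth_drop_Suc[symmetric]) simp
    have tj: "take (Suc j) ws = take j ws @ [ws ! j]" using Suc.prems l by (intro take_Suc_conv_app_nth) simp
    have e: "proves T \<Delta> \<theta> (Equal ?X (us ! j) (ws ! j))" using eq Suc.prems by simp
    have w: "wf_form T \<Delta> (Atom r (take j ws @ drop j us))" "wf_form T \<Delta> (Equal ?X (us ! j) (ws ! j))"
      using proves_in_context[OF T IH] proves_in_context[OF T e] by (auto simp: form_in_context_def)
    have X: "?X \<in> sorts T" using w(2) \<Delta> nth_mem[of "us ! j" \<Delta>] by auto
    have "wf_form T (?X # \<Delta>) (Atom r ?vs)"
      unfolding wf_Atom
    proof (intro conjI allI impI)
      fix i assume i: "i < length (arity T r)"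
      have wi: "(take j ws @ drop j us) ! i < length \<Delta>" "\<Delta> ! ((take j ws @ drop j us) ! i) = arity T r ! i"
        using w(1)[unfolded wf_Atom] i by auto
      consider "i < j" | "i = j" | "i > j" by linarith
      then have "?vs ! i = (if i = j then 0 else Suc ((take j ws @ drop j us) ! i))"
        by cases (use i Suc.prems lu l in \<open>auto simp: nth_append nth_Cons' Suc_diff_Suc\<close>)
      then show "?vs ! i < length (?X # \<Delta>)" "(?X # \<Delta>) ! (?vs ! i) = arity T r ! i"
        using wi by auto
    qed (use w(1)[unfolded wf_Atom] Suc.prems lu l in auto)
    then have "form_in_context T (?X # \<Delta>) (Atom r ?vs)" using X \<Delta> by (simp add: form_in_context_def)
    from equal_rewrite[OF e this] IH show ?case by (simp add: dj tj o_def)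
  qed
  from this[of "length (arity T r)"] show ?thesis using l lu by simp
qed

end

section \<open>Conservativity\<close>

text \<open>
  The numbers that a basic proposition mentions, each with the sort at which it is used: the
  same number denotes unrelated elements of different sorts.
\<close>

primrec names :: "('s, 'r, 'i) geo_theory \<Rightarrow> ('s, 'r) nat_prop \<Rightarrow> ('s \<times> nat) set" where
  "names T (Sim X n m) = {(X, n), (X, m)}"
| "names T (Holds r ns) = set (zip (arity T r) ns)"

primrec atom ::
  "('s, 'r, 'i) geo_theory \<Rightarrow> ('s \<times> nat \<Rightarrow> nat) \<Rightarrow> ('s, 'r) nat_prop \<Rightarrow> ('s, 'r, 'i) form" where
  "atom T e (Sim X n m) = Equal X (e (X, n)) (e (X, m))"
| "atom T e (Holds r ns) = Atom r (map e (zip (arity T r) ns))"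

text \<open>
  A formula \<open>\<theta>\<close> in context \<open>\<Delta>\<close> acts as a generic enumerated model in which the number \<open>n\<close>
  denotes the variable \<open>e (X, n)\<close> at sort \<open>X\<close>.
\<close>

definition forces ::
  "('s, 'r, 'i) geo_theory \<Rightarrow> 's list \<Rightarrow> ('s, 'r, 'i) form \<Rightarrow> ('s \<times> nat \<Rightarrow> nat) \<Rightarrow>
     ('s, 'r) nat_prop set \<Rightarrow> bool" where
  "forces T \<Delta> \<theta> e A \<longleftrightarrow> (\<forall>p\<in>A. proves T \<Delta> \<theta> (atom T e p))"

text \<open>
  Used for sentences \<open>\<psi>\<close> only.  A renaming may change a sentence in the members of its
  disjunctions outside the index set, hence the quantification over \<open>\<rho>\<close>: it makes weakening of
  \<open>\<psi>\<close> a syntactic identity.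
\<close>

definition consequence ::
  "('s, 'r, 'i) geo_theory \<Rightarrow> ('s, 'r, 'i) form \<Rightarrow> ('s, 'r) nat_prop set set" where
  "consequence T \<psi> = {A \<in> Fpow (props (nat_theory T)). \<forall>\<Delta> \<theta> e \<rho>.
     form_in_context T \<Delta> \<theta> \<longrightarrow> forces T \<Delta> \<theta> e A \<longrightarrow> proves T \<Delta> \<theta> (rename \<rho> \<psi>)}"

lemma finite_names: "finite (names T p)"
  by (cases p) auto

lemma rename_atom: "rename \<kappa> (atom T e p) = atom T (\<kappa> \<circ> e) p"
  by (cases p) auto

lemma atom_cong: "(\<And>s. s \<in> names T p \<Longrightarrow> e s = e' s) \<Longrightarrow> atom T e p = atom T e' p"
  by (cases p) auto

context
  fixes T :: "('s, 'r, 'i) geo_theory"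
  assumes T: "geometric_theory T"
begin

lemma forces_mono: "forces T \<Delta> \<theta> e B \<Longrightarrow> A \<subseteq> B \<Longrightarrow> forces T \<Delta> \<theta> e A"
  by (auto simp: forces_def)

lemma forces_weaken:
  assumes f: "forces T \<Delta> \<theta> e A" and \<kappa>: "renaming \<Delta> \<Delta>' \<kappa>" and \<theta>: "proves T \<Delta>' \<theta>' (rename \<kappa> \<theta>)"
    and e: "\<And>p s. p \<in> A \<Longrightarrow> s \<in> names T p \<Longrightarrow> e' s = \<kappa> (e s)"
  shows "forces T \<Delta>' \<theta>' e' A"
  unfolding forces_def
proof
  fix p assume p: "p \<in> A"
  have "proves T \<Delta>' \<theta>' (rename \<kappa> (atom T e p))"
    by (rule proves_weaken[OF T _ \<kappa> \<theta>]) (use f p in \<open>auto simp: forces_def\<close>)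
  moreover have "rename \<kappa> (atom T e p) = atom T e' p"
    unfolding rename_atom by (rule atom_cong) (simp add: e[OF p])
  ultimately show "proves T \<Delta>' \<theta>' (atom T e' p)" by simp
qed

lemma map_zip_names:
  assumes "wf_form T \<Gamma> (Atom r vs)" "\<And>v. v < length \<Gamma> \<Longrightarrow> \<rho> v = e (\<Gamma> ! v, ns ! v)"
  shows "map e (zip (arity T r) (map ((!) ns) vs)) = map \<rho> vs"
  unfolding list_eq_iff_nth_eq using assms(1)[unfolded wf_Atom] assms(2) by auto

text \<open>
  A generic model that satisfies the finite conjunction \<open>A\<close> satisfies the formulae that \<open>A\<close>
  makes true; a number witnessing an existential quantifier names a witnessing variable.
\<close>

lemma forces_inst:
  assumes "forces T \<Delta> \<theta> e A" "form_in_context T \<Delta> \<theta>"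
  shows "wf_form T \<Gamma> \<chi> \<Longrightarrow> renaming \<Gamma> \<Delta> \<rho> \<Longrightarrow> (\<And>v. v < length \<Gamma> \<Longrightarrow> \<rho> v = e (\<Gamma> ! v, ns ! v)) \<Longrightarrow>
    A \<in> pform_val (inst \<chi> ns) \<Longrightarrow> proves T \<Delta> \<theta> (rename \<rho> \<chi>)"
proof (induction \<chi> arbitrary: \<Gamma> \<rho> ns)
  case (Atom r vs)
  have "proves T \<Delta> \<theta> (atom T e (Holds r (map ((!) ns) vs)))" using assms(1) Atom.prems(4) by (auto simp: forces_def)
  then show ?case using map_zip_names[of \<Gamma> r vs \<rho> e ns, OF Atom.prems(1,3)] by simp
next
  case (Equal X v w)
  have "proves T \<Delta> \<theta> (atom T e (Sim X (ns ! v) (ns ! w)))" using assms(1) Equal.prems(4) by (auto simp: forces_def)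
  then show ?case using Equal.prems by auto
next
  case TT
  then show ?case using assms(2) by (simp add: proves.top)
next
  case (Conj \<phi> \<psi>)
  from Conj.IH(1)[of \<Gamma> \<rho> ns] Conj.IH(2)[of \<Gamma> \<rho> ns] Conj.prems show ?case by (simp add: proves.conj_right)
next
  case (Disj I f)
  then obtain i where i: "i \<in> I" "A \<in> pform_val (inst (f i) ns)" by auto
  have "proves T \<Delta> \<theta> (rename \<rho> (f i))" by (rule Disj.IH[of _ \<Gamma> \<rho> ns]) (use Disj.prems i in auto)
  moreover have "form_in_context T \<Delta> (rename \<rho> (Disj I f))"
    using assms(2) wf_rename[OF Disj.prems(1,2)] by (simp add: form_in_context_def)
  ultimately show ?case using proves.cut proves.disj_right[of T \<Delta> I "\<lambda>i. rename \<rho> (f i)" i] i(1) by auto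
next
  case (Exists X \<phi>)
  then obtain n where n: "Sim X n n \<in> A" "A \<in> pform_val (inst \<phi> (n # ns))" by auto
  let ?v = "e (X, n)"
  have "proves T \<Delta> \<theta> (Equal X ?v ?v)" using assms(1) n(1) by (auto simp: forces_def)
  from proves_in_context[OF T this] have v: "?v < length \<Delta>" "\<Delta> ! ?v = X" by (auto simp: form_in_context_def)
  have "proves T \<Delta> \<theta> (rename (case_nat ?v \<rho>) \<phi>)"
  proof (rule Exists.IH[of "X # \<Gamma>" _ "n # ns"])
    show "renaming (X # \<Gamma>) \<Delta> (case_nat ?v \<rho>)"
      using Exists.prems(2) v by (auto simp: renaming_def split: nat.split)
    show "case_nat ?v \<rho> u = e ((X # \<Gamma>) ! u, (n # ns) ! u)" if "u < length (X # \<Gamma>)" for u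
      using that Exists.prems(3) by (cases u) auto
  qed (use Exists.prems n in auto)
  moreover have "case_nat ?v \<rho> = case_nat ?v id \<circ> lift_ren \<rho>"
  proof
    fix u show "case_nat ?v \<rho> u = (case_nat ?v id \<circ> lift_ren \<rho>) u" by (cases u) auto
  qed
  ultimately have "proves T \<Delta> \<theta> (rename (case_nat ?v id) (rename (lift_ren \<rho>) \<phi>))"
    by (simp add: rename_comp)
  moreover have "form_in_context T \<Delta> (rename \<rho> (Exists X \<phi>))"
    using wf_rename[OF Exists.prems(1,2)] assms(2) by (simp add: form_in_context_def)
  ultimately show ?case using exists_right[OF T _ v] by simp
qed

text \<open>
  The converse direction.  If \<open>\<theta>\<close> proves \<open>\<chi>\<close>, then for proving \<open>\<psi>\<close> one may assume that \<open>\<chi>\<close> is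
  made true by a finite set \<open>B\<close> of forced basic propositions, after passing to a stronger formula
  in a larger context.  The induction on \<open>\<chi>\<close> builds \<open>B\<close>: a disjunction is split into its cases,
  and an existential quantifier contributes a new variable together with an unused number that
  names it.  The last assumption is a continuation that receives \<open>B\<close>; its general form, with a
  change of context \<open>\<kappa>\<close> that keeps the meaning of the numbers in \<open>S\<close>, lets the second
  conjunct of a conjunction be treated after the first one.
\<close>

lemma forces_step:
  assumes "finite S" "A \<in> Fpow (props (nat_theory T))" "\<And>p. p \<in> A \<Longrightarrow> names T p \<subseteq> S"
    "wf_form T \<Gamma> \<chi>" "set \<Gamma> \<subseteq> sorts T" "length ns = length \<Gamma>" "set (zip \<Gamma> ns) \<subseteq> S"
    "\<And>v. v < length \<Gamma> \<Longrightarrow> \<rho> v = e (\<Gamma> ! v, ns ! v)"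
    "forces T \<Delta> \<theta> e A" "proves T \<Delta> \<theta> (rename \<rho> \<chi>)" "form_in_context T \<Delta> \<psi>"
    "\<And>\<Delta>' \<theta>' e' \<kappa> B. renaming \<Delta> \<Delta>' \<kappa> \<Longrightarrow> proves T \<Delta>' \<theta>' (rename \<kappa> \<theta>) \<Longrightarrow>
       (\<And>s. s \<in> S \<Longrightarrow> e' s = \<kappa> (e s)) \<Longrightarrow> A \<subseteq> B \<Longrightarrow> B \<in> Fpow (props (nat_theory T)) \<Longrightarrow>
       B \<in> pform_val (inst \<chi> ns) \<Longrightarrow> forces T \<Delta>' \<theta>' e' B \<Longrightarrow> proves T \<Delta>' \<theta>' (rename \<kappa> \<psi>)"
  shows "proves T \<Delta> \<theta> \<psi>"
  using assms
proof (induction \<chi> arbitrary: S A \<Gamma> ns \<rho> e \<Delta> \<theta> \<psi>)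
  case (Atom r vs)
  let ?p = "Holds r (map ((!) ns) vs)"
  have \<theta>: "form_in_context T \<Delta> \<theta>" using proves_in_context[OF T] Atom.prems(10) by blast
  have "proves T \<Delta> \<theta> (rename id \<psi>)"
  proof (rule Atom.prems(12)[of \<Delta> id \<theta> e "insert ?p A"])
    show "insert ?p A \<in> Fpow (props (nat_theory T))"
      using Atom.prems(2,4) wf_Atom[of T \<Gamma> r vs] by (auto simp: Fpow_def props_Holds)
    show "forces T \<Delta> \<theta> e (insert ?p A)"
      using Atom.prems(9,10) map_zip_names[of \<Gamma> r vs \<rho> e ns, OF Atom.prems(4,8)] by (simp add: forces_def)
  qed (use \<theta> in \<open>auto simp: rename_id[unfolded id_def] renaming_id[unfolded id_def] proves.identity\<close>)
  then show ?case by (simp add: rename_id)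
next
  case (Equal X v w)
  let ?p = "Sim X (ns ! v) (ns ! w)"
  have \<theta>: "form_in_context T \<Delta> \<theta>" using proves_in_context[OF T] Equal.prems(10) by blast
  have "proves T \<Delta> \<theta> (rename id \<psi>)"
  proof (rule Equal.prems(12)[of \<Delta> id \<theta> e "insert ?p A"])
    show "insert ?p A \<in> Fpow (props (nat_theory T))"
      using Equal.prems(2,4,5) by (auto simp: Fpow_def props_Sim)
    show "forces T \<Delta> \<theta> e (insert ?p A)"
      using Equal.prems(4,8,9,10) by (auto simp: forces_def)
  qed (use \<theta> in \<open>auto simp: rename_id[unfolded id_def] renaming_id[unfolded id_def] proves.identity\<close>)
  then show ?case by (simp add: rename_id)
next
  case TT
  have \<theta>: "form_in_context T \<Delta> \<theta>" using proves_in_context[OF T] TT.prems(10) by blast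
  have "proves T \<Delta> \<theta> (rename id \<psi>)"
    by (rule TT.prems(12)[of \<Delta> id \<theta> e A]) (use \<theta> TT.prems in \<open>auto simp: rename_id[unfolded id_def] renaming_id[unfolded id_def] proves.identity\<close>)
  then show ?case by (simp add: rename_id)
next
  case (Conj \<phi> \<chi>)
  show ?case
  proof (rule Conj.IH(1)[OF Conj.prems(1,2,3) _ Conj.prems(5-9) _ Conj.prems(11)])
    show "wf_form T \<Gamma> \<phi>" using Conj.prems(4) by simp
    show "proves T \<Delta> \<theta> (rename \<rho> \<phi>)" using Conj.prems(10) conj_proj1[OF T] by simp
    fix \<Delta>' \<theta>' e' \<kappa> B
    assume x: "renaming \<Delta> \<Delta>' \<kappa>" "proves T \<Delta>' \<theta>' (rename \<kappa> \<theta>)" "\<And>s. s \<in> S \<Longrightarrow> e' s = \<kappa> (e s)"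
      "A \<subseteq> B" "B \<in> Fpow (props (nat_theory T))" "B \<in> pform_val (inst \<phi> ns)" "forces T \<Delta>' \<theta>' e' B"
    \<comment> \<open>the numbers that \<open>B\<close> has introduced must keep their meaning while \<open>\<chi>\<close> is treated\<close>
    let ?S = "S \<union> (\<Union>p\<in>B. names T p)"
    show "proves T \<Delta>' \<theta>' (rename \<kappa> \<psi>)"
    proof (rule Conj.IH(2)[of ?S B \<Gamma> ns "\<kappa> \<circ> \<rho>" e'])
      show "finite ?S" using Conj.prems(1) x(5) finite_names by (auto simp: Fpow_def)
      show "(\<kappa> \<circ> \<rho>) v = e' (\<Gamma> ! v, ns ! v)" if v: "v < length \<Gamma>" for v
      proof -
        have "(\<Gamma> ! v, ns ! v) \<in> S" using v Conj.prems(6,7) by (auto simp: set_zip)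
        then show ?thesis using x(3) Conj.prems(8)[OF v] by simp
      qed
      have "proves T \<Delta> \<theta> (rename \<rho> \<chi>)" using Conj.prems(10) conj_proj2[OF T] by simp
      from proves_weaken[OF T this x(1,2)] show "proves T \<Delta>' \<theta>' (rename (\<kappa> \<circ> \<rho>) \<chi>)"
        by (simp add: rename_comp)
      show "form_in_context T \<Delta>' (rename \<kappa> \<psi>)"
        by (rule form_in_context_rename[OF Conj.prems(11) x(1)])
          (use proves_in_context[OF T x(2)] in \<open>auto simp: form_in_context_def\<close>)
      fix \<Delta>'' \<theta>'' e'' \<kappa>' C
      assume y: "renaming \<Delta>' \<Delta>'' \<kappa>'" "proves T \<Delta>'' \<theta>'' (rename \<kappa>' \<theta>')" "\<And>s. s \<in> ?S \<Longrightarrow> e'' s = \<kappa>' (e' s)"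
        "B \<subseteq> C" "C \<in> Fpow (props (nat_theory T))" "C \<in> pform_val (inst \<chi> ns)" "forces T \<Delta>'' \<theta>'' e'' C"
      have "proves T \<Delta>'' \<theta>'' (rename (\<kappa>' \<circ> \<kappa>) \<psi>)"
      proof (rule Conj.prems(12)[of _ _ _ _ C])
        show "renaming \<Delta> \<Delta>'' (\<kappa>' \<circ> \<kappa>)" by (rule renaming_comp[OF x(1) y(1)])
        show "proves T \<Delta>'' \<theta>'' (rename (\<kappa>' \<circ> \<kappa>) \<theta>)"
          using proves_weaken[OF T x(2) y(1,2)] by (simp add: rename_comp)
        show "C \<in> pform_val (inst (Conj \<phi> \<chi>) ns)"
          using pform_val_mono[OF x(6) y(4)] y(6) by simp
      qed (use x y in auto)
      then show "proves T \<Delta>'' \<theta>'' (rename \<kappa>' (rename \<kappa> \<psi>))" by (simp add: rename_comp)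
    qed (use Conj.prems x in auto)
  qed
next
  case (Disj I f)
  have \<theta>: "form_in_context T \<Delta> \<theta>" using proves_in_context[OF T] Disj.prems(10) by blast
  have "proves T \<Delta> \<theta> (Disj I (\<lambda>i. rename \<rho> (f i)))" using Disj.prems(10) by simp
  then show ?case
  proof (rule disj_elim[OF T _ Disj.prems(11)])
    fix i assume i: "i \<in> I"
    have fi: "form_in_context T \<Delta> (rename \<rho> (f i))"
      using proves_in_context[OF T Disj.prems(10)] i by (auto simp: form_in_context_def)
    have c: "form_in_context T \<Delta> (Conj \<theta> (rename \<rho> (f i)))" using \<theta> fi by (simp add: form_in_context_def)
    note l1 = proves.conj_left1[OF c] and l2 = proves.conj_left2[OF c]
    show "proves T \<Delta> (Conj \<theta> (rename \<rho> (f i))) \<psi>"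
    proof (rule Disj.IH[OF _ Disj.prems(1,2,3) _ Disj.prems(5-8) _ l2 Disj.prems(11)])
      show "f i \<in> range f" by simp
      show "wf_form T \<Gamma> (f i)" using Disj.prems(4) i by simp
      show "forces T \<Delta> (Conj \<theta> (rename \<rho> (f i))) e A"
        using Disj.prems(9) proves.cut[OF l1] by (auto simp: forces_def)
      fix \<Delta>' \<theta>' e' \<kappa> B
      assume x: "renaming \<Delta> \<Delta>' \<kappa>" "proves T \<Delta>' \<theta>' (rename \<kappa> (Conj \<theta> (rename \<rho> (f i))))"
        "\<And>s. s \<in> S \<Longrightarrow> e' s = \<kappa> (e s)" "A \<subseteq> B" "B \<in> Fpow (props (nat_theory T))"
        "B \<in> pform_val (inst (f i) ns)" "forces T \<Delta>' \<theta>' e' B"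
      show "proves T \<Delta>' \<theta>' (rename \<kappa> \<psi>)"
        by (rule Disj.prems(12)[of _ _ _ _ B]) (use x i conj_proj1[OF T] in auto)
    qed
  qed
next
  case (Exists X \<chi>)
  have \<theta>: "form_in_context T \<Delta> \<theta>" using proves_in_context[OF T] Exists.prems(10) by blast
  have ex: "proves T \<Delta> \<theta> (Exists X (rename (lift_ren \<rho>) \<chi>))" using Exists.prems(10) by simp
  from proves_in_context[OF T this] have \<chi>: "form_in_context T (X # \<Delta>) (rename (lift_ren \<rho>) \<chi>)"
    and X: "X \<in> sorts T"
    by (auto simp: form_in_context_def)
  have "finite (snd ` S)" using Exists.prems(1) by simp
  \<comment> \<open>an unused number, so that the values of \<open>e\<close> on \<open>S\<close> survive when it is made to name the new variable\<close>
  then obtain n where "n \<notin> snd ` S" using ex_new_if_finite[OF infinite_UNIV_nat] by blast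
  then have n: "(X, n) \<notin> S" by force
  let ?\<theta> = "Conj (rename Suc \<theta>) (rename (lift_ren \<rho>) \<chi>)" and ?p = "Sim X n n"
  let ?e = "(Suc \<circ> e)((X, n) := 0)"
  have Suc\<theta>: "form_in_context T (X # \<Delta>) (rename Suc \<theta>)"
    by (rule form_in_context_rename[OF \<theta> renaming_Suc]) (use \<chi> in \<open>simp add: form_in_context_def\<close>)
  then have c: "form_in_context T (X # \<Delta>) ?\<theta>" using \<chi> by (simp add: form_in_context_def)
  note l1 = proves.conj_left1[OF c] and l2 = proves.conj_left2[OF c]
  have "proves T (X # \<Delta>) ?\<theta> (rename Suc \<psi>)"
  proof (rule Exists.IH[of "insert (X, n) S" "insert ?p A" "X # \<Gamma>" "n # ns" _ ?e, OF _ _ _ _ _ _ _ _ _ l2])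
    show "names T p \<subseteq> insert (X, n) S" if "p \<in> insert ?p A" for p
      using that Exists.prems(3) by auto
    show "lift_ren \<rho> v = ?e ((X # \<Gamma>) ! v, (n # ns) ! v)" if v: "v < length (X # \<Gamma>)" for v
    proof (cases v)
      case (Suc u)
      then have "(\<Gamma> ! u, ns ! u) \<in> S" using v Exists.prems(6,7) by (auto simp: set_zip)
      then show ?thesis using Suc v n Exists.prems(8) by auto
    qed simp
    have "forces T (X # \<Delta>) ?\<theta> ?e A"
      by (rule forces_weaken[OF Exists.prems(9) renaming_Suc l1]) (use Exists.prems(3) n in auto)
    moreover have "proves T (X # \<Delta>) ?\<theta> (Equal X 0 0)"
      using equal_self[OF T c, of 0] by simp
    ultimately show "forces T (X # \<Delta>) ?\<theta> ?e (insert ?p A)" by (simp add: forces_def)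
    show "form_in_context T (X # \<Delta>) (rename Suc \<psi>)"
      by (rule form_in_context_rename[OF Exists.prems(11) renaming_Suc])
        (use \<chi> in \<open>simp add: form_in_context_def\<close>)
    fix \<Delta>' \<theta>' e' \<kappa> B
    assume x: "renaming (X # \<Delta>) \<Delta>' \<kappa>" "proves T \<Delta>' \<theta>' (rename \<kappa> ?\<theta>)"
      "\<And>s. s \<in> insert (X, n) S \<Longrightarrow> e' s = \<kappa> (?e s)" "insert ?p A \<subseteq> B"
      "B \<in> Fpow (props (nat_theory T))" "B \<in> pform_val (inst \<chi> (n # ns))" "forces T \<Delta>' \<theta>' e' B"
    have "proves T \<Delta>' \<theta>' (rename (\<kappa> \<circ> Suc) \<psi>)"
    proof (rule Exists.prems(12)[of _ _ _ _ B])
      show "renaming \<Delta> \<Delta>' (\<kappa> \<circ> Suc)" by (rule renaming_comp[OF renaming_Suc x(1)])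
      show "proves T \<Delta>' \<theta>' (rename (\<kappa> \<circ> Suc) \<theta>)"
        using conj_proj1[OF T, of \<Delta>' \<theta>' "rename \<kappa> (rename Suc \<theta>)"] x(2) by (simp add: rename_comp)
      show "e' s = (\<kappa> \<circ> Suc) (e s)" if "s \<in> S" for s
        using x(3)[of s] that n by auto
      show "B \<in> pform_val (inst (Exists X \<chi>) ns)" using x(4,6) by auto
    qed (use x in auto)
    then show "proves T \<Delta>' \<theta>' (rename \<kappa> (rename Suc \<psi>))" by (simp add: rename_comp)
  qed (use Exists.prems X in \<open>auto simp: Fpow_def props_Sim\<close>)
  then show ?case by (rule exists_elim[OF T ex Exists.prems(11)])
qed

text \<open>
  The axioms on \<open>\<sim>\<close> and on relation symbols are instances of the rules of equality.  For an axiom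
  \<open>\<phi> \<turnstile> \<chi>\<close> of \<open>T\<close>, a formula \<open>\<theta>\<close> that forces an instance of \<open>\<phi>\<close> proves \<open>\<phi>\<close> by \<open>forces_inst\<close>, hence
  proves \<open>\<chi>\<close>, and \<open>forces_step\<close> reduces to the case where an instance of \<open>\<chi>\<close> is forced.
\<close>

lemma theory_ideal_consequence:
  assumes \<psi>: "form_in_context T [] \<psi>"
  shows "theory_ideal (nat_theory T) (consequence T \<psi>)"
proof (rule theory_idealI)
  let ?P = "nat_theory T"
  show "consequence T \<psi> \<subseteq> Fpow (props ?P)" by (auto simp: consequence_def)
  show "B \<in> consequence T \<psi>" if "A \<in> consequence T \<psi>" "B \<in> Fpow (props ?P)" "A \<subseteq> B" for A B
    using that forces_mono[OF _ that(3)] unfolding consequence_def by blast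
  fix a b A B
  assume ab: "(a, b) \<in> paxioms ?P" and A: "A \<in> Fpow (props ?P)"
    and b: "\<And>B. B \<in> Fpow (props ?P) \<Longrightarrow> A \<subseteq> B \<Longrightarrow> B \<in> pform_val b \<Longrightarrow> B \<in> consequence T \<psi>"
    and B: "B \<in> Fpow (props ?P)" "A \<subseteq> B" "B \<in> pform_val a"
  have "proves T \<Delta> \<theta> (rename \<rho> \<psi>)"
    if \<theta>: "form_in_context T \<Delta> \<theta>" and f: "forces T \<Delta> \<theta> e B" for \<Delta> \<theta> e \<rho>
  proof -
    have pB: "\<And>p. p \<in> B \<Longrightarrow> proves T \<Delta> \<theta> (atom T e p)" using f by (simp add: forces_def)
    have props: "proves T \<Delta> \<theta> (rename \<rho> \<psi>)"
      if "finite Q" "Q \<subseteq> props ?P" "B \<union> Q \<in> pform_val b" "\<And>q. q \<in> Q \<Longrightarrow> proves T \<Delta> \<theta> (atom T e q)" for Q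
    proof -
      have "B \<union> Q \<in> consequence T \<psi>" by (rule b) (use that A B in \<open>auto simp: Fpow_def\<close>)
      moreover have "forces T \<Delta> \<theta> e (B \<union> Q)" using f that(4) by (auto simp: forces_def)
      ultimately show ?thesis using \<theta> by (auto simp: consequence_def)
    qed
    from ab consider
        X n m where "X \<in> sorts T" "a = Prop (Sim X n m)" "b = Prop (Sim X m n)"
      | X n m l where "X \<in> sorts T" "a = PConj (Prop (Sim X n m)) (Prop (Sim X m l))" "b = Prop (Sim X n l)"
      | r ns ms where "r \<in> rels T" "length ns = length (arity T r)" "length ms = length (arity T r)"
          "a = PConj (Prop (Holds r ns)) (sims (arity T r) ns ms)" "b = Prop (Holds r ms)"
      | r ns where "r \<in> rels T" "length ns = length (arity T r)"
          "a = Prop (Holds r ns)" "b = sims (arity T r) ns ns"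
      | \<Gamma> \<phi> \<chi> ns where "(\<Gamma>, \<phi>, \<chi>) \<in> axioms T" "length ns = length \<Gamma>"
          "a = PConj (sims \<Gamma> ns ns) (inst \<phi> ns)" "b = inst \<chi> ns"
      by (auto simp: nat_theory_def)
    then show ?thesis
    proof cases
      case 1
      show ?thesis
        by (rule props[of "{Sim X m n}"])
          (use 1 B(3) equal_sym[OF T] pB[of "Sim X n m"] in \<open>auto simp: props_Sim\<close>)
    next
      case 2
      show ?thesis
        by (rule props[of "{Sim X n l}"])
          (use 2 B(3) equal_trans[OF T] pB[of "Sim X n m"] pB[of "Sim X m l"] in \<open>auto simp: props_Sim\<close>)
    next
      case 3
      have h: "Holds r ns \<in> B" "related (arity T r) ns ms B" using 3 B(3) by (auto simp: sims_val)
      have "proves T \<Delta> \<theta> (Atom r (map e (zip (arity T r) ms)))"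
      proof (rule atom_rewrite[OF T])
        show "proves T \<Delta> \<theta> (Atom r (map e (zip (arity T r) ns)))" using pB[OF h(1)] by simp
        fix i assume i: "i < length (arity T r)"
        then have "Sim (arity T r ! i) (ns ! i) (ms ! i) \<in> B" using h(2) by (simp add: related_def)
        from pB[OF this] show "proves T \<Delta> \<theta> (Equal (arity T r ! i) (map e (zip (arity T r) ns) ! i)
            (map e (zip (arity T r) ms) ! i))" using i 3 by simp
      qed (use 3 in auto)
      then show ?thesis
        by (intro props[of "{Holds r ms}"]) (use 3 in \<open>auto simp: props_Holds\<close>)
    next
      case 4
      have h: "Holds r ns \<in> B" using 4 B(3) by auto
      have wf: "wf_form T \<Delta> (Atom r (map e (zip (arity T r) ns)))" and \<Delta>: "set \<Delta> \<subseteq> sorts T"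
        using proves_in_context[OF T pB[OF h]] by (auto simp: form_in_context_def)
      let ?Q = "(\<lambda>i. Sim (arity T r ! i) (ns ! i) (ns ! i)) ` {..<length (arity T r)} :: ('s, 'r) nat_prop set"
      show ?thesis
      proof (rule props[of ?Q])
        have "set (arity T r) \<subseteq> sorts T" using T 4(1) by (auto simp: geometric_theory_def)
        then show "?Q \<subseteq> props ?P" by (auto simp: props_Sim dest: nth_mem)
        show "B \<union> ?Q \<in> pform_val b" unfolding 4 sims_val by (auto simp: related_def)
        fix q assume "q \<in> ?Q"
        then obtain i where i: "i < length (arity T r)" "q = Sim (arity T r ! i) (ns ! i) (ns ! i)" by auto
        have "e (arity T r ! i, ns ! i) < length \<Delta>" "\<Delta> ! e (arity T r ! i, ns ! i) = arity T r ! i"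
          using wf[unfolded wf_Atom] i 4 by auto
        then show "proves T \<Delta> \<theta> (atom T e q)" using equal_self[OF T \<theta>, of "e (arity T r ! i, ns ! i)"] i by simp
      qed simp
    next
      case 5
      have wf: "wf_form T \<Gamma> \<phi>" "wf_form T \<Gamma> \<chi>" "set \<Gamma> \<subseteq> sorts T"
        using T 5(1) by (auto simp: geometric_theory_def form_in_context_def)
      have h: "related \<Gamma> ns ns B" "B \<in> pform_val (inst \<phi> ns)" using 5 B(3) by (auto simp: sims_val)
      let ?\<sigma> = "\<lambda>v. e (\<Gamma> ! v, ns ! v)"
      have ren: "renaming \<Gamma> \<Delta> ?\<sigma>"
        unfolding renaming_def
      proof (intro allI impI)
        fix v assume "v < length \<Gamma>"
        then have "Sim (\<Gamma> ! v) (ns ! v) (ns ! v) \<in> B" using h(1) by (auto simp: related_def)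
        from proves_in_context[OF T pB[OF this]] show "?\<sigma> v < length \<Delta> \<and> \<Delta> ! ?\<sigma> v = \<Gamma> ! v"
          by (auto simp: form_in_context_def)
      qed
      have "proves T \<Delta> \<theta> (rename ?\<sigma> \<phi>)" by (rule forces_inst[OF f \<theta> wf(1) ren _ h(2)]) simp
      from proves_weaken[OF T proves.axiom[OF 5(1)] ren this]
      have \<chi>: "proves T \<Delta> \<theta> (rename ?\<sigma> \<chi>)" .
      let ?S = "(\<Union>p\<in>B. names T p) \<union> set (zip \<Gamma> ns)"
      show ?thesis
      proof (rule forces_step[of ?S B \<Gamma> \<chi> ns ?\<sigma> e \<Delta> \<theta>, OF _ B(1) _ wf(2,3) 5(2) _ _ f \<chi>])
        show "finite ?S" using B(1) finite_names by (auto simp: Fpow_def)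
        show "form_in_context T \<Delta> (rename \<rho> \<psi>)"
          by (rule form_in_context_rename[OF \<psi>]) (use \<theta> in \<open>auto simp: renaming_def form_in_context_def\<close>)
        fix \<Delta>' \<theta>' e' \<kappa> C
        assume x: "proves T \<Delta>' \<theta>' (rename \<kappa> \<theta>)" "B \<subseteq> C" "C \<in> Fpow (props ?P)"
          "C \<in> pform_val (inst \<chi> ns)" "forces T \<Delta>' \<theta>' e' C"
        have "C \<in> consequence T \<psi>" by (rule b) (use x B 5 in auto)
        then show "proves T \<Delta>' \<theta>' (rename \<kappa> (rename \<rho> \<psi>))"
          using x(5) proves_in_context[OF T x(1)] by (auto simp: consequence_def rename_comp)
      qed auto
    qed
  qed
  then show "B \<in> consequence T \<psi>" using B(1) by (auto simp: consequence_def)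
qed

text \<open>
  The formula \<open>\<phi>\<close> is a generic model of itself, in the empty context.  By \<open>forces_step\<close> it may be
  assumed to force some \<open>B\<close> in \<open>V \<phi> \<subseteq> V \<psi>\<close>, and \<open>V \<psi>\<close> lies below
  \<open>consequence T \<psi>\<close>.
\<close>

theorem conservativity:
  assumes \<phi>: "form_in_context T [] \<phi>" and \<psi>: "form_in_context T [] \<psi>"
    and le: "cover (nat_theory T) (pform_val (inst \<phi> [])) \<subseteq> cover (nat_theory T) (pform_val (inst \<psi> []))"
  shows "proves T [] \<phi> \<psi>"
proof -
  let ?P = "nat_theory T"
  have wf: "wf_form T [] \<psi>" using \<psi> by (simp add: form_in_context_def)
  have "A \<in> consequence T \<psi>" if A: "A \<in> Fpow (props ?P)" "A \<in> pform_val (inst \<psi> [])" for A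
  proof -
    have "proves T \<Delta> \<theta> (rename \<rho> \<psi>)" if "form_in_context T \<Delta> \<theta>" "forces T \<Delta> \<theta> e A" for \<Delta> \<theta> e \<rho>
      by (rule forces_inst[OF that(2,1) wf _ _ A(2)]) (auto simp: renaming_def)
    then show ?thesis using A(1) by (auto simp: consequence_def)
  qed
  then have "cover ?P (pform_val (inst \<psi> [])) \<subseteq> consequence T \<psi>"
    by (intro cover_least[OF theory_ideal_consequence[OF \<psi>]]) auto
  then have sub: "cover ?P (pform_val (inst \<phi> [])) \<subseteq> consequence T \<psi>" using le by auto
  show ?thesis
  proof (rule forces_step[of "{}" "{}" "[]" \<phi> "[]" id undefined "[]" \<phi>])
    show "proves T [] \<phi> (rename id \<phi>)" using \<phi> by (simp add: rename_id proves.identity)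
    fix \<Delta>' \<theta>' e' \<kappa> B
    assume x: "proves T \<Delta>' \<theta>' (rename \<kappa> \<phi>)" "B \<in> Fpow (props ?P)" "B \<in> pform_val (inst \<phi> [])"
      "forces T \<Delta>' \<theta>' e' B"
    have "B \<in> consequence T \<psi>" using sub cover_return[OF x(2,3)] by auto
    then show "proves T \<Delta>' \<theta>' (rename \<kappa> \<psi>)"
      using x(4) proves_in_context[OF T x(1)] by (auto simp: consequence_def)
  qed (use \<phi> \<psi> in \<open>auto simp: form_in_context_def empty_in_Fpow forces_def\<close>)
qed

end

section \<open>Sentences are invariant under isomorphism\<close>

abbreviation copy1 :: "('s, 'r) nat_prop \<Rightarrow> ('s iso_sort, ('s, 'r) iso_rel) nat_prop" where
  "copy1 \<equiv> map_nat_prop Sort1 Rel1"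

abbreviation copy2 :: "('s, 'r) nat_prop \<Rightarrow> ('s iso_sort, ('s, 'r) iso_rel) nat_prop" where
  "copy2 \<equiv> map_nat_prop Sort2 Rel2"

abbreviation alpha :: "'s \<Rightarrow> nat \<Rightarrow> nat \<Rightarrow> ('s iso_sort, ('s, 'r) iso_rel) nat_prop" where
  "alpha X n m \<equiv> Holds (Alpha X) [n, m]"

lemma iso_theory_simps:
  "sorts (iso_theory T) = Sort1 ` sorts T \<union> Sort2 ` sorts T"
  "rels (iso_theory T) = Rel1 ` rels T \<union> Rel2 ` rels T \<union> Alpha ` sorts T"
  "arity (iso_theory T) = iso_arity T"
  by (simp_all add: iso_theory_def)

lemma copy_props:
  "p \<in> props (nat_theory T) \<Longrightarrow> copy1 p \<in> props (nat_theory (iso_theory T))"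
  "p \<in> props (nat_theory T) \<Longrightarrow> copy2 p \<in> props (nat_theory (iso_theory T))"
  by (cases p; auto simp: props_Sim props_Holds iso_theory_simps)+

lemma Conjs_val:
  "A \<in> pform_val (inst (Conjs xs) ns) \<longleftrightarrow> (\<forall>\<phi>\<in>set xs. A \<in> pform_val (inst \<phi> ns))"
  by (induction xs) (auto simp: Conjs_def)

lemma iso_rel_val:
  fixes B :: "('s iso_sort, ('s, 'r) iso_rel) nat_prop set" and Xs :: "'s list"
  assumes "length ns = length Xs" "length ms = length Xs"
  shows "B \<in> pform_val (inst (Conjs (map (\<lambda>i. Atom (Alpha (Xs ! i)) [i, length Xs + i]) [0..<length Xs])
        :: ('s iso_sort, ('s, 'r) iso_rel, 'i) form) (ns @ ms)) \<longleftrightarrow>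
      (\<forall>i<length Xs. alpha (Xs ! i) (ns ! i) (ms ! i) \<in> B)"
    and "map ((!) (ns @ ms)) [0..<length Xs] = ns"
    and "map ((!) (ns @ ms)) [length Xs..<2 * length Xs] = ms"
proof -
  show "B \<in> pform_val (inst (Conjs (map (\<lambda>i. Atom (Alpha (Xs ! i)) [i, length Xs + i]) [0..<length Xs])
        :: ('s iso_sort, ('s, 'r) iso_rel, 'i) form) (ns @ ms)) \<longleftrightarrow>
      (\<forall>i<length Xs. alpha (Xs ! i) (ns ! i) (ms ! i) \<in> B)"
    using assms by (auto simp: Conjs_val nth_append)
  show "map ((!) (ns @ ms)) [0..<length Xs] = ns" "map ((!) (ns @ ms)) [length Xs..<2 * length Xs] = ms"
    unfolding list_eq_iff_nth_eq using assms by (auto simp: nth_append)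
qed

context
  fixes T :: "('s, 'r, 'i) geo_theory" and A :: "('s iso_sort, ('s, 'r) iso_rel) nat_prop set"
  assumes A: "A \<in> Fpow (props (nat_theory (iso_theory T)))"
begin

private abbreviation "Q \<equiv> nat_theory (iso_theory T)"

lemma alpha_self:
  assumes "alpha X n m \<in> A"
  shows "A \<in> cover Q {B. Sim (Sort1 X) n n \<in> B}" "A \<in> cover Q {B. Sim (Sort2 X) m m \<in> B}"
  using holds_sim[OF A assms, of 0] holds_sim[OF A assms, of 1] by (auto simp: iso_theory_simps)

lemma sims_cover:
  assumes "\<And>i. i < length Xs \<Longrightarrow> A \<in> cover Q {B. Sim (Xs ! i) (ns ! i) (ms ! i) \<in> B}"
  shows "A \<in> cover Q {B. related Xs ns ms B}"
proof -
  have "A \<in> cover Q {B. (\<lambda>i. Sim (Xs ! i) (ns ! i) (ms ! i)) ` {..<length Xs} \<subseteq> B}"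
    by (rule cover_all) (use A assms in auto)
  then show ?thesis by (simp add: related_def image_subset_iff lessThan_iff Ball_def)
qed

lemma iso_axiom_cover:
  assumes ax: "(\<Gamma>, \<phi>, \<psi>) \<in> axioms (iso_theory T)" "length ns = length \<Gamma>"
    and s: "\<And>i. i < length \<Gamma> \<Longrightarrow> A \<in> cover Q {B. Sim (\<Gamma> ! i) (ns ! i) (ns ! i) \<in> B}"
    and \<phi>: "A \<in> pform_val (inst \<phi> ns)"
  shows "A \<in> cover Q (pform_val (inst \<psi> ns))"
proof (rule cover_bind[OF sims_cover[OF s]])
  fix B assume B: "B \<in> Fpow (props Q)" "A \<subseteq> B" "B \<in> {B. related \<Gamma> ns ns B}"
  show "B \<in> cover Q (pform_val (inst \<psi> ns))"
    by (rule geometric_axiom_cover[OF B(1) ax]) (use B pform_val_mono[OF \<phi>] in auto)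
qed (auto intro: related_mono)

lemma alpha_equal:
  assumes X: "X \<in> sorts T" and a: "alpha X n m \<in> A" "alpha X n' m' \<in> A"
  shows "Sim (Sort1 X) n n' \<in> A \<Longrightarrow> A \<in> cover Q {B. Sim (Sort2 X) m m' \<in> B}"
    and "Sim (Sort2 X) m m' \<in> A \<Longrightarrow> A \<in> cover Q {B. Sim (Sort1 X) n n' \<in> B}"
proof -
  let ?\<Gamma> = "[Sort1 X, Sort1 X, Sort2 X, Sort2 X]" and ?ns = "[n, n', m, m']"
  let ?\<phi> = "Conj (Conj (Atom (Alpha X) [0, 2]) (Atom (Alpha X) [1, 3])) (Equal (Sort1 X) 0 1) :: ('s iso_sort, ('s, 'r) iso_rel, 'i) form"
  let ?\<psi> = "Conj (Conj (Atom (Alpha X) [0, 2]) (Atom (Alpha X) [1, 3])) (Equal (Sort2 X) 2 3) :: ('s iso_sort, ('s, 'r) iso_rel, 'i) form"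
  have ax: "(?\<Gamma>, ?\<phi>, ?\<psi>) \<in> axioms (iso_theory T)" "(?\<Gamma>, ?\<psi>, ?\<phi>) \<in> axioms (iso_theory T)"
    using X by (auto simp: iso_theory_def iso_alpha_axioms_def Let_def)
  have s: "A \<in> cover Q {B. Sim (?\<Gamma> ! i) (?ns ! i) (?ns ! i) \<in> B}" if "i < length ?\<Gamma>" for i
    using that alpha_self[OF a(1)] alpha_self[OF a(2)] by (auto simp: less_Suc_eq numeral_eq_Suc)
  show "A \<in> cover Q {B. Sim (Sort2 X) m m' \<in> B}" if "Sim (Sort1 X) n n' \<in> A"
  proof -
    have "A \<in> cover Q (pform_val (inst ?\<psi> ?ns))"
      by (rule iso_axiom_cover[OF ax(1) _ s]) (use a that in \<open>auto simp: numeral_eq_Suc\<close>)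
    moreover have "pform_val (inst ?\<psi> ?ns) \<subseteq> {B. Sim (Sort2 X) m m' \<in> B}" by (auto simp: numeral_eq_Suc)
    ultimately show ?thesis using cover_mono by blast
  qed
  show "A \<in> cover Q {B. Sim (Sort1 X) n n' \<in> B}" if "Sim (Sort2 X) m m' \<in> A"
  proof -
    have "A \<in> cover Q (pform_val (inst ?\<phi> ?ns))"
      by (rule iso_axiom_cover[OF ax(2) _ s]) (use a that in \<open>auto simp: numeral_eq_Suc\<close>)
    moreover have "pform_val (inst ?\<phi> ?ns) \<subseteq> {B. Sim (Sort1 X) n n' \<in> B}" by (auto simp: numeral_eq_Suc)
    ultimately show ?thesis using cover_mono by blast
  qed
qed

lemma alpha_total:
  assumes X: "X \<in> sorts T"
  shows "Sim (Sort1 X) n n \<in> A \<Longrightarrow> A \<in> cover Q {B. \<exists>m. alpha X n m \<in> B \<and> Sim (Sort2 X) m m \<in> B}"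
    and "Sim (Sort2 X) n n \<in> A \<Longrightarrow> A \<in> cover Q {B. \<exists>m. alpha X m n \<in> B \<and> Sim (Sort1 X) m m \<in> B}"
proof -
  let ?\<phi>1 = "Exists (Sort2 X) (Atom (Alpha X) [1, 0]) :: ('s iso_sort, ('s, 'r) iso_rel, 'i) form"
    and ?\<phi>2 = "Exists (Sort1 X) (Atom (Alpha X) [0, 1]) :: ('s iso_sort, ('s, 'r) iso_rel, 'i) form"
  have ax: "([Sort1 X], TT, ?\<phi>1) \<in> axioms (iso_theory T)" "([Sort2 X], TT, ?\<phi>2) \<in> axioms (iso_theory T)"
    using X by (auto simp: iso_theory_def iso_alpha_axioms_def Let_def)
  show "A \<in> cover Q {B. \<exists>m. alpha X n m \<in> B \<and> Sim (Sort2 X) m m \<in> B}" if "Sim (Sort1 X) n n \<in> A"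
  proof -
    have "A \<in> cover Q (pform_val (inst ?\<phi>1 [n]))"
      by (rule iso_axiom_cover[OF ax(1)]) (use that A in \<open>auto intro: cover_return\<close>)
    moreover have "pform_val (inst ?\<phi>1 [n]) \<subseteq> {B. \<exists>m. alpha X n m \<in> B \<and> Sim (Sort2 X) m m \<in> B}" by auto
    ultimately show ?thesis using cover_mono by blast
  qed
  show "A \<in> cover Q {B. \<exists>m. alpha X m n \<in> B \<and> Sim (Sort1 X) m m \<in> B}" if "Sim (Sort2 X) n n \<in> A"
  proof -
    have "A \<in> cover Q (pform_val (inst ?\<phi>2 [n]))"
      by (rule iso_axiom_cover[OF ax(2)]) (use that A in \<open>auto intro: cover_return\<close>)
    moreover have "pform_val (inst ?\<phi>2 [n]) \<subseteq> {B. \<exists>m. alpha X m n \<in> B \<and> Sim (Sort1 X) m m \<in> B}" by auto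
    ultimately show ?thesis using cover_mono by blast
  qed
qed

lemma alpha_rel:
  assumes r: "r \<in> rels T" and l: "length ns = length (arity T r)" "length ms = length (arity T r)"
    and a: "\<And>i. i < length (arity T r) \<Longrightarrow> alpha (arity T r ! i) (ns ! i) (ms ! i) \<in> A"
  shows "Holds (Rel1 r) ns \<in> A \<Longrightarrow> A \<in> cover Q {B. Holds (Rel2 r) ms \<in> B}"
    and "Holds (Rel2 r) ms \<in> A \<Longrightarrow> A \<in> cover Q {B. Holds (Rel1 r) ns \<in> B}"
proof -
  let ?k = "length (arity T r)"
  let ?\<Gamma> = "map Sort1 (arity T r) @ map Sort2 (arity T r)"
  let ?\<alpha> = "Conjs (map (\<lambda>i. Atom (Alpha (arity T r ! i)) [i, ?k + i]) [0..<?k]) :: ('s iso_sort, ('s, 'r) iso_rel, 'i) form"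
  let ?\<phi> = "Conj ?\<alpha> (Atom (Rel1 r) [0..<?k])" and ?\<psi> = "Conj ?\<alpha> (Atom (Rel2 r) [?k..<2 * ?k])"
  note v = iso_rel_val[OF l]
  have ax: "(?\<Gamma>, ?\<phi>, ?\<psi>) \<in> axioms (iso_theory T)" "(?\<Gamma>, ?\<psi>, ?\<phi>) \<in> axioms (iso_theory T)"
    using r by (auto simp: iso_theory_def iso_rel_axioms_def Let_def)
  have ln: "length (ns @ ms) = length ?\<Gamma>" using l by simp
  have s: "A \<in> cover Q {B. Sim (?\<Gamma> ! i) ((ns @ ms) ! i) ((ns @ ms) ! i) \<in> B}" if i: "i < length ?\<Gamma>" for i
  proof (cases "i < ?k")
    case True
    then show ?thesis using alpha_self(1)[OF a[OF True]] l by (simp add: nth_append)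
  next
    case False
    then have "i - ?k < ?k" using i by auto
    from alpha_self(2)[OF a[OF this]] show ?thesis using False i l by (simp add: nth_append)
  qed
  have av: "A \<in> pform_val (inst ?\<alpha> (ns @ ms))" by (rule iffD2[OF v(1)]) (use a in simp)
  show "A \<in> cover Q {B. Holds (Rel2 r) ms \<in> B}" if h: "Holds (Rel1 r) ns \<in> A"
  proof -
    have "A \<in> cover Q (pform_val (inst ?\<psi> (ns @ ms)))"
      by (rule iso_axiom_cover[OF ax(1) ln s]) (use av h v(2) in simp_all)
    moreover have "pform_val (inst ?\<psi> (ns @ ms)) \<subseteq> {B. Holds (Rel2 r) ms \<in> B}" using v(3) by simp
    ultimately show ?thesis using cover_mono by blast
  qed
  show "A \<in> cover Q {B. Holds (Rel1 r) ns \<in> B}" if h: "Holds (Rel2 r) ms \<in> A"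
  proof -
    have "A \<in> cover Q (pform_val (inst ?\<phi> (ns @ ms)))"
      by (rule iso_axiom_cover[OF ax(2) ln s]) (use av h v(3) in simp_all)
    moreover have "pform_val (inst ?\<phi> (ns @ ms)) \<subseteq> {B. Holds (Rel1 r) ns \<in> B}" using v(2) by auto
    ultimately show ?thesis using cover_mono by blast
  qed
qed

end

lemma sentence_iso_invariant:
  assumes \<phi>: "form_in_context T [] \<phi>"
  shows "cover (nat_theory (iso_theory T)) {B. copy1 -` B \<in> pform_val (inst \<phi> [])} =
    cover (nat_theory (iso_theory T)) {B. copy2 -` B \<in> pform_val (inst \<phi> [])}"
proof
  let ?Q = "nat_theory (iso_theory T)"
  have wf: "wf_form T [] \<phi>" using \<phi> by (simp add: form_in_context_def)
  have "A \<in> cover ?Q {B. copy2 -` B \<in> pform_val (inst \<phi> [])}"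
    if A: "A \<in> Fpow (props ?Q)" "copy1 -` A \<in> pform_val (inst \<phi> [])" for A
    by (rule inst_transfer[where T = T and a = alpha and k = copy1 and \<Gamma> = "[]" and ns = "[]"])
      (use wf A in \<open>auto intro: alpha_equal alpha_rel alpha_total\<close>)
  then show "cover ?Q {B. copy1 -` B \<in> pform_val (inst \<phi> [])} \<subseteq> cover ?Q {B. copy2 -` B \<in> pform_val (inst \<phi> [])}"
    by (intro cover_least[OF theory_ideal_cover]) auto
  have "A \<in> cover ?Q {B. copy1 -` B \<in> pform_val (inst \<phi> [])}"
    if A: "A \<in> Fpow (props ?Q)" "copy2 -` A \<in> pform_val (inst \<phi> [])" for A
    by (rule inst_transfer[where T = T and a = "\<lambda>X n m. alpha X m n" and k = copy2 and \<Gamma> = "[]" and ns = "[]"])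
      (use wf A in \<open>auto intro: alpha_equal alpha_rel alpha_total\<close>)
  then show "cover ?Q {B. copy2 -` B \<in> pform_val (inst \<phi> [])} \<subseteq> cover ?Q {B. copy1 -` B \<in> pform_val (inst \<phi> [])}"
    by (intro cover_least[OF theory_ideal_cover]) auto
qed

lemma source_generator:
  assumes "source_map T s" "p \<in> props (nat_theory T)"
  shows "s (generator (nat_theory T) p) = generator (nat_theory (iso_theory T)) (copy1 p)"
  using assms by (cases p) (auto simp: source_map_def props_Sim props_Holds)

lemma target_generator:
  assumes "target_map T t" "p \<in> props (nat_theory T)"
  shows "t (generator (nat_theory T) p) = generator (nat_theory (iso_theory T)) (copy2 p)"
  using assms by (cases p) (auto simp: target_map_def props_Sim props_Holds)

theorem sentence_equalised:
  assumes \<phi>: "form_in_context T [] \<phi>" and s: "source_map T s" and t: "target_map T t"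
  shows "s (cover (nat_theory T) (pform_val (inst \<phi> []))) = t (cover (nat_theory T) (pform_val (inst \<phi> [])))"
proof -
  have over: "pform_over (props (nat_theory T)) (inst \<phi> [])"
    by (rule pform_over_inst) (use \<phi> in \<open>auto simp: form_in_context_def\<close>)
  have sh: "frame_hom (G0_frame T) (G1_frame T) s" "frame_hom (G0_frame T) (G1_frame T) t"
    using s t by (auto simp: source_map_def target_map_def)
  show ?thesis
    using hom_cover[OF sh(1) copy_props(1) source_generator[OF s] over]
      hom_cover[OF sh(2) copy_props(2) target_generator[OF t] over] sentence_iso_invariant[OF \<phi>]
    by simp
qed

section \<open>Invariant opens are closed under renumbering\<close>

text \<open>
  The inverse image of a basic proposition under \<open>(M, e) \<mapsto> (M, e \<circ> \<sigma>)\<close>.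
\<close>

primrec renumber :: "('s, 'r, 'i) geo_theory \<Rightarrow> ('s \<Rightarrow> nat \<Rightarrow> nat) \<Rightarrow> ('s, 'r) nat_prop \<Rightarrow> ('s, 'r) nat_prop" where
  "renumber T \<sigma> (Sim X n m) = Sim X (\<sigma> X n) (\<sigma> X m)"
| "renumber T \<sigma> (Holds r ns) = Holds r (map2 \<sigma> (arity T r) ns)"

text \<open>
  The inverse image of a basic proposition under the map from \<open>G\<^sub>0\<close> to \<open>G\<^sub>1\<close> which sends \<open>(M, e)\<close>
  to the identity of \<open>M\<close>, as an isomorphism from \<open>(M, e)\<close> to \<open>(M, e \<circ> \<sigma>)\<close>.  That \<open>n\<close>
  corresponds to \<open>m\<close> under this isomorphism means \<open>e n = e (\<sigma> m)\<close>.
\<close>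

fun collapse ::
  "('s, 'r, 'i) geo_theory \<Rightarrow> ('s \<Rightarrow> nat \<Rightarrow> nat) \<Rightarrow> ('s iso_sort, ('s, 'r) iso_rel) nat_prop \<Rightarrow> ('s, 'r) nat_prop"
  where
  "collapse T \<sigma> (Sim (Sort1 X) n m) = Sim X n m"
| "collapse T \<sigma> (Sim (Sort2 X) n m) = Sim X (\<sigma> X n) (\<sigma> X m)"
| "collapse T \<sigma> (Holds (Rel1 r) ns) = Holds r ns"
| "collapse T \<sigma> (Holds (Rel2 r) ns) = Holds r (map2 \<sigma> (arity T r) ns)"
| "collapse T \<sigma> (Holds (Alpha X) ns) = Sim X (ns ! 0) (\<sigma> X (ns ! 1))"

lemma collapse_copy:
  "collapse T \<sigma> (copy1 p) = p" "collapse T \<sigma> (copy2 p) = renumber T \<sigma> p"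
  by (cases p; simp)+

lemma collapse_vimage: "copy1 -` (collapse T \<sigma> -` A) = A" "copy2 -` (collapse T \<sigma> -` A) = renumber T \<sigma> -` A"
  by (auto simp: collapse_copy)

text \<open>
  Surjectivity of \<open>\<sigma>\<close> matters for existential quantifiers: every number is the renumbering of a
  possible witness.
\<close>

lemma renumber_inst_val:
  assumes "\<And>X. X \<in> sorts T \<Longrightarrow> surj (\<sigma> X)"
  shows "wf_form T \<Gamma> \<phi> \<Longrightarrow> length ns = length \<Gamma> \<Longrightarrow>
    renumber T \<sigma> -` A \<in> pform_val (inst \<phi> ns) \<longleftrightarrow> A \<in> pform_val (inst \<phi> (map2 \<sigma> \<Gamma> ns))"
proof (induction \<phi> arbitrary: \<Gamma> ns)
  case (Atom r vs)
  have "map2 \<sigma> (arity T r) (map ((!) ns) vs) = map ((!) (map2 \<sigma> \<Gamma> ns)) vs"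
    unfolding list_eq_iff_nth_eq using Atom[unfolded wf_Atom] by auto
  then show ?case by simp
next
  case (Conj \<phi> \<psi>)
  from Conj.IH(1)[of \<Gamma> ns] Conj.IH(2)[of \<Gamma> ns] Conj.prems show ?case by simp
next
  case (Disj I f)
  have "renumber T \<sigma> -` A \<in> pform_val (inst (f i) ns) \<longleftrightarrow> A \<in> pform_val (inst (f i) (map2 \<sigma> \<Gamma> ns))"
    if "i \<in> I" for i using Disj.IH[of "f i" \<Gamma> ns] Disj.prems that by auto
  then show ?case by auto
next
  case (Exists X \<phi>)
  have IH: "renumber T \<sigma> -` A \<in> pform_val (inst \<phi> (n # ns)) \<longleftrightarrow>
      A \<in> pform_val (inst \<phi> (\<sigma> X n # map2 \<sigma> \<Gamma> ns))" for n
    using Exists.IH[of "X # \<Gamma>" "n # ns"] Exists.prems by simp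
  have s: "surj (\<sigma> X)" using assms Exists.prems by simp
  have "(\<exists>n. Q (\<sigma> X n)) \<longleftrightarrow> (\<exists>n. Q n)" for Q using s by (metis surj_def)
  from this[of "\<lambda>n. Sim X n n \<in> A \<and> A \<in> pform_val (inst \<phi> (n # map2 \<sigma> \<Gamma> ns))"]
  show ?case by (simp add: IH)
qed auto

lemma map_form_val:
  "A \<in> pform_val (inst (map_form f g \<phi>) ns) \<longleftrightarrow> map_nat_prop f g -` A \<in> pform_val (inst \<phi> ns)"
  by (simp only: map_inst[symmetric] pform_val_map)

text \<open>
  The axioms that make up the second copy of \<open>T\<close> become axioms of \<open>T\<close> at renumbered arguments, by
  \<open>renumber_inst_val\<close>.  The axioms on \<open>\<alpha>\<close> reduce to \<open>\<sim>\<close> being an equivalence relation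
  compatible with the relation symbols, except that the totality of \<open>\<alpha>\<close> uses the
  surjectivity of \<open>\<sigma>\<close>.
\<close>

lemma collapse_axiom:
  fixes T :: "('s, 'r, 'i) geo_theory"
  assumes T: "geometric_theory T" and surj: "\<And>X. X \<in> sorts T \<Longrightarrow> surj (\<sigma> X)"
    and ab: "(a, b) \<in> paxioms (nat_theory (iso_theory T))" and A: "A \<in> Fpow (props (nat_theory T))"
    and a: "collapse T \<sigma> -` A \<in> pform_val a"
  shows "A \<in> cover (nat_theory T) {B. collapse T \<sigma> -` B \<in> pform_val b}"
proof -
  let ?P = "nat_theory T" and ?I = "iso_theory T" and ?k = "collapse T \<sigma>"
  from ab consider
      Y n m where "Y \<in> sorts ?I" "a = Prop (Sim Y n m)" "b = Prop (Sim Y m n)"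
    | Y n m l where "Y \<in> sorts ?I" "a = PConj (Prop (Sim Y n m)) (Prop (Sim Y m l))" "b = Prop (Sim Y n l)"
    | r ns ms where "r \<in> rels ?I" "length ns = length (arity ?I r)" "length ms = length (arity ?I r)"
        "a = PConj (Prop (Holds r ns)) (sims (arity ?I r) ns ms)" "b = Prop (Holds r ms)"
    | r ns where "r \<in> rels ?I" "length ns = length (arity ?I r)"
        "a = Prop (Holds r ns)" "b = sims (arity ?I r) ns ns"
    | \<Gamma> \<phi> \<psi> ns where "(\<Gamma>, \<phi>, \<psi>) \<in> axioms ?I" "length ns = length \<Gamma>"
        "a = PConj (sims \<Gamma> ns ns) (inst \<phi> ns)" "b = inst \<psi> ns"
    by (auto simp: nat_theory_def)
  then show ?thesis
  proof cases
    case 1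
    then show ?thesis using a sim_sym[OF A] by (cases Y) auto
  next
    case 2
    then show ?thesis using a sim_trans[OF A] by (cases Y) auto
  next
    case 3
    have h: "?k (Holds r ns) \<in> A" "\<And>i. i < length (arity ?I r) \<Longrightarrow> ?k (Sim (arity ?I r ! i) (ns ! i) (ms ! i)) \<in> A"
      using a 3 by (auto simp: sims_val related_def)
    have "A \<in> cover ?P {B. ?k (Holds r ms) \<in> B}"
    proof (cases r)
      case (Rel1 r')
      have "A \<in> cover ?P {B. Holds r' ms \<in> B}"
        by (rule holds_subst[OF A, of _ ns]) (use Rel1 h 3 in \<open>auto simp: iso_theory_simps\<close>)
      then show ?thesis using Rel1 by simp
    next
      case (Rel2 r')
      have "A \<in> cover ?P {B. Holds r' (map2 \<sigma> (arity T r') ms) \<in> B}"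
        by (rule holds_subst[OF A, of _ "map2 \<sigma> (arity T r') ns"])
          (use Rel2 h 3 in \<open>auto simp: iso_theory_simps\<close>)
      then show ?thesis using Rel2 by simp
    next
      case (Alpha X)
      have s: "Sim X (ns ! 0) (ms ! 0) \<in> A" "Sim X (\<sigma> X (ns ! 1)) (\<sigma> X (ms ! 1)) \<in> A"
        "Sim X (ns ! 0) (\<sigma> X (ns ! 1)) \<in> A"
        using h(1) h(2)[of 0] h(2)[of 1] Alpha by (auto simp: iso_theory_simps)
      have "A \<in> cover ?P {B. Sim X (ms ! 0) (\<sigma> X (ms ! 1)) \<in> B}"
      proof (rule cover_bind[OF sim_sym[OF A s(1)]])
        fix B assume B: "B \<in> Fpow (props ?P)" "A \<subseteq> B" "B \<in> {B. Sim X (ms ! 0) (ns ! 0) \<in> B}"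
        have "B \<in> cover ?P {B. Sim X (ms ! 0) (\<sigma> X (ns ! 1)) \<in> B}"
          by (rule sim_trans[OF B(1), of _ _ "ns ! 0"]) (use B s in auto)
        then show "B \<in> cover ?P {B. Sim X (ms ! 0) (\<sigma> X (ms ! 1)) \<in> B}"
        proof (rule cover_bind)
          fix C assume C: "C \<in> Fpow (props ?P)" "B \<subseteq> C" "C \<in> {B. Sim X (ms ! 0) (\<sigma> X (ns ! 1)) \<in> B}"
          show "C \<in> cover ?P {B. Sim X (ms ! 0) (\<sigma> X (ms ! 1)) \<in> B}"
            by (rule sim_trans[OF C(1), of _ _ "\<sigma> X (ns ! 1)"]) (use B C s in auto)
        qed auto
      qed auto
      then show ?thesis using Alpha by simp
    qed
    then show ?thesis using 3 by simp
  next
    case 4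
    have h: "?k (Holds r ns) \<in> A" using a 4 by simp
    have "A \<in> cover ?P {B. ?k (Sim (arity ?I r ! i) (ns ! i) (ns ! i)) \<in> B}"
      if i: "i < length (arity ?I r)" for i
    proof (cases r)
      case (Rel1 r')
      then show ?thesis using holds_sim[OF A, of r' ns i] h i by (simp add: iso_theory_simps)
    next
      case (Rel2 r')
      then show ?thesis
        using holds_sim[OF A, of r' "map2 \<sigma> (arity T r') ns" i] h i 4 by (simp add: iso_theory_simps)
    next
      case (Alpha X)
      then show ?thesis
        using sim_self[OF A, of X "ns ! 0" "\<sigma> X (ns ! 1)"] h i by (auto simp: iso_theory_simps less_Suc_eq)
    qed
    then have "A \<in> cover ?P {B. (\<lambda>i. ?k (Sim (arity ?I r ! i) (ns ! i) (ns ! i))) ` {..<length (arity ?I r)} \<subseteq> B}"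
      by (intro cover_all A) auto
    moreover have "{B. (\<lambda>i. ?k (Sim (arity ?I r ! i) (ns ! i) (ns ! i))) ` {..<length (arity ?I r)} \<subseteq> B} =
        {B. ?k -` B \<in> pform_val b}"
      unfolding 4 by (auto simp: sims_val related_def)
    ultimately show ?thesis by simp
  next
    case 5
    have h: "related \<Gamma> ns ns (?k -` A)" "?k -` A \<in> pform_val (inst \<phi> ns)" using a 5 by (auto simp: sims_val)
    from 5(1) consider \<Gamma>' \<phi>' \<psi>' where "(\<Gamma>', \<phi>', \<psi>') \<in> axioms T" "\<Gamma> = map Sort1 \<Gamma>'"
        "\<phi> = map_form Sort1 Rel1 \<phi>'" "\<psi> = map_form Sort1 Rel1 \<psi>'"
      | \<Gamma>' \<phi>' \<psi>' where "(\<Gamma>', \<phi>', \<psi>') \<in> axioms T" "\<Gamma> = map Sort2 \<Gamma>'"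
        "\<phi> = map_form Sort2 Rel2 \<phi>'" "\<psi> = map_form Sort2 Rel2 \<psi>'"
      | X where "X \<in> sorts T" "(\<Gamma>, \<phi>, \<psi>) \<in> iso_alpha_axioms X"
      | r where "r \<in> rels T" "(\<Gamma>, \<phi>, \<psi>) \<in> iso_rel_axioms T r"
      unfolding iso_theory_def by auto
    then have "A \<in> cover ?P {B. ?k -` B \<in> pform_val (inst \<psi> ns)}"
    proof cases
      case c: 1
      have "A \<in> cover ?P (pform_val (inst \<psi>' ns))"
        by (rule geometric_axiom_cover[OF A c(1)])
          (use h 5(2) c in \<open>auto simp: map_form_val collapse_vimage related_def\<close>)
      then show ?thesis using c by (simp add: map_form_val collapse_vimage)
    next
      case c: 2
      have wf: "wf_form T \<Gamma>' \<phi>'" "wf_form T \<Gamma>' \<psi>'"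
        using T c(1) by (auto simp: geometric_theory_def form_in_context_def)
      have l: "length ns = length \<Gamma>'" using 5(2) c by simp
      have "A \<in> cover ?P (pform_val (inst \<psi>' (map2 \<sigma> \<Gamma>' ns)))"
        by (rule geometric_axiom_cover[OF A c(1)])
          (use h l c renumber_inst_val[OF surj wf(1) l] in
            \<open>auto simp: map_form_val collapse_vimage related_def\<close>)
      then show ?thesis
        using c renumber_inst_val[OF surj wf(2) l] by (simp add: map_form_val collapse_vimage)
    next
      case c: 3
      let ?\<Gamma> = "[Sort1 X, Sort1 X, Sort2 X, Sort2 X]"
      let ?\<alpha> = "Conj (Atom (Alpha X) [0, 2]) (Atom (Alpha X) [1, 3])"
      from c(2) consider
          "\<Gamma> = ?\<Gamma>" "\<phi> = Conj ?\<alpha> (Equal (Sort1 X) 0 1)" "\<psi> = Conj ?\<alpha> (Equal (Sort2 X) 2 3)"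
        | "\<Gamma> = ?\<Gamma>" "\<phi> = Conj ?\<alpha> (Equal (Sort2 X) 2 3)" "\<psi> = Conj ?\<alpha> (Equal (Sort1 X) 0 1)"
        | "\<Gamma> = [Sort2 X]" "\<phi> = TT" "\<psi> = Exists (Sort1 X) (Atom (Alpha X) [0, 1])"
        | "\<Gamma> = [Sort1 X]" "\<phi> = TT" "\<psi> = Exists (Sort2 X) (Atom (Alpha X) [1, 0])"
        unfolding iso_alpha_axioms_def Let_def by auto
      then show ?thesis
      proof cases
        case d: 1
        have s: "Sim X (ns ! 0) (\<sigma> X (ns ! 2)) \<in> A" "Sim X (ns ! 1) (\<sigma> X (ns ! 3)) \<in> A"
          "Sim X (ns ! 0) (ns ! 1) \<in> A" using h(2) d by auto
        have "A \<in> cover ?P {B. Sim X (\<sigma> X (ns ! 2)) (\<sigma> X (ns ! 3)) \<in> B}"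
        proof (rule cover_bind[OF sim_sym[OF A s(1)]])
          fix B assume B: "B \<in> Fpow (props ?P)" "A \<subseteq> B" "B \<in> {B. Sim X (\<sigma> X (ns ! 2)) (ns ! 0) \<in> B}"
          have "B \<in> cover ?P {B. Sim X (\<sigma> X (ns ! 2)) (ns ! 1) \<in> B}"
            by (rule sim_trans[OF B(1), of _ _ "ns ! 0"]) (use B s in auto)
          then show "B \<in> cover ?P {B. Sim X (\<sigma> X (ns ! 2)) (\<sigma> X (ns ! 3)) \<in> B}"
          proof (rule cover_bind)
            fix C assume C: "C \<in> Fpow (props ?P)" "B \<subseteq> C" "C \<in> {B. Sim X (\<sigma> X (ns ! 2)) (ns ! 1) \<in> B}"
            show "C \<in> cover ?P {B. Sim X (\<sigma> X (ns ! 2)) (\<sigma> X (ns ! 3)) \<in> B}"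
              by (rule sim_trans[OF C(1), of _ _ "ns ! 1"]) (use B C s in auto)
          qed auto
        qed auto
        then show ?thesis
          by (rule cover_bind) (use d s in \<open>auto intro: cover_return\<close>)
      next
        case d: 2
        have s: "Sim X (ns ! 0) (\<sigma> X (ns ! 2)) \<in> A" "Sim X (ns ! 1) (\<sigma> X (ns ! 3)) \<in> A"
          "Sim X (\<sigma> X (ns ! 2)) (\<sigma> X (ns ! 3)) \<in> A" using h(2) d by auto
        have "A \<in> cover ?P {B. Sim X (ns ! 0) (ns ! 1) \<in> B}"
        proof (rule cover_bind[OF sim_sym[OF A s(2)]])
          fix B assume B: "B \<in> Fpow (props ?P)" "A \<subseteq> B" "B \<in> {B. Sim X (\<sigma> X (ns ! 3)) (ns ! 1) \<in> B}"
          have "B \<in> cover ?P {B. Sim X (ns ! 0) (\<sigma> X (ns ! 3)) \<in> B}"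
            by (rule sim_trans[OF B(1), of _ _ "\<sigma> X (ns ! 2)"]) (use B s in auto)
          then show "B \<in> cover ?P {B. Sim X (ns ! 0) (ns ! 1) \<in> B}"
          proof (rule cover_bind)
            fix C assume C: "C \<in> Fpow (props ?P)" "B \<subseteq> C" "C \<in> {B. Sim X (ns ! 0) (\<sigma> X (ns ! 3)) \<in> B}"
            show "C \<in> cover ?P {B. Sim X (ns ! 0) (ns ! 1) \<in> B}"
              by (rule sim_trans[OF C(1), of _ _ "\<sigma> X (ns ! 3)"]) (use B C s in auto)
          qed auto
        qed auto
        then show ?thesis
          by (rule cover_bind) (use d s in \<open>auto intro: cover_return\<close>)
      next
        case d: 3
        have "Sim X (\<sigma> X (ns ! 0)) (\<sigma> X (ns ! 0)) \<in> A" using h(1) d by (auto simp: related_def)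
        then show ?thesis using d by (intro cover_return A) auto
      next
        case d: 4
        obtain m where "\<sigma> X m = ns ! 0" using surj[OF c(1)] by (metis surj_def)
        moreover have "Sim X (ns ! 0) (ns ! 0) \<in> A" using h(1) d by (auto simp: related_def)
        ultimately show ?thesis using d by (intro cover_return A) (auto intro!: exI[of _ m])
      qed
    next
      case c: 4
      let ?l = "length (arity T r)"
      let ?ns = "take ?l ns" and ?ms = "drop ?l ns"
      let ?\<alpha> = "Conjs (map (\<lambda>i. Atom (Alpha (arity T r ! i)) [i, ?l + i]) [0..<?l]) :: ('s iso_sort, ('s, 'r) iso_rel, 'i) form"
      let ?\<phi> = "Conj ?\<alpha> (Atom (Rel1 r) [0..<?l])" and ?\<psi> = "Conj ?\<alpha> (Atom (Rel2 r) [?l..<2 * ?l])"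
      have G: "\<Gamma> = map Sort1 (arity T r) @ map Sort2 (arity T r)"
        and fp: "\<phi> = ?\<phi> \<and> \<psi> = ?\<psi> \<or> \<phi> = ?\<psi> \<and> \<psi> = ?\<phi>"
        using c(2) by (auto simp: iso_rel_axioms_def Let_def)
      have l: "length ?ns = ?l" "length ?ms = ?l" using 5(2) G by auto
      note v = iso_rel_val[OF l, unfolded append_take_drop_id]
      have al: "?k -` A \<in> pform_val (inst ?\<alpha> ns)" using h(2) fp by auto
      then have s: "Sim (arity T r ! i) (?ns ! i) (map2 \<sigma> (arity T r) ?ms ! i) \<in> A" if "i < ?l" for i
        using that l unfolding v(1) by auto
      have \<alpha>B: "?k -` B \<in> pform_val (inst ?\<alpha> ns)" if "A \<subseteq> B" for B
        by (rule pform_val_mono[OF al]) (use that in auto)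
      from fp show ?thesis
      proof (elim disjE conjE)
        assume d: "\<phi> = ?\<phi>" "\<psi> = ?\<psi>"
        have "A \<in> cover ?P {B. Holds r (map2 \<sigma> (arity T r) ?ms) \<in> B}"
          by (rule holds_subst[OF A, of _ ?ns]) (use h(2) d v(2) s l in auto)
        then show ?thesis
          by (rule cover_bind) (use d \<alpha>B v(3) in \<open>auto intro: cover_return\<close>)
      next
        assume d: "\<phi> = ?\<psi>" "\<psi> = ?\<phi>"
        have R: "Holds r (map2 \<sigma> (arity T r) ?ms) \<in> A" using h(2) d v(3) by auto
        have "A \<in> cover ?P {B. (\<lambda>i. Sim (arity T r ! i) (map2 \<sigma> (arity T r) ?ms ! i) (?ns ! i)) ` {..<?l} \<subseteq> B}"
          by (rule cover_all[OF _ A]) (use sim_sym[OF A s] in auto)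
        then have "A \<in> cover ?P {B. Holds r ?ns \<in> B}"
        proof (rule cover_bind)
          fix B assume B: "B \<in> Fpow (props ?P)" "A \<subseteq> B"
            "B \<in> {B. (\<lambda>i. Sim (arity T r ! i) (map2 \<sigma> (arity T r) ?ms ! i) (?ns ! i)) ` {..<?l} \<subseteq> B}"
          show "B \<in> cover ?P {B. Holds r ?ns \<in> B}"
            by (rule holds_subst[OF B(1), of _ "map2 \<sigma> (arity T r) ?ms"]) (use R B l in auto)
        qed auto
        then show ?thesis
          by (rule cover_bind) (use d \<alpha>B v(2) in \<open>auto intro: cover_return\<close>)
      qed
    qed
    then show ?thesis using 5 by simp
  qed
qed

text \<open>
  Let \<open>h\<close> be the homomorphism defined by \<open>collapse\<close>.  It satisfies \<open>h \<circ> s = id\<close>, while \<open>h \<circ> t\<close>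
  renumbers, so \<open>h (t D) = h (s D) = D\<close> contains the renumbering of \<open>A\<close>.
\<close>

theorem renumber_equalised:
  fixes T :: "('s, 'r, 'i) geo_theory"
  assumes T: "geometric_theory T" and surj: "\<And>X. X \<in> sorts T \<Longrightarrow> surj (\<sigma> X)"
    and s: "source_map T s" and t: "target_map T t"
    and D: "D \<in> carrier (G0_frame T)" "s D = t D" and A: "A \<in> D"
  shows "renumber T \<sigma> ` A \<in> D"
proof -
  let ?P = "nat_theory T" and ?Q = "nat_theory (iso_theory T)" and ?k = "collapse T \<sigma>"
  have sh: "frame_hom (G0_frame T) (G1_frame T) s" "frame_hom (G0_frame T) (G1_frame T) t"
    using s t by (auto simp: source_map_def target_map_def)
  have kp: "?k p \<in> props ?P" if "p \<in> props ?Q" for p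
    using that by (cases "(T, \<sigma>, p)" rule: collapse.cases)
      (auto simp: props_Sim props_Holds iso_theory_simps)
  have "propositional_theory ?Q"
    by (rule propositional_theory_nat_theory[OF geometric_theory_iso_theory[OF T]])
  then have "\<exists>h. frame_hom (G1_frame T) (G0_frame T) h \<and>
      (\<forall>p\<in>props ?Q. h (generator ?Q p) = generator ?P (?k p))"
    by (rule interpretation_exists) (use kp collapse_axiom[OF T surj] in auto)
  then obtain h where h: "frame_hom (G1_frame T) (G0_frame T) h"
    and hg: "\<And>p. p \<in> props ?Q \<Longrightarrow> h (generator ?Q p) = generator ?P (?k p)" by blast
  have "(h \<circ> s) D = id D"
  proof (rule classifying_frame_hom_unique[OF frame_hom_comp[OF sh(1) h] _ _ D(1)])
    show "frame_hom (G0_frame T) (G0_frame T) id" by (simp add: frame_hom_def)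
    show "(h \<circ> s) (generator ?P p) = id (generator ?P p)" if "p \<in> props ?P" for p
      using source_generator[OF s that] hg[OF copy_props(1)[OF that]] by (simp add: collapse_copy)
  qed
  then have hD: "h (t D) = D" using D(2) by simp
  have "copy2 ` A \<in> t D"
    by (rule hom_image_mem[OF sh(2) copy_props(2) target_generator[OF t] D(1) A])
  from hom_image_mem[OF h kp hg frame_homD(1)[OF sh(2) D(1)] this]
  have "?k ` copy2 ` A \<in> h (t D)" .
  then show ?thesis using hD by (simp add: image_image collapse_copy)
qed

section \<open>Invariant opens are sentences\<close>

text \<open>
  The context binds its first variable innermost, in accordance with de Bruijn indices.
\<close>

primrec exists_closure :: "'s list \<Rightarrow> ('s, 'r, 'i) form \<Rightarrow> ('s, 'r, 'i) form" where
  "exists_closure [] \<theta> = \<theta>"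
| "exists_closure (X # \<Gamma>) \<theta> = exists_closure \<Gamma> (Exists X \<theta>)"

lemma wf_exists_closure: "wf_form T (\<Gamma> @ \<Delta>) \<theta> \<Longrightarrow> set \<Gamma> \<subseteq> sorts T \<Longrightarrow> wf_form T \<Delta> (exists_closure \<Gamma> \<theta>)"
  by (induction \<Gamma> arbitrary: \<theta>) auto

lemma exists_closure_val:
  "B \<in> pform_val (inst (exists_closure \<Gamma> \<theta>) ms) \<longleftrightarrow>
     (\<exists>ns. length ns = length \<Gamma> \<and> related \<Gamma> ns ns B \<and> B \<in> pform_val (inst \<theta> (ns @ ms)))"
proof (induction \<Gamma> arbitrary: \<theta>)
  case Nil
  then show ?case by (simp add: related_def)
next
  case (Cons X \<Gamma>)
  have "(\<exists>ns. length ns = length \<Gamma> \<and> related \<Gamma> ns ns B \<and>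
        (\<exists>n. Sim X n n \<in> B \<and> B \<in> pform_val (inst \<theta> (n # ns @ ms)))) \<longleftrightarrow>
      (\<exists>ns'. length ns' = length (X # \<Gamma>) \<and> related (X # \<Gamma>) ns' ns' B \<and>
        B \<in> pform_val (inst \<theta> (ns' @ ms)))" (is "?L \<longleftrightarrow> ?R")
  proof
    assume ?L
    then obtain ns n where "length ns = length \<Gamma>" "related \<Gamma> ns ns B" "Sim X n n \<in> B"
      "B \<in> pform_val (inst \<theta> (n # ns @ ms))" by auto
    then show ?R by (intro exI[of _ "n # ns"]) (simp add: related_Cons)
  next
    assume ?R
    then obtain ns' where ns': "length ns' = length (X # \<Gamma>)" "related (X # \<Gamma>) ns' ns' B"
      "B \<in> pform_val (inst \<theta> (ns' @ ms))" by auto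
    then obtain n ns where "ns' = n # ns" by (cases ns') auto
    then show ?L using ns' by (intro exI[of _ ns]) (auto simp: related_Cons)
  qed
  then show ?case by (simp add: Cons.IH)
qed

lemma inst_atom_val:
  "B \<in> pform_val (inst (atom T e p) ns) \<longleftrightarrow> renumber T (\<lambda>X n. ns ! e (X, n)) p \<in> B"
  by (cases p) (auto simp: o_def split_def)

lemma renumber_cong:
  "(\<And>X n. (X, n) \<in> names T p \<Longrightarrow> \<sigma> X n = \<sigma>' X n) \<Longrightarrow> renumber T \<sigma> p = renumber T \<sigma>' p"
  by (cases p) auto

lemma renumber_id: "p \<in> props (nat_theory T) \<Longrightarrow> renumber T (\<lambda>X n. n) p = p"
  by (cases p) (auto simp: props_Holds intro!: nth_equalityI)

lemma wf_atom:
  assumes p: "p \<in> props (nat_theory T)"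
    and e: "\<And>X n. (X, n) \<in> names T p \<Longrightarrow> e (X, n) < length \<Gamma> \<and> \<Gamma> ! e (X, n) = X"
  shows "wf_form T \<Gamma> (atom T e p)"
proof (cases p)
  case (Sim X n m)
  then show ?thesis using e by auto
next
  case (Holds r ns)
  then have r: "r \<in> rels T" "length ns = length (arity T r)" using p by (auto simp: props_Holds)
  have "e (arity T r ! i, ns ! i) < length \<Gamma> \<and> \<Gamma> ! e (arity T r ! i, ns ! i) = arity T r ! i"
    if "i < length (arity T r)" for i
    by (rule e) (use that r Holds in \<open>auto simp: set_zip\<close>)
  then show ?thesis unfolding Holds atom.simps wf_Atom using r by auto
qed

lemma name_self:
  assumes A: "A \<in> Fpow (props (nat_theory T))" and p: "p \<in> A" "(X, n) \<in> names T p"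
  shows "A \<in> cover (nat_theory T) {B. Sim X n n \<in> B}"
proof (cases p)
  case (Sim Y m l)
  then show ?thesis using sim_self[OF A, of Y m l] p by auto
next
  case (Holds r ns)
  then obtain i where "i < length (arity T r)" "X = arity T r ! i" "n = ns ! i"
    using p by (auto simp: set_zip)
  then show ?thesis using holds_sim[OF A, of r ns i] p Holds by auto
qed

lemma names_sorts:
  assumes "geometric_theory T" "p \<in> props (nat_theory T)" "(X, n) \<in> names T p"
  shows "X \<in> sorts T"
  using assms by (cases p) (auto simp: props_Sim props_Holds geometric_theory_def dest: set_zip_leftD)

text \<open>
  Only finitely many numbers are prescribed, so the others can be shifted down to cover everything.
\<close>

lemma surj_extension:
  fixes N :: "('s \<times> nat) set" and f :: "'s \<Rightarrow> nat \<Rightarrow> nat"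
  assumes "finite N"
  shows "\<exists>\<sigma>. (\<forall>X. surj (\<sigma> X)) \<and> (\<forall>X n. (X, n) \<in> N \<longrightarrow> \<sigma> X n = f X n)"
proof -
  have "finite (snd ` N)" using assms by simp
  then obtain k where k: "\<forall>n\<in>snd ` N. n < k" using finite_nat_set_iff_bounded by auto
  let ?\<sigma> = "\<lambda>X n. if (X, n) \<in> N then f X n else n - k"
  have "surj (?\<sigma> X)" for X
  proof (rule surjI)
    fix m
    have "(X, k + m) \<notin> N" using k by force
    then show "?\<sigma> X (k + m) = m" by simp
  qed
  then show ?thesis by (intro exI[of _ ?\<sigma>]) auto
qed

text \<open>
  The sentence states that there are elements satisfying the conjunction of \<open>A\<close>, with one
  variable for each number that \<open>A\<close> mentions at a sort.  A choice of numbers for these variables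
  is a renumbering of the finitely many numbers in \<open>A\<close>; distinct numbers may become equal.
\<close>

lemma diagram_sentence:
  fixes T :: "('s, 'r, 'i) geo_theory"
  assumes T: "geometric_theory T" and A: "A \<in> Fpow (props (nat_theory T))"
  obtains \<phi> where "form_in_context T [] \<phi>" "A \<in> cover (nat_theory T) (pform_val (inst \<phi> []))"
    "\<And>B. B \<in> pform_val (inst \<phi> []) \<Longrightarrow> \<exists>\<sigma>. (\<forall>X. surj (\<sigma> X)) \<and> renumber T \<sigma> ` A \<subseteq> B"
proof -
  let ?P = "nat_theory T" and ?N = "\<Union>p\<in>A. names T p"
  have fin: "finite A" "A \<subseteq> props ?P" using A by (auto simp: Fpow_def)
  have finN: "finite ?N" using fin finite_names by auto
  obtain L where L: "set L = ?N" using finite_list[OF finN] by blast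
  obtain as where as: "set as = A" using finite_list[OF fin(1)] by blast
  have "\<forall>s\<in>?N. \<exists>i<length L. L ! i = s" using L by (metis in_set_conv_nth)
  \<comment> \<open>\<open>e\<close> numbers the variables: it picks a position in \<open>L\<close>, which may contain repetitions\<close>
  from bchoice[OF this] obtain e where e: "\<And>s. s \<in> ?N \<Longrightarrow> e s < length L \<and> L ! e s = s" by blast
  let ?\<Gamma> = "map fst L" and ?\<theta> = "Conjs (map (atom T e) as)"
  let ?\<phi> = "exists_closure ?\<Gamma> ?\<theta>"
  have val: "B \<in> pform_val (inst ?\<phi> []) \<longleftrightarrow> (\<exists>ns. length ns = length L \<and> related ?\<Gamma> ns ns B \<and>
      (\<lambda>p. renumber T (\<lambda>X n. ns ! e (X, n)) p) ` A \<subseteq> B)" for B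
    unfolding exists_closure_val Conjs_val using as by (auto simp: inst_atom_val)
  show thesis
  proof (rule that[of ?\<phi>])
    have "wf_form T ?\<Gamma> (atom T e p)" if "p \<in> A" for p
    proof (rule wf_atom)
      show "p \<in> props ?P" using that fin(2) by blast
      fix X n assume "(X, n) \<in> names T p"
      then have "(X, n) \<in> ?N" using that by blast
      from e[OF this] show "e (X, n) < length ?\<Gamma> \<and> ?\<Gamma> ! e (X, n) = X" by simp
    qed
    then have "wf_form T (?\<Gamma> @ []) ?\<theta>" using as by (auto simp: wf_Conjs)
    moreover have "set ?\<Gamma> \<subseteq> sorts T"
    proof
      fix X assume "X \<in> set ?\<Gamma>"
      then obtain n where "(X, n) \<in> set L" by auto
      then have "(X, n) \<in> ?N" unfolding L .
      then obtain p where "p \<in> A" "(X, n) \<in> names T p" by blast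
      then show "X \<in> sorts T" using names_sorts[OF T _ \<open>(X, n) \<in> names T p\<close>] fin(2) by blast
    qed
    ultimately show "form_in_context T [] ?\<phi>" using wf_exists_closure[of T ?\<Gamma> "[]" ?\<theta>] by (simp add: form_in_context_def)
  next
    \<comment> \<open>the witnesses are the original numbers; they denote elements because \<open>A\<close> mentions them\<close>
    let ?ns = "map snd L" and ?Q = "(\<lambda>(X, n). Sim X n n) ` ?N"
    have "A \<in> cover ?P {B. ?Q \<subseteq> B}"
      by (rule cover_all) (use finN A name_self[OF A] in auto)
    then show "A \<in> cover ?P (pform_val (inst ?\<phi> []))"
    proof (rule cover_bind)
      fix B assume B: "B \<in> Fpow (props ?P)" "A \<subseteq> B" "B \<in> {B. ?Q \<subseteq> B}"
      have "Sim (fst (L ! i)) (snd (L ! i)) (snd (L ! i)) \<in> B" if "i < length L" for i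
      proof -
        have "L ! i \<in> ?N" using that L nth_mem by metis
        then have "(case L ! i of (X, n) \<Rightarrow> Sim X n n) \<in> B" using B(3) by blast
        then show ?thesis by (simp add: case_prod_beta)
      qed
      then have 1: "related ?\<Gamma> ?ns ?ns B" by (simp add: related_def)
      have "renumber T (\<lambda>X n. ?ns ! e (X, n)) p = p" if p: "p \<in> A" for p
      proof -
        have "renumber T (\<lambda>X n. ?ns ! e (X, n)) p = renumber T (\<lambda>X n. n) p"
        proof (rule renumber_cong)
          fix X n assume "(X, n) \<in> names T p"
          then have "(X, n) \<in> ?N" using p by blast
          from e[OF this] show "?ns ! e (X, n) = n" by simp
        qed
        then show ?thesis using renumber_id fin(2) p by auto
      qed
      then have "B \<in> pform_val (inst ?\<phi> [])"
        unfolding val using 1 B(2) by (intro exI[of _ ?ns]) auto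
      then show "B \<in> cover ?P (pform_val (inst ?\<phi> []))" by (rule cover_return[OF B(1)])
    qed auto
  next
    fix B assume "B \<in> pform_val (inst ?\<phi> [])"
    then obtain ns where ns: "\<And>p. p \<in> A \<Longrightarrow> renumber T (\<lambda>X n. ns ! e (X, n)) p \<in> B"
      unfolding val by auto
    obtain \<sigma> where \<sigma>: "\<And>X. surj (\<sigma> X)" "\<And>X n. (X, n) \<in> ?N \<Longrightarrow> \<sigma> X n = ns ! e (X, n)"
      using surj_extension[OF finN, of "\<lambda>X n. ns ! e (X, n)"] by blast
    have "renumber T \<sigma> p \<in> B" if p: "p \<in> A" for p
    proof -
      have "renumber T \<sigma> p = renumber T (\<lambda>X n. ns ! e (X, n)) p"
        by (rule renumber_cong) (use \<sigma>(2) p in blast)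
      then show ?thesis using ns[OF p] by simp
    qed
    then show "\<exists>\<sigma>. (\<forall>X. surj (\<sigma> X)) \<and> renumber T \<sigma> ` A \<subseteq> B" using \<sigma>(1) by blast
  qed
qed

text \<open>
  A list is encoded by its length and by the iterated pairing of its entries.
\<close>

lemma inj_lists:
  assumes "infinite (UNIV :: 'i set)"
  shows "\<exists>f :: 'i list \<Rightarrow> 'i. inj f"
proof -
  obtain p :: "'i \<times> 'i \<Rightarrow> 'i" where "bij_betw p (UNIV \<times> UNIV) UNIV"
    using iffD2[OF card_of_ordIso card_of_Times_same_infinite[OF assms]] by blast
  then have p: "inj p" by (simp add: bij_betw_def)
  obtain \<nu> :: "nat \<Rightarrow> 'i" where \<nu>: "inj \<nu>" using infinite_countable_subset[OF assms] by blast
  let ?g = "\<lambda>xs. foldr (\<lambda>x y. p (x, y)) xs (\<nu> 0)"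
  let ?f = "\<lambda>xs. p (\<nu> (length xs), ?g xs)"
  have "xs = ys" if "length xs = length ys" "?g xs = ?g ys" for xs ys :: "'i list"
    using that by (induction xs ys rule: list_induct2) (auto dest: injD[OF p])
  then have "inj ?f" by (auto intro!: injI dest!: injD[OF p] dest: injD[OF \<nu>])
  then show ?thesis by blast
qed

lemma inj_finite_props:
  fixes T :: "('s, 'r, 'i) geo_theory"
  assumes "small_signature T"
  shows "\<exists>c :: ('s, 'r) nat_prop set \<Rightarrow> 'i. inj_on c (Fpow (props (nat_theory T)))"
proof -
  have inf: "infinite (UNIV :: 'i set)" using assms by (simp add: small_signature_def)
  obtain f :: "'s \<Rightarrow> 'i" where f: "inj_on f (sorts T)" using assms by (auto simp: small_signature_def)
  obtain g :: "'r \<Rightarrow> 'i" where g: "inj_on g (rels T)" using assms by (auto simp: small_signature_def)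
  obtain l :: "'i list \<Rightarrow> 'i" where l: "inj l" using inj_lists[OF inf] by blast
  obtain \<nu> :: "nat \<Rightarrow> 'i" where \<nu>: "inj \<nu>" using infinite_countable_subset[OF inf] by blast
  define c :: "('s, 'r) nat_prop \<Rightarrow> 'i" where "c = (\<lambda>p. l (case p of
      Sim X n m \<Rightarrow> [\<nu> 0, f X, \<nu> n, \<nu> m] | Holds r ns \<Rightarrow> \<nu> 1 # g r # map \<nu> ns))"
  have c: "inj_on c (props (nat_theory T))"
  proof (rule inj_onI)
    fix p q assume pq: "p \<in> props (nat_theory T)" "q \<in> props (nat_theory T)" "c p = c q"
    show "p = q"
    proof (cases p; cases q)
      fix X n m Y n' m' assume "p = Sim X n m" "q = Sim Y n' m'"
      then show ?thesis
        using pq by (auto simp: c_def props_Sim dest!: injD[OF l] dest: injD[OF \<nu>] inj_onD[OF f])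
    next
      fix r ns r' ns' assume "p = Holds r ns" "q = Holds r' ns'"
      then show ?thesis
        using pq inj_mapI[OF \<nu>]
        by (auto simp: c_def props_Holds dest!: injD[OF l] dest: inj_onD[OF g] injD)
    qed (use pq in \<open>auto simp: c_def dest!: injD[OF l] dest: injD[OF \<nu>]\<close>)
  qed
  have "\<forall>A\<in>Fpow (props (nat_theory T)). \<exists>xs. set xs = A" using finite_list by (auto simp: Fpow_def)
  then obtain e where e: "\<And>A. A \<in> Fpow (props (nat_theory T)) \<Longrightarrow> set (e A) = A" by metis
  have "inj_on (\<lambda>A. l (map c (e A))) (Fpow (props (nat_theory T)))"
  proof (rule inj_onI)
    fix A B assume AB: "A \<in> Fpow (props (nat_theory T))" "B \<in> Fpow (props (nat_theory T))"
      "l (map c (e A)) = l (map c (e B))"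
    then have "c ` A = c ` B" using injD[OF l] e by (metis list.set_map)
    then show "A = B" using AB inj_on_image_eq_iff[OF c] by (auto simp: Fpow_def)
  qed
  then show ?thesis by blast
qed

text \<open>
  The sentence is the disjunction over all \<open>A \<in> D\<close> of the sentences of \<open>diagram_sentence\<close>.  It
  lies below \<open>D\<close> because \<open>D\<close> is closed under renumbering.
\<close>

theorem equalised_sentence:
  fixes T :: "('s, 'r, 'i) geo_theory"
  assumes T: "geometric_theory T" "small_signature T" and s: "source_map T s" and t: "target_map T t"
    and D: "D \<in> carrier (G0_frame T)" "s D = t D"
  shows "\<exists>\<phi>. form_in_context T [] \<phi> \<and> cover (nat_theory T) (pform_val (inst \<phi> [])) = D"
proof -
  let ?P = "nat_theory T"
  have DI: "theory_ideal ?P D" using D(1) by (simp add: classifying_frame_def)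
  have DF: "D \<subseteq> Fpow (props ?P)" by (rule theory_idealD(1)[OF DI])
  have "\<forall>A\<in>D. \<exists>\<phi>. form_in_context T [] \<phi> \<and> A \<in> cover ?P (pform_val (inst \<phi> [])) \<and>
      (\<forall>B\<in>pform_val (inst \<phi> []). \<exists>\<sigma>. (\<forall>X. surj (\<sigma> X)) \<and> renumber T \<sigma> ` A \<subseteq> B)"
  proof
    fix A assume "A \<in> D"
    then have "A \<in> Fpow (props ?P)" using DF by blast
    from diagram_sentence[OF T(1) this] show "\<exists>\<phi>. form_in_context T [] \<phi> \<and> A \<in> cover ?P (pform_val (inst \<phi> [])) \<and>
      (\<forall>B\<in>pform_val (inst \<phi> []). \<exists>\<sigma>. (\<forall>X. surj (\<sigma> X)) \<and> renumber T \<sigma> ` A \<subseteq> B)" by metis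
  qed
  from bchoice[OF this] obtain F where
    "\<forall>A\<in>D. form_in_context T [] (F A) \<and> A \<in> cover ?P (pform_val (inst (F A) [])) \<and>
      (\<forall>B\<in>pform_val (inst (F A) []). \<exists>\<sigma>. (\<forall>X. surj (\<sigma> X)) \<and> renumber T \<sigma> ` A \<subseteq> B)" by (rule exE)
  then have F: "\<And>A. A \<in> D \<Longrightarrow> form_in_context T [] (F A)"
    "\<And>A. A \<in> D \<Longrightarrow> A \<in> cover ?P (pform_val (inst (F A) []))"
    "\<And>A B. A \<in> D \<Longrightarrow> B \<in> pform_val (inst (F A) []) \<Longrightarrow> \<exists>\<sigma>. (\<forall>X. surj (\<sigma> X)) \<and> renumber T \<sigma> ` A \<subseteq> B"
    by blast+
  obtain c :: "('s, 'r) nat_prop set \<Rightarrow> 'i" where "inj_on c (Fpow (props ?P))"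
    using inj_finite_props[OF T(2)] by blast
  then have c: "inj_on c D" using DF inj_on_subset by blast
  let ?\<phi> = "Disj (c ` D) (\<lambda>i. F (the_inv_into D c i))"
  have val: "B \<in> pform_val (inst ?\<phi> []) \<longleftrightarrow> (\<exists>A\<in>D. B \<in> pform_val (inst (F A) []))" for B
    using the_inv_into_f_f[OF c] by auto
  have ctx: "form_in_context T [] ?\<phi>"
    using F(1) the_inv_into_f_f[OF c] by (auto simp: form_in_context_def)
  have "cover ?P (pform_val (inst ?\<phi> [])) \<subseteq> D"
  proof (rule cover_least[OF DI], rule subsetI)
    fix B assume "B \<in> Fpow (props ?P) \<inter> pform_val (inst ?\<phi> [])"
    then obtain A where A: "B \<in> Fpow (props ?P)" "A \<in> D" "B \<in> pform_val (inst (F A) [])" using val by auto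
    then obtain \<sigma> where \<sigma>: "\<And>X. surj (\<sigma> X)" "renumber T \<sigma> ` A \<subseteq> B" using F(3) by blast
    have "renumber T \<sigma> ` A \<in> D" by (rule renumber_equalised[OF T(1) \<sigma>(1) s t D A(2)])
    then show "B \<in> D" using theory_idealD(2)[OF DI _ A(1) \<sigma>(2)] by blast
  qed
  moreover have "D \<subseteq> cover ?P (pform_val (inst ?\<phi> []))"
  proof
    fix A assume A: "A \<in> D"
    have "pform_val (inst (F A) []) \<subseteq> pform_val (inst ?\<phi> [])" using A val by blast
    then show "A \<in> cover ?P (pform_val (inst ?\<phi> []))" using cover_mono F(2)[OF A] by blast
  qed
  ultimately show ?thesis using ctx by blast
qed

section \<open>Isomorphisms of frames\<close>

text \<open>
  Top, joins and meets are determined by the order, so they can be transported along the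
  isomorphism; \<open>frameI\<close> identifies the transported operations with those of \<open>L\<close>.
\<close>

lemma order_iso_frame:
  fixes L :: "'a gorder" and E :: "'b gorder"
  assumes E: "frame E" and eq: "eq L = (=)" and f: "bij_betw f (carrier L) (carrier E)"
    and le: "\<And>x y. x \<in> carrier L \<Longrightarrow> y \<in> carrier L \<Longrightarrow> x \<sqsubseteq>\<^bsub>L\<^esub> y \<longleftrightarrow> f x \<sqsubseteq>\<^bsub>E\<^esub> f y"
  shows "frame L" "frame_isomorphic E L"
proof -
  interpret E: frame E by (rule E)
  define g where "g = the_inv_into (carrier L) f"
  have g: "bij_betw g (carrier E) (carrier L)" unfolding g_def by (rule bij_betw_the_inv_into[OF f])
  have fc: "\<And>x. x \<in> carrier L \<Longrightarrow> f x \<in> carrier E" and gc: "\<And>y. y \<in> carrier E \<Longrightarrow> g y \<in> carrier L"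
    using f g by (auto simp: bij_betw_def)
  have gf: "\<And>x. x \<in> carrier L \<Longrightarrow> g (f x) = x" and fg: "\<And>y. y \<in> carrier E \<Longrightarrow> f (g y) = y"
    using f by (auto simp: g_def bij_betw_def the_inv_into_f_f f_the_inv_into_f)
  have sub: "\<And>A. A \<subseteq> carrier L \<Longrightarrow> f ` A \<subseteq> carrier E" using fc by auto
  have po: "partial_order L"
  proof
    have "x = y" if "x \<sqsubseteq>\<^bsub>L\<^esub> y" "y \<sqsubseteq>\<^bsub>L\<^esub> x" "x \<in> carrier L" "y \<in> carrier L" for x y
      using that le gf fc E.le_antisym by metis
    then show "x .=\<^bsub>L\<^esub> y" if "x \<sqsubseteq>\<^bsub>L\<^esub> y" "y \<sqsubseteq>\<^bsub>L\<^esub> x" "x \<in> carrier L" "y \<in> carrier L" for x y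
      using that eq by simp
    show "x \<sqsubseteq>\<^bsub>L\<^esub> z" if "x \<sqsubseteq>\<^bsub>L\<^esub> y" "y \<sqsubseteq>\<^bsub>L\<^esub> z" "x \<in> carrier L" "y \<in> carrier L" "z \<in> carrier L" for x y z
      using that le fc E.le_trans[of "f x" "f y" "f z"] by simp
  qed (use le fc eq in auto)
  have top: "g \<top>\<^bsub>E\<^esub> \<in> carrier L" "\<And>x. x \<in> carrier L \<Longrightarrow> x \<sqsubseteq>\<^bsub>L\<^esub> g \<top>\<^bsub>E\<^esub>"
    using gc fc fg le by auto
  have sup: "g (\<Squnion>\<^bsub>E\<^esub>(f ` A)) \<in> carrier L" if "A \<subseteq> carrier L" for A
    using that sub gc by auto
  have up: "a \<sqsubseteq>\<^bsub>L\<^esub> g (\<Squnion>\<^bsub>E\<^esub>(f ` A))" if A: "A \<subseteq> carrier L" "a \<in> A" for A a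
  proof -
    have "f a \<sqsubseteq>\<^bsub>E\<^esub> \<Squnion>\<^bsub>E\<^esub>(f ` A)" by (rule E.sup_upper[OF sub[OF A(1)]]) (use A in auto)
    then show ?thesis using A le[of a] gc fg sub[OF A(1)] by auto
  qed
  have lst: "g (\<Squnion>\<^bsub>E\<^esub>(f ` A)) \<sqsubseteq>\<^bsub>L\<^esub> y"
    if A: "A \<subseteq> carrier L" "y \<in> carrier L" "\<And>a. a \<in> A \<Longrightarrow> a \<sqsubseteq>\<^bsub>L\<^esub> y" for A y
  proof -
    have "\<Squnion>\<^bsub>E\<^esub>(f ` A) \<sqsubseteq>\<^bsub>E\<^esub> f y"
    proof (rule E.sup_least[OF sub[OF A(1)] fc[OF A(2)]])
      fix z assume "z \<in> f ` A"
      then obtain a where a: "a \<in> A" "z = f a" by blast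
      then have "a \<in> carrier L" using A(1) by blast
      from le[OF this A(2)] show "z \<sqsubseteq>\<^bsub>E\<^esub> f y" using A(3)[OF a(1)] a(2) by simp
    qed
    then show ?thesis using A le[of _ y] gc fg sub[OF A(1)] by auto
  qed
  have m: "g (f a \<sqinter>\<^bsub>E\<^esub> f b) \<in> carrier L" "g (f a \<sqinter>\<^bsub>E\<^esub> f b) \<sqsubseteq>\<^bsub>L\<^esub> a" "g (f a \<sqinter>\<^bsub>E\<^esub> f b) \<sqsubseteq>\<^bsub>L\<^esub> b"
    if "a \<in> carrier L" "b \<in> carrier L" for a b
    using that gc fc fg le E.meet_left E.meet_right by auto
  have mg: "y \<sqsubseteq>\<^bsub>L\<^esub> g (f a \<sqinter>\<^bsub>E\<^esub> f b)"
    if "a \<in> carrier L" "b \<in> carrier L" "y \<in> carrier L" "y \<sqsubseteq>\<^bsub>L\<^esub> a" "y \<sqsubseteq>\<^bsub>L\<^esub> b" for a b y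
    using that gc fc fg le E.meet_le by auto
  have d: "g (f x \<sqinter>\<^bsub>E\<^esub> f (g (\<Squnion>\<^bsub>E\<^esub>(f ` A)))) = g (\<Squnion>\<^bsub>E\<^esub>(f ` (\<lambda>a. g (f x \<sqinter>\<^bsub>E\<^esub> f a)) ` A))"
    if x: "x \<in> carrier L" "A \<subseteq> carrier L" for x A
  proof -
    have "f ` (\<lambda>a. g (f x \<sqinter>\<^bsub>E\<^esub> f a)) ` A = (\<lambda>a. f x \<sqinter>\<^bsub>E\<^esub> a) ` f ` A"
      unfolding image_image by (rule image_cong) (use x fc fg in auto)
    then show ?thesis using E.meet_sup_distrib[OF fc[OF x(1)] sub[OF x(2)]] fg sub[OF x(2)] by simp
  qed
  note * = frameI[where L = L and tp = "g \<top>\<^bsub>E\<^esub>" and sp = "\<lambda>A. g (\<Squnion>\<^bsub>E\<^esub>(f ` A))"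
      and mt = "\<lambda>a b. g (f a \<sqinter>\<^bsub>E\<^esub> f b)", OF po top sup up lst m mg d]
  show "frame L" by (rule *(1); assumption)
  have t: "\<top>\<^bsub>L\<^esub> = g \<top>\<^bsub>E\<^esub>" by (rule *(2); assumption)
  have s: "\<And>A. A \<subseteq> carrier L \<Longrightarrow> \<Squnion>\<^bsub>L\<^esub>A = g (\<Squnion>\<^bsub>E\<^esub>(f ` A))" by (rule *(3); assumption)
  have mt: "\<And>a b. a \<in> carrier L \<Longrightarrow> b \<in> carrier L \<Longrightarrow> a \<sqinter>\<^bsub>L\<^esub> b = g (f a \<sqinter>\<^bsub>E\<^esub> f b)"
    by (rule *(4); assumption)
  have "g (\<Squnion>\<^bsub>E\<^esub>A) = \<Squnion>\<^bsub>L\<^esub>(g ` A)" if A: "A \<subseteq> carrier E" for A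
  proof -
    have "f ` g ` A = A" unfolding image_image using A fg by (force simp: subset_iff)
    moreover have "g ` A \<subseteq> carrier L" using A gc by blast
    ultimately show ?thesis using s[of "g ` A"] by simp
  qed
  then have "frame_hom E L g" unfolding frame_hom_def using gc t mt fg by auto
  then show "frame_isomorphic E L" unfolding frame_isomorphic_def using g by blast
qed

text \<open>
  Both frames are coequalisers.  The comparison maps are inverse to each other by the uniqueness
  part of the universal property, applied to \<open>E\<close> itself; this is why the universal property is
  needed for frames with elements of the type of \<open>E\<close>.
\<close>

lemma coequaliser_equaliser_iso:
  fixes L0 :: "'g set set gorder" and E :: "'e gorder"
  assumes L0: "frame L0" and s: "frame_hom L0 L1 s" and t: "frame_hom L0 L1 t"
    and co: "loc_coequaliser TYPE('g set set) L0 L1 s t E q"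
  shows "frame_isomorphic E (equaliser_frame L0 s t)"
proof -
  note Q = equaliser_frame[OF L0 s t]
  let ?Q = "equaliser_frame L0 s t"
  have E: "frame E" and q: "frame_hom E L0 q" and sq: "\<forall>x\<in>carrier E. s (q x) = t (q x)"
    using co by (auto simp: loc_coequaliser_def)
  have qQ: "frame_hom E ?Q q" by (rule Q(4)[OF q sq])
  have "\<forall>x\<in>carrier ?Q. s (id x) = t (id x)" using Q(3) by simp
  then obtain k where k: "frame_hom ?Q E k" "\<And>x. x \<in> carrier ?Q \<Longrightarrow> q (k x) = x"
    using co Q(1,2) unfolding loc_coequaliser_def by (metis id_apply)
  have "loc_coequaliser TYPE('e) L0 L1 s t E q" by (rule loc_coequaliser_any_type[OF L0 s t co])
  then obtain u where u: "\<And>k'. frame_hom E E k' \<Longrightarrow> \<forall>x\<in>carrier E. q (k' x) = q x \<Longrightarrow> \<forall>x\<in>carrier E. k' x = u x"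
    using E q sq unfolding loc_coequaliser_def by metis
  have "frame_hom E E id" by (simp add: frame_hom_def)
  from u[OF this] have idu: "\<forall>x\<in>carrier E. x = u x" by simp
  have qk: "\<forall>x\<in>carrier E. q ((k \<circ> q) x) = q x" using k(2) frame_homD(1)[OF qQ] by simp
  from u[OF frame_hom_comp[OF qQ k(1)] qk] have kq: "\<And>x. x \<in> carrier E \<Longrightarrow> k (q x) = x"
    using idu by simp
  have "bij_betw q (carrier E) (carrier ?Q)"
    by (rule bij_betw_byWitness[where f' = k])
      (use kq k(2) frame_homD(1)[OF qQ] frame_homD(1)[OF k(1)] in auto)
  then show ?thesis unfolding frame_isomorphic_def using qQ by blast
qed

lemma frame_isomorphic_trans:
  "frame_isomorphic L M \<Longrightarrow> frame_isomorphic M N \<Longrightarrow> frame_isomorphic L N"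
  unfolding frame_isomorphic_def using frame_hom_comp bij_betw_trans by metis

section \<open>The frame of isomorphism classes\<close>

theorem mainTheorem4:
  fixes T :: "('s, 'r, 'i) geo_theory"
    and s t :: "('s, 'r) nat_prop set set \<Rightarrow> ('s iso_sort, ('s, 'r) iso_rel) nat_prop set set"
    and pi0 :: "'e gorder"
    and q :: "'e \<Rightarrow> ('s, 'r) nat_prop set set"
  assumes "geometric_theory T" and "small_signature T"
    and "source_map T s" and "target_map T t"
    and "loc_coequaliser TYPE(('s, 'r) nat_prop set set) (G0_frame T) (G1_frame T) s t pi0 q"
  shows "frame (sentence_frame T) \<and> frame_isomorphic pi0 (sentence_frame T)"
proof -
  let ?E = "equaliser_frame (G0_frame T) s t" and ?S = "sentence_frame T"
  let ?V = "\<lambda>\<phi>. cover (nat_theory T) (pform_val (inst \<phi> []))"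
  have hom: "frame_hom (G0_frame T) (G1_frame T) s" "frame_hom (G0_frame T) (G1_frame T) t"
    using assms(3,4) by (auto simp: source_map_def target_map_def)
  note E = equaliser_frame[OF classifying_frame(1) hom]
  have V_le: "?V \<phi> \<subseteq> ?V \<psi> \<longleftrightarrow> proves T [] \<phi> \<psi>" if "\<phi> \<in> sentences T" "\<psi> \<in> sentences T" for \<phi> \<psi>
  proof
    assume "proves T [] \<phi> \<psi>"
    from soundness[OF assms(1) this, of "[]"] show "?V \<phi> \<subseteq> ?V \<psi>"
      by (intro cover_least[OF theory_ideal_cover]) (auto simp: related_def)
  qed (use that conservativity[OF assms(1)] in \<open>auto simp: sentences_def\<close>)
  have V_E: "?V ` sentences T = carrier ?E"
  proof
    show "?V ` sentences T \<subseteq> carrier ?E"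
      using E(3) cover_closed sentence_equalised[OF _ assms(3,4)] by (auto simp: sentences_def)
    show "carrier ?E \<subseteq> ?V ` sentences T"
    proof
      fix D assume "D \<in> carrier ?E"
      then have "D \<in> carrier (G0_frame T)" "s D = t D" using E(3) by auto
      from equalised_sentence[OF assms(1-4) this] show "D \<in> ?V ` sentences T"
        by (auto simp: sentences_def)
    qed
  qed
  let ?R = "provably_equivalent T"
  have R: "(\<phi>, \<psi>) \<in> ?R \<longleftrightarrow> \<phi> \<in> sentences T \<and> \<psi> \<in> sentences T \<and> ?V \<phi> = ?V \<psi>" for \<phi> \<psi>
    using V_le by (auto simp: provably_equivalent_def)
  have equiv: "equiv (sentences T) ?R"
    by (rule equivI) (auto simp: R intro!: refl_onI symI transI)
  define f where "f C = \<Union>(?V ` C)" for C :: "('s, 'r, 'i) form set"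
  have f: "f C = ?V \<phi>" if C: "C \<in> sentences T // ?R" "\<phi> \<in> C" for C \<phi>
  proof -
    have "?V \<psi> = ?V \<phi>" if "\<psi> \<in> C" for \<psi>
      using quotient_eqI[OF equiv C(1,1) that C(2)] quotient_eq_iff[OF equiv C(1,1) that C(2)] R by blast
    then show ?thesis unfolding f_def using C(2) by blast
  qed
  have rep: "\<exists>\<phi>\<in>sentences T. \<phi> \<in> C \<and> C = ?R `` {\<phi>}" if "C \<in> sentences T // ?R" for C
    using that equiv_class_self[OF equiv] by (auto elim!: quotientE)
  have memS: "\<phi> \<in> sentences T" if "C \<in> sentences T // ?R" "\<phi> \<in> C" for C \<phi>
    using that in_quotient_imp_subset[OF equiv] by blast
  have car: "carrier ?S = sentences T // ?R" by (simp add: sentence_frame_def)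
  have f_le: "C \<sqsubseteq>\<^bsub>?S\<^esub> C' \<longleftrightarrow> f C \<sqsubseteq>\<^bsub>?E\<^esub> f C'" if C: "C \<in> carrier ?S" "C' \<in> carrier ?S" for C C'
  proof -
    have C: "C \<in> sentences T // ?R" "C' \<in> sentences T // ?R" using C car by auto
    have pf: "proves T [] \<phi> \<psi> \<longleftrightarrow> f C \<subseteq> f C'" if "\<phi> \<in> C" "\<psi> \<in> C'" for \<phi> \<psi>
      using V_le[OF memS[OF C(1) that(1)] memS[OF C(2) that(2)]] f[OF C(1) that(1)] f[OF C(2) that(2)]
      by simp
    have "C \<sqsubseteq>\<^bsub>?S\<^esub> C' \<longleftrightarrow> (\<exists>\<phi>\<in>C. \<exists>\<psi>\<in>C'. proves T [] \<phi> \<psi>)" by (simp add: sentence_frame_def)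
    also have "\<dots> \<longleftrightarrow> (\<exists>\<phi>\<in>C. \<exists>\<psi>\<in>C'. f C \<subseteq> f C')"
      using pf by (intro bex_cong refl)
    also have "\<dots> \<longleftrightarrow> f C \<subseteq> f C'" using rep C by blast
    also have "\<dots> \<longleftrightarrow> f C \<sqsubseteq>\<^bsub>?E\<^esub> f C'" by (simp add: equaliser_frame_def classifying_frame_def)
    finally show ?thesis .
  qed
  have f_bij: "bij_betw f (carrier ?S) (carrier ?E)"
    unfolding bij_betw_def
  proof
    show "inj_on f (carrier ?S)"
    proof (rule inj_onI)
      fix C C' assume C: "C \<in> carrier ?S" "C' \<in> carrier ?S" "f C = f C'"
      then have q: "C \<in> sentences T // ?R" "C' \<in> sentences T // ?R" by (simp_all add: car)
      obtain \<phi> where \<phi>: "\<phi> \<in> sentences T" "\<phi> \<in> C" "C = ?R `` {\<phi>}" using rep[OF q(1)] by blast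
      obtain \<psi> where \<psi>: "\<psi> \<in> sentences T" "\<psi> \<in> C'" "C' = ?R `` {\<psi>}" using rep[OF q(2)] by blast
      have "(\<phi>, \<psi>) \<in> ?R" unfolding R using f[OF q(1) \<phi>(2)] f[OF q(2) \<psi>(2)] C(3) \<phi>(1) \<psi>(1) by simp
      from equiv_class_eq[OF equiv this] show "C = C'" unfolding \<phi>(3) \<psi>(3) .
    qed
    have "f ` carrier ?S = ?V ` sentences T"
    proof
      show "f ` carrier ?S \<subseteq> ?V ` sentences T"
      proof (rule image_subsetI)
        fix C assume "C \<in> carrier ?S"
        then have q: "C \<in> sentences T // ?R" by (simp add: car)
        obtain \<phi> where \<phi>: "\<phi> \<in> sentences T" "\<phi> \<in> C" using rep[OF q] by blast
        show "f C \<in> ?V ` sentences T" unfolding f[OF q \<phi>(2)] by (rule imageI[OF \<phi>(1)])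
      qed
      show "?V ` sentences T \<subseteq> f ` carrier ?S"
      proof
        fix D assume "D \<in> ?V ` sentences T"
        then obtain \<phi> where \<phi>: "\<phi> \<in> sentences T" "D = ?V \<phi>" by blast
        have q: "?R `` {\<phi>} \<in> sentences T // ?R" by (rule quotientI[OF \<phi>(1)])
        have "D = f (?R `` {\<phi>})" using f[OF q equiv_class_self[OF equiv \<phi>(1)]] \<phi>(2) by simp
        then show "D \<in> f ` carrier ?S" by (rule image_eqI) (simp add: car q)
      qed
    qed
    then show "f ` carrier ?S = carrier ?E" using V_E by simp
  qed
  have "eq ?S = (=)" by (simp add: sentence_frame_def)
  note iso = order_iso_frame[OF E(1) this f_bij f_le]
  have "frame_isomorphic pi0 ?E"
    by (rule coequaliser_equaliser_iso[OF classifying_frame(1) hom assms(5)])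
  then show ?thesis using iso frame_isomorphic_trans by blast
qed

end
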